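(* Let $\Delta$ be a simplicial complex on $[n]$ and let $c$ be the largest integer such that all subsets of $[n]$ of cardinality $c$ are in $\Delta$. If $\Delta$ is bi-Cohen-Macaulay, then its $f$-polynomial is $$f_\Delta(t)=(1+t)^{n-s}f_{s,c}(t)$$ for some integer $s$ with $0\le s\le n$, where $f_{s,c}(t)=1+st+\binom s2t^2+\cdots+\binom sct^c$.
   Context: Let $k$ be a field. A simplicial complex on $[n]=\{1,\dots,n\}$ is a family of subsets of $[n]$ (faces) closed under taking subsets; a face of cardinality $r$ has dimension $r-1$. $\Delta$ is Cohen-Macaulay (over $k$) if its Stanley-Reisner ring $k[\Delta]=k[x_1,\dots,x_n]/(x_{i_1}\cdots x_{i_r} : \{i_1,\dots,i_r\}\notin\Delta)$ is a Cohen-Macaulay ring. The Alexander dual of $\Delta$ is $\Delta^*=\{F\subseteq[n] : [n]\setminus F\notin\Delta\}$. $\Delta$ is bi-Cohen-Macaulay if both $\Delta$ and $\Delta^*$ are Cohen-Macaulay. The $f$-polynomial of $\Delta$ is $f_\Delta(t)=1+f_0t+f_1t^2+\cdots+f_{d-1}t^d$, where $f_i$ is the number of $i$-dimensional faces and $d-1=\dim\Delta$. The polynomial $f_{s,c}$ is the $f$-polynomial of the $(c-1)$-dimensional skeleton of the $(s-1)$-simplex. *)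

theory Defs
  imports
    "HOL-Algebra.Ring_Divisibility"
    "HOL-Library.Poly_Mapping"
    "HOL-Library.Extended_Nat"
    "HOL-Computational_Algebra.Polynomial"
begin

section \<open>Cohen-Macaulay rings\<close>

definition regular_sequence :: "('a, 'b) ring_scheme \<Rightarrow> 'a list \<Rightarrow> bool" where
  "regular_sequence R xs \<longleftrightarrow>
     set xs \<subseteq> carrier R \<and>
     (\<forall>i<length xs. \<forall>a\<in>carrier R.
        xs ! i \<otimes>\<^bsub>R\<^esub> a \<in> Idl\<^bsub>R\<^esub> (set (take i xs)) \<longrightarrow> a \<in> Idl\<^bsub>R\<^esub> (set (take i xs))) \<and>
     Idl\<^bsub>R\<^esub> (set xs) \<noteq> carrier R"

definition ideal_depth :: "('a, 'b) ring_scheme \<Rightarrow> 'a set \<Rightarrow> enat" where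
  "ideal_depth R I = Sup {enat (length xs) | xs. regular_sequence R xs \<and> set xs \<subseteq> I}"

definition prime_chain :: "('a, 'b) ring_scheme \<Rightarrow> nat \<Rightarrow> (nat \<Rightarrow> 'a set) \<Rightarrow> bool" where
  "prime_chain R r C \<longleftrightarrow> (\<forall>i\<le>r. primeideal (C i) R) \<and> (\<forall>i<r. C i \<subset> C (Suc i))"

definition prime_height :: "('a, 'b) ring_scheme \<Rightarrow> 'a set \<Rightarrow> enat" where
  "prime_height R P = Sup {enat r | r. \<exists>C. prime_chain R r C \<and> C r = P}"

text \<open>The definition of Eisenbud, \<^emph>\<open>Commutative Algebra with a View Toward Algebraic
  Geometry\<close>, Section 18.2: a Noetherian ring in which depth and codimension agree at every maximal
  ideal. The zero ring, which is the Stanley-Reisner ring of the void complex (the Alexander dual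
  of a full simplex), has no maximal ideals and thus is Cohen-Macaulay.\<close>

definition cohen_macaulay_ring :: "('a, 'b) ring_scheme \<Rightarrow> bool" where
  "cohen_macaulay_ring R \<longleftrightarrow>
     cring R \<and> noetherian_ring R \<and>
     (\<forall>M. maximalideal M R \<longrightarrow> ideal_depth R M = prime_height R M)"


section \<open>Stanley-Reisner rings\<close>

text \<open>The ring \<open>k[x\<^sub>1, \<dots>, x\<^sub>n]\<close>: a monomial is a finitely supported exponent vector
  \<open>nat \<Rightarrow>\<^sub>0 nat\<close>, a polynomial a finitely supported function from monomials to coefficients, and
  the carrier restricts to the polynomials involving only the variables with index in
  \<open>{1..n}\<close>.\<close>

definition polynomial_ring ::
    "'k::field itself \<Rightarrow> nat \<Rightarrow> ((nat \<Rightarrow>\<^sub>0 nat) \<Rightarrow>\<^sub>0 'k) ring" where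
  "polynomial_ring _ n =
     \<lparr>carrier = {p. \<forall>m\<in>Poly_Mapping.keys p. Poly_Mapping.keys m \<subseteq> {1..n}},
      mult = (*), one = 1, zero = 0, add = (+)\<rparr>"

definition var :: "nat \<Rightarrow> ((nat \<Rightarrow>\<^sub>0 nat) \<Rightarrow>\<^sub>0 'k::field)" where
  "var i = Poly_Mapping.single (Poly_Mapping.single i 1) 1"

definition stanley_reisner_ideal ::
    "'k::field itself \<Rightarrow> nat \<Rightarrow> nat set set \<Rightarrow> ((nat \<Rightarrow>\<^sub>0 nat) \<Rightarrow>\<^sub>0 'k) set" where
  "stanley_reisner_ideal k n \<Delta> =
     Idl\<^bsub>polynomial_ring k n\<^esub> {\<Prod>i\<in>F. var i | F. F \<subseteq> {1..n} \<and> F \<notin> \<Delta>}"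

definition stanley_reisner_ring ::
    "'k::field itself \<Rightarrow> nat \<Rightarrow> nat set set \<Rightarrow> ((nat \<Rightarrow>\<^sub>0 nat) \<Rightarrow>\<^sub>0 'k) set ring" where
  "stanley_reisner_ring k n \<Delta> = polynomial_ring k n Quot stanley_reisner_ideal k n \<Delta>"

lemma cring_polynomial_ring: "cring (polynomial_ring (k :: 'k::field itself) n)"
proof -
  let ?S = "{p :: (nat \<Rightarrow>\<^sub>0 nat) \<Rightarrow>\<^sub>0 'k.
    \<forall>m\<in>Poly_Mapping.keys p. Poly_Mapping.keys m \<subseteq> {1..n}}"
  have add: "p + q \<in> ?S" if "p \<in> ?S" "q \<in> ?S" for p q
    using that Poly_Mapping.keys_add[of p q] by blast
  have mult: "p * q \<in> ?S" if p: "p \<in> ?S" and q: "q \<in> ?S" for p q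
  proof (intro CollectI ballI)
    fix m assume "m \<in> Poly_Mapping.keys (p * q)"
    then obtain a b where ab: "a \<in> Poly_Mapping.keys p" "b \<in> Poly_Mapping.keys q" "m = a + b"
      using keys_mult[of p q] by blast
    have "Poly_Mapping.keys a \<subseteq> {1..n}" "Poly_Mapping.keys b \<subseteq> {1..n}"
      using ab p q by blast+
    then show "Poly_Mapping.keys m \<subseteq> {1..n}"
      using Poly_Mapping.keys_add[of a b] unfolding ab(3) by blast
  qed
  have uminus: "- p \<in> ?S" if "p \<in> ?S" for p
    using that by simp
  have zero: "0 \<in> ?S" and one: "1 \<in> ?S"
    by simp_all
  show ?thesis
    unfolding polynomial_ring_def
  proof (intro cringI abelian_groupI comm_monoidI, goal_cases)
    case (6 x)
    then show ?case
      using uminus by (intro bexI[of _ "- x"]) simp_all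
  qed (use add mult zero one in \<open>simp_all only: partial_object.simps monoid.simps ring.simps
         add_ac mult_ac add_0 add_0_right mult_1 mult_1_right distrib_left distrib_right\<close>)
qed


lemma cring_stanley_reisner_ring: "cring (stanley_reisner_ring (k :: 'k::field itself) n \<Delta>)"
proof -
  let ?S = "polynomial_ring k n"
  interpret S: cring ?S by (rule cring_polynomial_ring)
  have "(\<Prod>i\<in>F. var i) \<in> carrier ?S" if "F \<subseteq> {1..n}" for F
  proof -
    have "finite F" using that finite_subset by blast
    then show ?thesis using that
    proof (induction F)
      case empty
      then show ?case using S.one_closed by (simp add: polynomial_ring_def)
    next
      case (insert i F)
      have "(var i :: (nat \<Rightarrow>\<^sub>0 nat) \<Rightarrow>\<^sub>0 'k) \<in> carrier ?S"
        using insert.prems by (simp add: polynomial_ring_def var_def)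
      then have "var i \<otimes>\<^bsub>?S\<^esub> (\<Prod>i\<in>F. var i) \<in> carrier ?S"
        using insert by (intro S.m_closed) auto
      then show ?case using insert.hyps by (simp add: polynomial_ring_def)
    qed
  qed
  then have "ideal (stanley_reisner_ideal k n \<Delta>) ?S"
    unfolding stanley_reisner_ideal_def by (intro S.genideal_ideal) blast
  then show ?thesis
    unfolding stanley_reisner_ring_def by (rule ideal.quotient_is_cring) (rule S.cring_axioms)
qed


section \<open>Simplicial complexes\<close>

definition simplicial_complex :: "nat \<Rightarrow> nat set set \<Rightarrow> bool" where
  "simplicial_complex n \<Delta> \<longleftrightarrow> \<Delta> \<subseteq> Pow {1..n} \<and> (\<forall>F\<in>\<Delta>. \<forall>G\<subseteq>F. G \<in> \<Delta>)"

definition cohen_macaulay :: "'k::field itself \<Rightarrow> nat \<Rightarrow> nat set set \<Rightarrow> bool" where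
  "cohen_macaulay k n \<Delta> \<longleftrightarrow> cohen_macaulay_ring (stanley_reisner_ring k n \<Delta>)"

definition alexander_dual :: "nat \<Rightarrow> nat set set \<Rightarrow> nat set set" where
  "alexander_dual n \<Delta> = {F. F \<subseteq> {1..n} \<and> {1..n} - F \<notin> \<Delta>}"

definition bi_cohen_macaulay :: "'k::field itself \<Rightarrow> nat \<Rightarrow> nat set set \<Rightarrow> bool" where
  "bi_cohen_macaulay k n \<Delta> \<longleftrightarrow>
     cohen_macaulay k n \<Delta> \<and> cohen_macaulay k n (alexander_dual n \<Delta>)"

definition face_number :: "nat set set \<Rightarrow> nat \<Rightarrow> nat" where
  "face_number \<Delta> i = card {F \<in> \<Delta>. card F = Suc i}"

text \<open>\<open>Max (card ` \<Delta>)\<close> is \<open>d = dim \<Delta> + 1\<close>; this and the constant coefficient 1 presuppose that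
  the empty set is a face.\<close>

definition f_polynomial :: "nat set set \<Rightarrow> int poly" where
  "f_polynomial \<Delta> =
     1 + (\<Sum>i<Max (card ` \<Delta>). Polynomial.monom (int (face_number \<Delta> i)) (Suc i))"

definition skeleton_f_polynomial :: "nat \<Rightarrow> nat \<Rightarrow> int poly" where
  "skeleton_f_polynomial s c = (\<Sum>i\<le>c. Polynomial.monom (int (s choose i)) i)"

end

theory Submission
  imports Defs "HOL-Computational_Algebra.Polynomial_FPS"
begin

text \<open>Write \<open>h(t) = \<Sum>\<^bsub>F \<in> \<Delta>\<^esub> t\<^bsup>|F|\<^esup> (1 - t)\<^bsup>d - |F|\<^esup>\<close> with \<open>d = dim \<Delta> + 1\<close>. Alexander duality is the
  polynomial identity \<open>(1 - t)\<^bsup>n - d\<^esup> h(t) + t\<^bsup>c + 1\<^esup> h\<^sup>*(1 - t) = 1\<close>, where \<open>h\<^sup>*\<close> belongs to the dual complex.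
  The claimed \<open>f\<close>-polynomial corresponds to the solution of least degree of this Bezout equation, so \<open>h\<close>
  differs from it by some \<open>t\<^bsup>c + 1\<^esup> r(t)\<close>. If \<open>h\<close> and \<open>h\<^sup>*\<close> have nonnegative coefficients, then so has
  \<open>r\<close>, while the coefficient of \<open>h\<^sup>*\<close> in degree \<open>n - d\<close> is \<open>- r(1)\<close>; hence \<open>r = 0\<close>.

  That the Cohen-Macaulay property makes \<open>h\<close> nonnegative needs a regular sequence of linear forms, whereas
  depth only provides some regular sequence of length \<open>d\<close> in the irrelevant ideal, and \<open>k\<close> may be finite. After
  adjoining new variables \<open>u\<^sub>j\<close>, the generic form \<open>\<Sum>\<^sub>j u\<^sub>j x\<^sub>j\<close> can be exchanged for the last element of the
  given sequence and moved to the front. Repeating this yields \<open>d\<close> generic forms, which are homogeneous in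
  \<open>x\<close> and in \<open>u\<close>, and \<open>h\<close> appears as the limit of the bigraded Hilbert functions of the quotient by them, normalised by
  the number of monomials in \<open>u\<close>.\<close>

text \<open>Genericity replaces the usual passage to an infinite field. An element of the irrelevant
  ideal is a sum of multiples \<open>h j * var j\<close> with polynomials \<open>h j\<close> of any
  degree, hence a specialisation of the generic form; this is why inhomogeneous elements can be
  exchanged for it. The price is the second grading: a generic form has bidegree (1, 1), so dividing
  by a regular one replaces H(i, b) by H(i, b) - H(i - 1, b - 1), and the shift in b becomes
  harmless only after normalisation and passage to the limit. The exponent c + 1 reflects the
  dimension of the dual: its largest faces are the complements of the smallest nonfaces, which have
  c + 1 elements. The solution of least degree comes from cutting the expansion of (t + (1 - t))^s
  after the term c, and this works for s = n - d + c. The full simplex, whose dual is void, is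
  treated apart.\<close>

lemma poly_mapping_sum_single:
  fixes p :: "'m \<Rightarrow>\<^sub>0 'a::comm_monoid_add"
  shows "p = (\<Sum>m\<in>Poly_Mapping.keys p. Poly_Mapping.single m (Poly_Mapping.lookup p m))"
proof (rule poly_mapping_eqI)
  fix k
  show "Poly_Mapping.lookup p k = Poly_Mapping.lookup
    (\<Sum>m\<in>Poly_Mapping.keys p. Poly_Mapping.single m (Poly_Mapping.lookup p m)) k"
    by (cases "k \<in> Poly_Mapping.keys p")
       (simp_all add: lookup_sum lookup_single when_def in_keys_iff sum.delta')
qed

lemma poly_mapping_single_induct [case_names zero single add]:
  fixes p :: "'m \<Rightarrow>\<^sub>0 'a::comm_monoid_add"
  assumes "P 0" and "\<And>m a. P (Poly_Mapping.single m a)"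
    and "\<And>p q. P p \<Longrightarrow> P q \<Longrightarrow> P (p + q)"
  shows "P p"
proof -
  have "P (\<Sum>m\<in>M. Poly_Mapping.single m (Poly_Mapping.lookup p m))" if "finite M" for M
    using that by (induction M) (use assms in auto)
  from this[OF finite_keys] show ?thesis
    by (subst poly_mapping_sum_single)
qed

section \<open>Evaluation homomorphisms\<close>

definition monomial_eval :: "(nat \<Rightarrow> 'b::comm_ring_1) \<Rightarrow> (nat \<Rightarrow>\<^sub>0 nat) \<Rightarrow> 'b" where
  "monomial_eval v m = (\<Prod>i\<in>Poly_Mapping.keys m. v i ^ Poly_Mapping.lookup m i)"

lemma monomial_eval_superset:
  assumes "finite A" "Poly_Mapping.keys m \<subseteq> A"
  shows "monomial_eval v m = (\<Prod>i\<in>A. v i ^ Poly_Mapping.lookup m i)"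
  unfolding monomial_eval_def
  by (rule prod.mono_neutral_left) (use assms in \<open>auto simp: in_keys_iff\<close>)

lemma monomial_eval_0 [simp]: "monomial_eval v 0 = 1"
  by (simp add: monomial_eval_def)

lemma monomial_eval_add: "monomial_eval v (a + b) = monomial_eval v a * monomial_eval v b"
proof -
  let ?A = "Poly_Mapping.keys a \<union> Poly_Mapping.keys b"
  have "Poly_Mapping.keys (a + b) \<subseteq> ?A" by (rule Poly_Mapping.keys_add)
  then show ?thesis
    by (simp add: monomial_eval_superset[of ?A] lookup_add power_add prod.distrib)
qed

lemma monomial_eval_single [simp]: "monomial_eval v (Poly_Mapping.single i e) = v i ^ e"
  by (simp add: monomial_eval_def)

locale coefficient_hom =
  fixes c :: "'a::comm_ring_1 \<Rightarrow> 'b::comm_ring_1"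
  assumes c_0 [simp]: "c 0 = 0" and c_1 [simp]: "c 1 = 1"
    and c_add: "c (x + y) = c x + c y" and c_mult: "c (x * y) = c x * c y"
begin

definition eval :: "(nat \<Rightarrow> 'b) \<Rightarrow> ((nat \<Rightarrow>\<^sub>0 nat) \<Rightarrow>\<^sub>0 'a) \<Rightarrow> 'b" where
  "eval v p = (\<Sum>m\<in>Poly_Mapping.keys p. c (Poly_Mapping.lookup p m) * monomial_eval v m)"

lemma eval_superset:
  assumes "finite A" "Poly_Mapping.keys p \<subseteq> A"
  shows "eval v p = (\<Sum>m\<in>A. c (Poly_Mapping.lookup p m) * monomial_eval v m)"
  unfolding eval_def
  by (rule sum.mono_neutral_left) (use assms in \<open>auto simp: in_keys_iff\<close>)

lemma eval_0 [simp]: "eval v 0 = 0"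
  by (simp add: eval_def)

lemma eval_single: "eval v (Poly_Mapping.single m a) = c a * monomial_eval v m"
  by (simp add: eval_def)

lemma eval_add: "eval v (p + q) = eval v p + eval v q"
proof -
  let ?A = "Poly_Mapping.keys p \<union> Poly_Mapping.keys q"
  have "Poly_Mapping.keys (p + q) \<subseteq> ?A" by (rule Poly_Mapping.keys_add)
  then show ?thesis
    by (simp add: eval_superset[of ?A] lookup_add c_add distrib_right sum.distrib)
qed

lemma eval_mult: "eval v (p * q) = eval v p * eval v q"
proof (induction p rule: poly_mapping_single_induct)
  case (single m a)
  show ?case
    by (induction q rule: poly_mapping_single_induct)
       (simp_all add: mult_single eval_single c_mult monomial_eval_add distrib_left eval_add)
qed (simp_all add: distrib_right eval_add)

lemma eval_sum: "eval v (sum f A) = (\<Sum>i\<in>A. eval v (f i))"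
  by (induction A rule: infinite_finite_induct) (simp_all add: eval_add)

lemma eval_var [simp]: "eval v (Poly_Mapping.single (Poly_Mapping.single i 1) 1) = v i"
  by (simp add: eval_single)

end

section \<open>Extracting coefficients\<close>

text \<open>For m = 0 this is the projection onto the span of the monomials in \<open>A\<close>. For
  \<open>A\<close> the monomials in some variables and \<open>m\<close> a monomial in the others, it
  is the coefficient of \<open>m\<close> over the polynomial ring in the former.\<close>

definition part :: "'m set \<Rightarrow> 'm \<Rightarrow> ('m \<Rightarrow>\<^sub>0 'a) \<Rightarrow> ('m::cancel_comm_monoid_add \<Rightarrow>\<^sub>0 'a::comm_ring_1)" where
  "part A m p =
     Abs_poly_mapping (\<lambda>b. if b \<in> A then Poly_Mapping.lookup p (b + m) else 0)"

lemma lookup_part: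
  "Poly_Mapping.lookup (part A m p) b = (if b \<in> A then Poly_Mapping.lookup p (b + m) else 0)"
proof -
  have "finite ((\<lambda>b. b + m) -` Poly_Mapping.keys p)"
    by (rule finite_vimageI) (auto intro: injI)
  then have "finite {b. (if b \<in> A then Poly_Mapping.lookup p (b + m) else 0) \<noteq> 0}"
    by (rule rev_finite_subset) (auto simp: in_keys_iff)
  then show ?thesis
    unfolding part_def by simp
qed

lemma part_0 [simp]: "part A m 0 = 0"
  by (rule poly_mapping_eqI) (simp add: lookup_part)

lemma part_add: "part A m (p + q) = part A m p + part A m q"
  by (rule poly_mapping_eqI) (simp add: lookup_part lookup_add)

lemma part_sum: "part A m (sum f I) = (\<Sum>i\<in>I. part A m (f i))"
  by (induction I rule: infinite_finite_induct) (simp_all add: part_add)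

lemma keys_part: "Poly_Mapping.keys (part A m p) = {b \<in> A. b + m \<in> Poly_Mapping.keys p}"
  by (auto simp: in_keys_iff lookup_part split: if_splits)

lemma part_single_in:
  "b \<in> A \<Longrightarrow> part A m (Poly_Mapping.single (b + m) a) = Poly_Mapping.single b a"
  by (rule poly_mapping_eqI) (auto simp: lookup_part lookup_single when_def)

lemma part_single_notin:
  "\<not> (\<exists>b\<in>A. b + m = c) \<Longrightarrow> part A m (Poly_Mapping.single c a) = 0"
  by (rule poly_mapping_eqI) (auto simp: lookup_part lookup_single when_def)

text \<open>By the hypothesis, multiplication by a monomial of \<open>y\<close> turns the selection
  \<open>B\<close> into the selection \<open>A\<close>, so \<open>y\<close> can be pulled out. The
  two sets differ when \<open>y\<close> raises a degree; \<open>B\<close> is empty when no multiple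
  of \<open>y\<close> reaches the selected degree.\<close>

lemma part_mult:
  assumes "\<And>a c. a \<in> Poly_Mapping.keys y \<Longrightarrow> (\<exists>b\<in>A. b + m = a + c) \<longleftrightarrow> (\<exists>b\<in>B. b + m = c)"
  shows "part A m (y * p) = y * part B m p"
proof -
  have single: "part A m (Poly_Mapping.single a r * p) = Poly_Mapping.single a r * part B m p"
    if a: "a \<in> Poly_Mapping.keys y" for a r p
  proof (induction p rule: poly_mapping_single_induct)
    case (single c s)
    show ?case
    proof (cases "\<exists>b\<in>B. b + m = c")
      case True
      then obtain b where b: "b \<in> B" "c = b + m" by blast
      with assms[OF a, of c] obtain b' where b': "b' \<in> A" "b' + m = a + c" by blast
      then have "b' = a + b" using b(2) by (metis add.assoc add_right_cancel)
      then show ?thesis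
        using part_single_in[OF b(1), of m s] part_single_in[OF b'(1), of m "r * s"] b b'
        by (simp add: mult_single)
    next
      case False
      with assms[OF a, of c] show ?thesis
        by (simp add: mult_single part_single_notin)
    qed
  qed (simp_all add: distrib_left part_add)
  have "part A m (y * p) =
      part A m (\<Sum>a\<in>Poly_Mapping.keys y. Poly_Mapping.single a (Poly_Mapping.lookup y a) * p)"
    by (subst poly_mapping_sum_single[of y]) (simp only: sum_distrib_right)
  also have "\<dots> = (\<Sum>a\<in>Poly_Mapping.keys y.
      Poly_Mapping.single a (Poly_Mapping.lookup y a) * part B m p)"
    by (simp add: part_sum single)
  also have "\<dots> = y * part B m p"
    by (subst (3) poly_mapping_sum_single[of y]) (simp only: sum_distrib_right)
  finally show ?thesis .
qed

section \<open>Regular sequences modulo an ideal\<close>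

text \<open>Ideals of a whole type. For polynomials this is the ring in infinitely many variables,
  where the new variables are available without a change of ring.\<close>

definition ideal_of_ring :: "'a::comm_ring_1 set \<Rightarrow> bool" where
  "ideal_of_ring J \<longleftrightarrow> 0 \<in> J \<and> (\<forall>a\<in>J. \<forall>b\<in>J. a + b \<in> J) \<and> (\<forall>a\<in>J. \<forall>r. r * a \<in> J)"

definition nonzerodivisor_mod :: "'a::comm_ring_1 set \<Rightarrow> 'a \<Rightarrow> bool" where
  "nonzerodivisor_mod J f \<longleftrightarrow> (\<forall>a. f * a \<in> J \<longrightarrow> a \<in> J)"

definition adjoin :: "'a::comm_ring_1 set \<Rightarrow> 'a \<Rightarrow> 'a set" where
  "adjoin J f = {a + f * b | a b. a \<in> J}"

text \<open>Weakly regular sequences: the dimension counts below rest on injectivity of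
  multiplication modulo the preceding ideal.\<close>

fun regular_mod :: "'a::comm_ring_1 set \<Rightarrow> 'a list \<Rightarrow> bool" where
  "regular_mod J [] = True"
| "regular_mod J (y # ys) \<longleftrightarrow> nonzerodivisor_mod J y \<and> regular_mod (adjoin J y) ys"

lemma ideal_of_ring_zero: "ideal_of_ring J \<Longrightarrow> 0 \<in> J"
  and ideal_of_ring_add: "ideal_of_ring J \<Longrightarrow> a \<in> J \<Longrightarrow> b \<in> J \<Longrightarrow> a + b \<in> J"
  and ideal_of_ring_mult: "ideal_of_ring J \<Longrightarrow> a \<in> J \<Longrightarrow> r * a \<in> J"
  by (auto simp: ideal_of_ring_def)

lemma ideal_of_ring_diff: "ideal_of_ring J \<Longrightarrow> a \<in> J \<Longrightarrow> b \<in> J \<Longrightarrow> a - b \<in> J"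
  using ideal_of_ring_add[of J a "- b"] ideal_of_ring_mult[of J b "- 1"] by simp

lemma ideal_of_ring_sum:
  assumes "ideal_of_ring J" and "\<forall>i\<in>A. f i \<in> J"
  shows "sum f A \<in> J"
  using assms(2)
proof (induction A rule: infinite_finite_induct)
  case (insert x A)
  have "f x + sum f A \<in> J"
    by (rule ideal_of_ring_add[OF assms(1)]) (use insert in auto)
  then show ?case using insert.hyps by simp
qed (simp_all add: ideal_of_ring_zero[OF assms(1)])

lemma ideal_of_ring_adjoin: "ideal_of_ring J \<Longrightarrow> ideal_of_ring (adjoin J f)"
  unfolding ideal_of_ring_def adjoin_def
proof (intro conjI ballI allI, goal_cases)
  case 1
  then show ?case by (metis (mono_tags, lifting) add_0 mem_Collect_eq mult_zero_right)
next
  case (2 a b)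
  then obtain p q r s where "p \<in> J" "r \<in> J" "a = p + f * q" "b = r + f * s" by blast
  moreover from this have "a + b = (p + r) + f * (q + s)" by (simp add: algebra_simps)
  ultimately show ?case using 2 by blast
next
  case (3 a t)
  then obtain p q where "p \<in> J" "a = p + f * q" by blast
  moreover from this have "t * a = t * p + f * (t * q)" by (simp add: algebra_simps)
  ultimately show ?case using 3 by blast
qed

lemma subset_adjoin: "J \<subseteq> adjoin J f"
proof
  fix a assume "a \<in> J"
  moreover have "a = a + f * 0" by simp
  ultimately show "a \<in> adjoin J f" unfolding adjoin_def by blast
qed

lemma mult_in_adjoin:
  fixes J :: "'a::comm_ring_1 set"
  shows "ideal_of_ring J \<Longrightarrow> f * b \<in> adjoin J f"
proof -
  assume "ideal_of_ring J"
  then have "0 \<in> J" by (rule ideal_of_ring_zero)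
  moreover have "f * b = 0 + f * b" by simp
  ultimately show ?thesis unfolding adjoin_def by blast
qed

lemma adjoin_commute: "adjoin (adjoin J f) g = adjoin (adjoin J g) f"
proof -
  have "adjoin (adjoin J f) g \<subseteq> adjoin (adjoin J g) f" for f g
  proof
    fix x assume "x \<in> adjoin (adjoin J f) g"
    then obtain a b c where "a \<in> J" "x = a + f * b + g * c"
      unfolding adjoin_def by blast
    moreover from this have "x = (a + g * c) + f * b" by (simp add: algebra_simps)
    ultimately show "x \<in> adjoin (adjoin J g) f" unfolding adjoin_def by blast
  qed
  then show ?thesis by blast
qed

text \<open>In a relation f a = j + g b, the element g b lies in (J, f), so b = i + f c; then f can
  be cancelled from f (a - g c) = j + g i, and a agrees with g c modulo J.\<close>

lemma nonzerodivisor_mod_swap: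
  assumes J: "ideal_of_ring J" and f: "nonzerodivisor_mod J f" and g: "nonzerodivisor_mod J g"
    and fg: "nonzerodivisor_mod (adjoin J f) g"
  shows "nonzerodivisor_mod (adjoin J g) f"
  unfolding nonzerodivisor_mod_def
proof (intro allI impI)
  fix a assume "f * a \<in> adjoin J g"
  then obtain j b where j: "j \<in> J" and jb: "f * a = j + g * b"
    unfolding adjoin_def by blast
  have "g * b = (- j) + f * a" using jb by (simp add: algebra_simps)
  moreover have "- j \<in> J" using ideal_of_ring_mult[OF J j, of "- 1"] by simp
  ultimately have "g * b \<in> adjoin J f" unfolding adjoin_def by blast
  then have "b \<in> adjoin J f" using fg by (simp add: nonzerodivisor_mod_def)
  then obtain i c where i: "i \<in> J" and ic: "b = i + f * c" unfolding adjoin_def by blast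
  have "f * (a - g * c) = j + g * i" using jb ic by (simp add: algebra_simps)
  then have "f * (a - g * c) \<in> J"
    using J j i by (simp add: ideal_of_ring_add ideal_of_ring_mult)
  then have "a - g * c \<in> J" using f by (simp add: nonzerodivisor_mod_def)
  moreover have "a = (a - g * c) + g * c" by simp
  ultimately show "a \<in> adjoin J g" unfolding adjoin_def by blast
qed

text \<open>An element that is a nonzerodivisor modulo all initial segments can replace the last
  element of a regular sequence and then be moved to the front.\<close>

lemma regular_mod_exchange:
  assumes "ideal_of_ring J" "regular_mod J ys" "ys \<noteq> []"
    and "\<And>i. i < length ys \<Longrightarrow> nonzerodivisor_mod (foldl adjoin J (take i ys)) g"
  shows "regular_mod (adjoin J g) (butlast ys)"
  using assms
proof (induction ys arbitrary: J)
  case (Cons y ys)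
  note J = Cons.prems(1)
  have y: "nonzerodivisor_mod J y" and ys: "regular_mod (adjoin J y) ys"
    using Cons.prems(2) by simp_all
  have g: "nonzerodivisor_mod J g"
    using Cons.prems(4)[of 0] by simp
  show ?case
  proof (cases "ys = []")
    case False
    have "nonzerodivisor_mod (foldl adjoin (adjoin J y) (take i ys)) g" if "i < length ys" for i
      using Cons.prems(4)[of "Suc i"] that by simp
    from Cons.IH[OF ideal_of_ring_adjoin[OF J] ys False this]
    have 1: "regular_mod (adjoin (adjoin J g) y) (butlast ys)"
      by (simp add: adjoin_commute[of J g y])
    have "nonzerodivisor_mod (adjoin J y) g"
      using Cons.prems(4)[of "Suc 0"] False by simp
    then have 2: "nonzerodivisor_mod (adjoin J g) y"
      using J y g by (rule_tac nonzerodivisor_mod_swap)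
    have "butlast (y # ys) = y # butlast ys" using False by simp
    then show ?thesis using 1 2 by simp
  next
    case True
    then show ?thesis by simp
  qed
qed simp

text \<open>The leading coefficient \<open>f\<close> is cancelled from the top down: the product has
  the coefficient g p_(i+1) + f p_i in degree i + 1, and p_(i+1) is already known to lie in
  J.\<close>

lemma nonzerodivisor_mod_linear:
  fixes J :: "'a::comm_ring_1 set"
  assumes J: "ideal_of_ring J" and f: "nonzerodivisor_mod J f"
    and p: "\<forall>i. coeff ([:g, f:] * p) i \<in> J"
  shows "\<forall>i. coeff p i \<in> J"
proof -
  \<comment> \<open>Descending induction on the index, started one above the degree, where the
    coefficient vanishes; for large k the truncated subtraction stays at index 0.\<close>
  have "coeff p (Suc (degree p) - k) \<in> J" for k
  proof (induction k)
    case 0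
    then show ?case using J by (simp add: coeff_eq_0 ideal_of_ring_zero)
  next
    case (Suc k)
    show ?case
    proof (cases "k < Suc (degree p)")
      case True
      then obtain i where i: "Suc (degree p) - k = Suc i" "Suc (degree p) - Suc k = i"
        by (metis Suc_diff_Suc)
      have "coeff ([:g, f:] * p) (Suc i) = g * coeff p (Suc i) + f * coeff p i"
        by (simp add: mult_pCons_left coeff_pCons)
      moreover have "g * coeff p (Suc i) \<in> J"
        using Suc i J by (simp add: ideal_of_ring_mult)
      ultimately have "f * coeff p i \<in> J"
        using p ideal_of_ring_diff[OF J] by (metis add_diff_cancel_left')
      then show ?thesis using f i by (simp add: nonzerodivisor_mod_def)
    next
      case False
      then show ?thesis using Suc by simp
    qed
  qed
  then have "coeff p i \<in> J" if "i \<le> degree p" for i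
    using that by (metis diff_diff_cancel le_SucI)
  then show ?thesis
    using J by (metis coeff_eq_0 ideal_of_ring_zero not_le)
qed

section \<open>Generic linear forms\<close>

definition supported :: "nat set \<Rightarrow> ((nat \<Rightarrow>\<^sub>0 nat) \<Rightarrow>\<^sub>0 'k::zero) \<Rightarrow> bool" where
  "supported V p \<longleftrightarrow> (\<forall>m\<in>Poly_Mapping.keys p. Poly_Mapping.keys m \<subseteq> V)"

lemma var_power: "(var i :: (nat \<Rightarrow>\<^sub>0 nat) \<Rightarrow>\<^sub>0 'k::field) ^ e = Poly_Mapping.single (Poly_Mapping.single i e) 1"
  by (induction e) (simp_all add: var_def mult_single single_add[symmetric])

lemma prod_single:
  "(\<Prod>i\<in>A. Poly_Mapping.single (f i :: 'm::comm_monoid_add) (1::'k::comm_ring_1)) = Poly_Mapping.single (\<Sum>i\<in>A. f i) 1"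
  by (induction A rule: infinite_finite_induct) (simp_all add: mult_single)

lemma prod_var_power:
  "(\<Prod>i\<in>A. (var i :: (nat \<Rightarrow>\<^sub>0 nat) \<Rightarrow>\<^sub>0 'k::field) ^ e i) =
     Poly_Mapping.single (\<Sum>i\<in>A. Poly_Mapping.single i (e i)) 1"
  by (simp add: var_power prod_single)

lemma monomial_eval_var:
  "monomial_eval var m = (Poly_Mapping.single m 1 :: (nat \<Rightarrow>\<^sub>0 nat) \<Rightarrow>\<^sub>0 'k::field)"
  unfolding monomial_eval_def prod_var_power poly_mapping_sum_single[symmetric] ..

lemma prod_const_poly: "(\<Prod>i\<in>A. [:f i:]) = [:\<Prod>i\<in>A. f i:]"
  by (induction A rule: infinite_finite_induct) (simp_all add: one_pCons mult.commute)

text \<open>Substitutions take values in univariate polynomials over the multivariate ring; the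
  additional variable is the deformation parameter w of
  \<open>nonzerodivisor_mod_generic\<close>.\<close>

interpretation poly_eval: coefficient_hom
  "\<lambda>a. [:Poly_Mapping.single (0 :: nat \<Rightarrow>\<^sub>0 nat) (a :: 'k::field):]"
  by unfold_locales (simp_all add: one_pCons single_add mult_single mult.commute)

lemma poly_eval_supported:
  assumes "supported V p" "\<forall>i\<in>V. v i = [:var i:]"
  shows "poly_eval.eval v p = [:p:]"
proof -
  have "poly_eval.eval v (Poly_Mapping.single m a) = [:Poly_Mapping.single m a:]"
    if "Poly_Mapping.keys m \<subseteq> V" for m a
  proof -
    have "monomial_eval v m = (\<Prod>i\<in>Poly_Mapping.keys m. [:var i ^ Poly_Mapping.lookup m i:])"
      unfolding monomial_eval_def
      by (rule prod.cong) (use that assms(2) in \<open>auto simp: poly_const_pow\<close>)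
    then show ?thesis
      by (simp add: poly_eval.eval_single prod_const_poly monomial_eval_def[symmetric]
          monomial_eval_var mult_single)
  qed
  then have "(\<Sum>m\<in>Poly_Mapping.keys p. poly_eval.eval v (Poly_Mapping.single m (Poly_Mapping.lookup p m)))
    = (\<Sum>m\<in>Poly_Mapping.keys p. [:Poly_Mapping.single m (Poly_Mapping.lookup p m):])"
    using assms(1) by (intro sum.cong) (simp_all add: supported_def)
  also have "\<dots> = [:\<Sum>m\<in>Poly_Mapping.keys p. Poly_Mapping.single m (Poly_Mapping.lookup p m):]"
    by (induction "Poly_Mapping.keys p" rule: infinite_finite_induct)
       (simp_all add: sum_to_poly)
  finally show ?thesis
    unfolding poly_eval.eval_sum[symmetric] poly_mapping_sum_single[symmetric] .
qed

text \<open>Setting w = 0 undoes the deformation, so \<open>p\<close> itself is recovered as the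
  constant coefficient in w.\<close>

lemma poly_eval_at_0:
  assumes "\<And>i. poly (v i) 0 = var i"
  shows "poly (poly_eval.eval v p) 0 = p"
proof -
  have "poly (monomial_eval v m) 0 = Poly_Mapping.single m 1" for m
    unfolding monomial_eval_var[symmetric] by (simp add: monomial_eval_def poly_prod assms)
  then have "poly (poly_eval.eval v p) 0 =
      (\<Sum>m\<in>Poly_Mapping.keys p. Poly_Mapping.single m (Poly_Mapping.lookup p m))"
    by (simp add: poly_eval.eval_def poly_sum mult_single)
  then show ?thesis by (simp add: poly_mapping_sum_single[symmetric])
qed

text \<open>The ideal \<open>J\<close> is extended from the polynomial ring in the variables \<open>V\<close>; this is expressed by
  invariance under all substitutions fixing these variables.\<close>

definition substitution_stable :: "nat set \<Rightarrow> ((nat \<Rightarrow>\<^sub>0 nat) \<Rightarrow>\<^sub>0 'k::field) set \<Rightarrow> bool" where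
  "substitution_stable V J \<longleftrightarrow>
     (\<forall>v. (\<forall>i\<in>V. v i = [:var i:]) \<longrightarrow> (\<forall>p\<in>J. \<forall>l. coeff (poly_eval.eval v p) l \<in> J))"

lemma substitution_stable_mono:
  "substitution_stable V J \<Longrightarrow> V \<subseteq> W \<Longrightarrow> substitution_stable W J"
  unfolding substitution_stable_def by blast

lemma substitution_stable_adjoin:
  fixes y :: "(nat \<Rightarrow>\<^sub>0 nat) \<Rightarrow>\<^sub>0 'k::field"
  assumes "substitution_stable V J" "supported V y"
  shows "substitution_stable V (adjoin J y)"
  unfolding substitution_stable_def
proof (intro allI impI ballI)
  fix v :: "nat \<Rightarrow> ((nat \<Rightarrow>\<^sub>0 nat) \<Rightarrow>\<^sub>0 'k) poly" and p :: "(nat \<Rightarrow>\<^sub>0 nat) \<Rightarrow>\<^sub>0 'k" and l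
  assume v: "\<forall>i\<in>V. v i = [:var i:]" and "p \<in> adjoin J y"
  then obtain a b where ab: "a \<in> J" "p = a + y * b" unfolding adjoin_def by blast
  have "coeff (poly_eval.eval v p) l =
      coeff (poly_eval.eval v a) l + y * coeff (poly_eval.eval v b) l"
    by (simp add: ab poly_eval.eval_add poly_eval.eval_mult poly_eval_supported[OF assms(2) v])
  moreover have "coeff (poly_eval.eval v a) l \<in> J"
    using assms(1) v ab(1) unfolding substitution_stable_def by blast
  ultimately show "coeff (poly_eval.eval v p) l \<in> adjoin J y"
    unfolding adjoin_def by blast
qed

text \<open>Substituting \<open>u\<^sub>j + w h\<^sub>j\<close> for \<open>u\<^sub>j\<close> turns \<open>\<Sum>\<^sub>j u\<^sub>j x\<^sub>j\<close> into a polynomial in \<open>w\<close> whose leading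
  coefficient \<open>\<Sum>\<^sub>j h\<^sub>j x\<^sub>j\<close> is a nonzerodivisor.\<close>

lemma nonzerodivisor_mod_generic:
  fixes J :: "((nat \<Rightarrow>\<^sub>0 nat) \<Rightarrow>\<^sub>0 'k::field) set"
  assumes J: "ideal_of_ring J" "substitution_stable V J"
    and nz: "nonzerodivisor_mod J (\<Sum>j\<in>A. h j * var j)"
    and A: "A \<subseteq> V" and u: "inj_on u A" "u ` A \<inter> V = {}"
  shows "nonzerodivisor_mod J (\<Sum>j\<in>A. var (u j) * var j)"
  unfolding nonzerodivisor_mod_def
proof (intro allI impI)
  let ?f = "\<Sum>j\<in>A. h j * var j" and ?g = "\<Sum>j\<in>A. var (u j) * var j :: (nat \<Rightarrow>\<^sub>0 nat) \<Rightarrow>\<^sub>0 'k"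
  \<comment> \<open>Only the coefficient variables are moved, and \<open>the_inv_into\<close>
    recovers j from \<open>u j\<close>. They lie outside \<open>V\<close>, so the stability of
    \<open>J\<close> applies.\<close>
  define v where "v i = (if i \<in> u ` A then [:var i, h (the_inv_into A u i):] else [:var i:])" for i
  have vV: "\<forall>i\<in>V. v i = [:var i:]" using u(2) by (auto simp: v_def)
  have eval_var: "poly_eval.eval v (var i) = v i" for i
    unfolding var_def by (rule poly_eval.eval_var)
  have "poly_eval.eval v ?g = (\<Sum>j\<in>A. [:var (u j), h j:] * [:var j:])"
    unfolding poly_eval.eval_sum
  proof (rule sum.cong)
    fix j assume j: "j \<in> A"
    have "v (u j) = [:var (u j), h j:]"
      using j by (simp add: v_def the_inv_into_f_f[OF u(1)])
    moreover have "v j = [:var j:]" using j A vV by blast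
    ultimately show "poly_eval.eval v (var (u j) * var j) = [:var (u j), h j:] * [:var j:]"
      by (simp only: poly_eval.eval_mult eval_var)
  qed simp
  also have "\<dots> = (\<Sum>j\<in>A. [:var (u j) * var j, h j * var j:])"
    by (simp add: mult.commute)
  also have "\<dots> = [:?g, ?f:]"
    by (induction A rule: infinite_finite_induct) simp_all
  finally have g: "poly_eval.eval v ?g = [:?g, ?f:]" .
  fix p assume "?g * p \<in> J"
  then have "\<forall>l. coeff (poly_eval.eval v (?g * p)) l \<in> J"
    using J(2) vV unfolding substitution_stable_def by blast
  then have "\<forall>l. coeff ([:?g, ?f:] * poly_eval.eval v p) l \<in> J"
    unfolding poly_eval.eval_mult g .
  then have "coeff (poly_eval.eval v p) 0 \<in> J"
    using nonzerodivisor_mod_linear[OF J(1) nz] by blast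
  moreover have "poly (v i) 0 = var i" for i
    by (simp add: v_def)
  ultimately show "p \<in> J"
    by (simp add: poly_eval_at_0 flip: poly_0_coeff_0)
qed

text \<open>The indices 1 to n are the x; the block from n(k + 1) + 1 to n(k + 2) holds the
  coefficients of form k, so different forms share no coefficient.\<close>

definition generic_form :: "nat \<Rightarrow> nat \<Rightarrow> (nat \<Rightarrow>\<^sub>0 nat) \<Rightarrow>\<^sub>0 'k::field" where
  "generic_form n k = (\<Sum>j\<in>{1..n}. var (n * (k + 1) + j) * var j)"

lemma supported_add: "supported V p \<Longrightarrow> supported V q \<Longrightarrow> supported V (p + q)"
  unfolding supported_def using Poly_Mapping.keys_add[of p q] by blast

lemma supported_sum: "(\<And>i. i \<in> A \<Longrightarrow> supported V (f i)) \<Longrightarrow> supported V (sum f A)"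
  by (induction A rule: infinite_finite_induct) (simp_all add: supported_add supported_def[of _ 0])

lemma supported_generic_form: "supported {1..n * (k + 2)} (generic_form n k)"
  unfolding generic_form_def
  by (rule supported_sum)
     (use Poly_Mapping.keys_add in \<open>fastforce simp: var_def mult_single supported_def\<close>)

lemma ideal_of_ring_foldl_adjoin: "ideal_of_ring J \<Longrightarrow> ideal_of_ring (foldl adjoin J ys)"
  by (induction ys arbitrary: J) (simp_all add: ideal_of_ring_adjoin)

lemma substitution_stable_foldl_adjoin:
  "substitution_stable V J \<Longrightarrow> \<forall>y\<in>set ys. supported V y \<Longrightarrow> substitution_stable V (foldl adjoin J ys)"
  by (induction ys arbitrary: J) (simp_all add: substitution_stable_adjoin)

lemma regular_mod_iff:
  "regular_mod J ys \<longleftrightarrow> (\<forall>i<length ys. nonzerodivisor_mod (foldl adjoin J (take i ys)) (ys ! i))"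
  by (induction ys arbitrary: J) (simp_all add: All_less_Suc2)

text \<open>Each round puts a generic form in front and drops the last given element. The enlarged
  ideal involves the coefficient block k, whence the shift of \<open>k\<close> in the induction,
  while the remaining given elements still involve the x alone.\<close>

lemma regular_mod_generic_forms:
  fixes J :: "((nat \<Rightarrow>\<^sub>0 nat) \<Rightarrow>\<^sub>0 'k::field) set"
  assumes "ideal_of_ring J" "substitution_stable {1..n * (k + 1)} J" "regular_mod J ys"
    and "\<forall>y\<in>set ys. supported {1..n} y \<and> (\<exists>h. y = (\<Sum>j\<in>{1..n}. h j * var j))"
  shows "regular_mod J (map (generic_form n) [k..<k + length ys])"
  using assms
proof (induction "length ys" arbitrary: J k ys)
  case (Suc l)
  let ?V = "{1..n * (k + 1)}"
  note J = Suc.prems(1,2)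
  have V: "{1..n} \<subseteq> ?V" by auto
  have supp: "\<forall>y\<in>set ys. supported ?V y"
    using Suc.prems(4) V unfolding supported_def by blast
  have ne: "ys \<noteq> []" using Suc.hyps(2) by auto
  \<comment> \<open>Each given element is a combination of the x, so it is itself the specialisation
    showing that the generic form is a nonzerodivisor modulo the elements before it.\<close>
  have gen: "nonzerodivisor_mod (foldl adjoin J (take i ys)) (generic_form n k)"
    if i: "i < length ys" for i
  proof -
    obtain h where h: "ys ! i = (\<Sum>j\<in>{1..n}. h j * var j)"
      using Suc.prems(4) i nth_mem by blast
    have "nonzerodivisor_mod (foldl adjoin J (take i ys)) (\<Sum>j\<in>{1..n}. h j * var j)"
      using Suc.prems(3) i unfolding regular_mod_iff h[symmetric] by blast
    moreover have "ideal_of_ring (foldl adjoin J (take i ys))"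
      by (rule ideal_of_ring_foldl_adjoin[OF J(1)])
    moreover have "substitution_stable ?V (foldl adjoin J (take i ys))"
      using supp by (intro substitution_stable_foldl_adjoin[OF J(2)]) (blast dest: in_set_takeD)
    ultimately show ?thesis
      unfolding generic_form_def using V
      by (intro nonzerodivisor_mod_generic) (auto intro: inj_onI)
  qed
  have "regular_mod (adjoin J (generic_form n k)) (butlast ys)"
    by (rule regular_mod_exchange[OF J(1) Suc.prems(3) ne gen])
  moreover have "substitution_stable {1..n * (k + 2)} (adjoin J (generic_form n k))"
    by (rule substitution_stable_adjoin[OF _ supported_generic_form])
       (rule substitution_stable_mono[OF J(2)], auto)
  ultimately have "regular_mod (adjoin J (generic_form n k))
      (map (generic_form n) [Suc k..<Suc k + length (butlast ys)])"
    using Suc.hyps(2) Suc.prems(4)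
    by (intro Suc.hyps(1) ideal_of_ring_adjoin J(1)) (auto dest: in_set_butlastD)
  moreover have "[k..<k + length ys] = k # [Suc k..<Suc k + length (butlast ys)]"
    by (simp add: upt_conv_Cons Suc.hyps(2)[symmetric] del: upt_Suc)
  moreover have "nonzerodivisor_mod J (generic_form n k)"
    using gen[of 0] ne by simp
  ultimately show ?case by simp
qed simp

section \<open>Bigraded Hilbert functions\<close>

text \<open>\<open>U\<close> is the preimage of \<open>W\<close> in \<open>V\<close>, so
  \<open>g\<close> induces an isomorphism of V/U onto (W + g V)/W. In bases: a basis of
  \<open>W\<close> and the images of a basis of \<open>V\<close> modulo \<open>U\<close> together
  form a basis of the sum.\<close>

lemma (in vector_space) dim_sum_linear_image:
  assumes g: "Vector_Spaces.linear scale scale g"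
    and W: "subspace W" "W \<subseteq> span S" "finite S"
    and V: "subspace V" "V \<subseteq> span T" "finite T"
    and U: "subspace U" "U \<subseteq> V"
    and gU: "\<And>v. v \<in> V \<Longrightarrow> g v \<in> W \<longleftrightarrow> v \<in> U"
  shows "dim {w + g v | w v. w \<in> W \<and> v \<in> V} + dim U = dim W + dim V"
proof -
  interpret g: Vector_Spaces.linear scale scale g by (rule g)
  obtain BW where BW: "BW \<subseteq> W" "independent BW" "W \<subseteq> span BW" "card BW = dim W"
    using basis_exists by blast
  obtain BU where BU: "BU \<subseteq> U" "independent BU" "U \<subseteq> span BU" "card BU = dim U"
    using basis_exists by blast
  obtain B where B: "BU \<subseteq> B" "B \<subseteq> V" "independent B" "V \<subseteq> span B"
    using maximal_independent_subset_extend[OF subset_trans[OF BU(1) U(2)] BU(2)] by blast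
  have finBW: "finite BW" using independent_span_bound[OF W(3) BW(2) subset_trans[OF BW(1) W(2)]] ..
  have finB: "finite B" using independent_span_bound[OF V(3) B(3) subset_trans[OF B(2) V(2)]] ..
  have spanW: "span BW = W" by (rule span_subspace[OF BW(1,3) W(1)])
  have spanU: "span BU = U" by (rule span_subspace[OF BU(1,3) U(1)])
  have spanV: "span B = V" by (rule span_subspace[OF B(2,4) V(1)])
  have dimV: "dim V = card B" by (rule basis_card_eq_dim[OF B(2,4,3), symmetric])
  have span: "span (BW \<union> g ` C) = {w + g v | w v. w \<in> W \<and> v \<in> span C}" for C
    unfolding span_Un spanW g.span_image by blast
  \<comment> \<open>Adding one vector at a time yields independence, injectivity of \<open>g\<close>
    and disjointness from \<open>BW\<close> together, all from the fact that the new image is not in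
    the span so far.\<close>
  have "independent (BW \<union> g ` C) \<and> card (BW \<union> g ` C) = card BW + card C" if "C \<subseteq> B - BU" for C
  proof -
    have "finite C" using that finB finite_subset by blast
    then show ?thesis using that
    proof (induction C)
      case empty
      then show ?case using BW by simp
    next
      case (insert c C)
      have C: "C \<subseteq> B - BU" using insert.prems by blast
      have notin: "g c \<notin> span (BW \<union> g ` C)"
      proof
        assume "g c \<in> span (BW \<union> g ` C)"
        then obtain w v where wv: "w \<in> W" "v \<in> span C" "g c = w + g v"
          unfolding span by blast
        have cV: "c \<in> V" using insert.prems B(2) by blast
        have "span C \<subseteq> V" using C B(2) V(1) span_minimal by blast
        then have "c - v \<in> V" using cV wv(2) V(1) subspace_diff by blast
        moreover have "g (c - v) \<in> W" using wv by (simp add: g.diff)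
        ultimately have "c - v \<in> span BU" using gU spanU by blast
        then have "c - v \<in> span (BU \<union> C)" using span_mono[of BU "BU \<union> C"] by blast
        moreover have "v \<in> span (BU \<union> C)" using wv(2) span_mono[of C "BU \<union> C"] by blast
        ultimately have "(c - v) + v \<in> span (BU \<union> C)" by (rule span_add)
        then have "c \<in> span (BU \<union> C)" by simp
        moreover have "BU \<union> C \<subseteq> B - {c}" using insert.hyps insert.prems B(1) by blast
        ultimately have "c \<in> span (B - {c})" using span_mono[of "BU \<union> C" "B - {c}"] by blast
        moreover have "c \<in> B" using insert.prems by blast
        ultimately show False using B(3) unfolding dependent_def by blast
      qed
      then have notin': "g c \<notin> BW \<union> g ` C" using span_base[of "g c" "BW \<union> g ` C"] by blast
      have "BW \<union> g ` insert c C = insert (g c) (BW \<union> g ` C)" by blast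
      moreover have "independent (insert (g c) (BW \<union> g ` C))"
        using insert.IH[OF C] notin by (intro independent_insertI) blast+
      moreover have "card (insert (g c) (BW \<union> g ` C)) = Suc (card (BW \<union> g ` C))"
        using notin' finBW insert.hyps(1) by (intro card_insert_disjoint) blast+
      ultimately show ?case
        using insert.IH[OF C] insert.hyps by simp
    qed
  qed
  from this[of "B - BU"] have ind: "independent (BW \<union> g ` (B - BU))"
    and card: "card (BW \<union> g ` (B - BU)) = card BW + card (B - BU)" by simp_all
  have eq: "{w + g v | w v. w \<in> W \<and> v \<in> V} = span (BW \<union> g ` (B - BU))"
  proof
    show "span (BW \<union> g ` (B - BU)) \<subseteq> {w + g v | w v. w \<in> W \<and> v \<in> V}"
      unfolding span using spanV span_mono[of "B - BU" B] by blast
    show "{w + g v | w v. w \<in> W \<and> v \<in> V} \<subseteq> span (BW \<union> g ` (B - BU))"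
    proof clarify
      fix w v assume w: "w \<in> W" and v: "v \<in> V"
      have "B = BU \<union> (B - BU)" using B(1) by blast
      then have "v \<in> span (BU \<union> (B - BU))" using v spanV by simp
      then obtain a b where ab: "a \<in> U" "b \<in> span (B - BU)" "v = a + b"
        unfolding span_Un spanU by blast
      have "g a \<in> W" using ab(1) gU U(2) by blast
      then have "w + g a \<in> W" using w W(1) subspace_add by blast
      moreover have "w + g v = (w + g a) + g b" using ab(3) by (simp add: g.add add.assoc)
      ultimately show "w + g v \<in> span (BW \<union> g ` (B - BU))"
        unfolding span using ab(2) by blast
    qed
  qed
  have "dim {w + g v | w v. w \<in> W \<and> v \<in> V} = card BW + card (B - BU)"
    unfolding eq dim_span_eq_card_independent[OF ind] by (rule card)
  moreover have "card B = card BU + card (B - BU)"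
    using card_Un_disjoint[of BU "B - BU"] B(1) finB finite_subset[OF B(1)]
    by (simp add: Un_absorb1)
  ultimately show ?thesis using BW BU dimV by simp
qed

section \<open>Polynomials as a vector space, spanned by monomials\<close>

interpretation mpoly: vector_space
  "\<lambda>(a :: 'k::field) (p :: (nat \<Rightarrow>\<^sub>0 nat) \<Rightarrow>\<^sub>0 'k). Poly_Mapping.single 0 a * p"
  by unfold_locales
     (simp_all add: algebra_simps single_add mult_single flip: mult.assoc)

definition monomial_span :: "(nat \<Rightarrow>\<^sub>0 nat) set \<Rightarrow> ((nat \<Rightarrow>\<^sub>0 nat) \<Rightarrow>\<^sub>0 'k::field) set" where
  "monomial_span M = {p. Poly_Mapping.keys p \<subseteq> M}"

lemma subspace_monomial_span:
  "mpoly.subspace (monomial_span M :: ((nat \<Rightarrow>\<^sub>0 nat) \<Rightarrow>\<^sub>0 'k::field) set)"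
proof (rule mpoly.subspaceI)
  fix p q :: "(nat \<Rightarrow>\<^sub>0 nat) \<Rightarrow>\<^sub>0 'k" and a :: 'k
  show "0 \<in> (monomial_span M :: ((nat \<Rightarrow>\<^sub>0 nat) \<Rightarrow>\<^sub>0 'k) set)" by (simp add: monomial_span_def)
  assume p: "p \<in> monomial_span M"
  show "p + q \<in> monomial_span M" if "q \<in> monomial_span M"
    using p that Poly_Mapping.keys_add[of p q] by (auto simp: monomial_span_def)
  show "Poly_Mapping.single 0 a * p \<in> monomial_span M"
    using p keys_mult[of "Poly_Mapping.single 0 a" p] by (auto simp: monomial_span_def split: if_splits)
qed

lemma span_monomials:
  "mpoly.span ((\<lambda>m. Poly_Mapping.single m (1::'k::field)) ` M) = monomial_span M"
proof
  show "mpoly.span ((\<lambda>m. Poly_Mapping.single m (1::'k)) ` M) \<subseteq> monomial_span M"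
    by (rule mpoly.span_minimal[OF _ subspace_monomial_span]) (auto simp: monomial_span_def)
  show "monomial_span M \<subseteq> mpoly.span ((\<lambda>m. Poly_Mapping.single m (1::'k)) ` M)"
  proof
    fix p :: "(nat \<Rightarrow>\<^sub>0 nat) \<Rightarrow>\<^sub>0 'k" assume p: "p \<in> monomial_span M"
    have "(\<Sum>m\<in>Poly_Mapping.keys p. Poly_Mapping.single 0 (Poly_Mapping.lookup p m) * Poly_Mapping.single m 1)
      \<in> mpoly.span ((\<lambda>m. Poly_Mapping.single m (1::'k)) ` M)"
      using p by (intro mpoly.span_sum mpoly.span_scale mpoly.span_base) (auto simp: monomial_span_def)
    then show "p \<in> mpoly.span ((\<lambda>m. Poly_Mapping.single m (1::'k)) ` M)"
      by (simp add: mult_single poly_mapping_sum_single[symmetric])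
  qed
qed

lemma dim_monomial_span:
  assumes "finite M"
  shows "mpoly.dim (monomial_span M :: ((nat \<Rightarrow>\<^sub>0 nat) \<Rightarrow>\<^sub>0 'k::field) set) = card M"
proof -
  let ?s = "\<lambda>m. Poly_Mapping.single m (1::'k)"
  have inj: "inj_on ?s M"
    by (rule inj_onI) (metis keys_single singleton_inject zero_neq_one)
  have "mpoly.independent (?s ` M)"
  proof -
    have "?s m \<notin> mpoly.span (?s ` M - {?s m})" if "m \<in> M" for m
    proof -
      have "?s ` M - {?s m} \<subseteq> ?s ` (M - {m})" by blast
      then have "mpoly.span (?s ` M - {?s m}) \<subseteq> monomial_span (M - {m})"
        unfolding span_monomials[symmetric] by (rule mpoly.span_mono)
      then show ?thesis by (auto simp: monomial_span_def)
    qed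
    then show ?thesis unfolding mpoly.dependent_def by blast
  qed
  then show ?thesis
    unfolding span_monomials[symmetric] card_image[OF inj, symmetric]
    by (rule mpoly.dim_span_eq_card_independent)
qed

text \<open>The first degree counts the x, the second the coefficients of the generic forms; the
  bound \<open>N\<close> on the indices makes each component finite-dimensional.\<close>

definition bidegree :: "nat \<Rightarrow> nat \<Rightarrow> nat \<Rightarrow> nat \<Rightarrow> (nat \<Rightarrow>\<^sub>0 nat) set" where
  "bidegree n N i b = {m. Poly_Mapping.keys m \<subseteq> {1..N} \<and>
     (\<Sum>j\<in>{1..n}. Poly_Mapping.lookup m j) = i \<and> (\<Sum>j\<in>{n<..N}. Poly_Mapping.lookup m j) = b}"

definition bigraded :: "nat \<Rightarrow> nat \<Rightarrow> ((nat \<Rightarrow>\<^sub>0 nat) \<Rightarrow>\<^sub>0 'k::field) set \<Rightarrow> bool" where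
  "bigraded n N J \<longleftrightarrow> (\<forall>p\<in>J. \<forall>i b. part (bidegree n N i b) 0 p \<in> J)"

text \<open>Dimension of a component of the quotient by \<open>J\<close>, computed as a codimension;
  real values avoid truncated subtraction and fit the limits taken later.\<close>

definition quotient_dim :: "nat \<Rightarrow> nat \<Rightarrow> ((nat \<Rightarrow>\<^sub>0 nat) \<Rightarrow>\<^sub>0 'k::field) set \<Rightarrow> nat \<Rightarrow> nat \<Rightarrow> real" where
  "quotient_dim n N J i b =
     real (card (bidegree n N i b)) - real (mpoly.dim (J \<inter> monomial_span (bidegree n N i b)))"

lemma keys_add_nat:
  "Poly_Mapping.keys (a + b :: 'a \<Rightarrow>\<^sub>0 nat) = Poly_Mapping.keys a \<union> Poly_Mapping.keys b"
  by (auto simp: in_keys_iff lookup_add)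

lemma bidegree_add_iff:
  assumes "a \<in> bidegree n N 1 1"
  shows "a + c \<in> bidegree n N (Suc i) (Suc b) \<longleftrightarrow> c \<in> bidegree n N i b"
    and "a + c \<notin> bidegree n N 0 b" and "a + c \<notin> bidegree n N i 0"
proof -
  have sum: "(\<Sum>j\<in>{1..n}. Poly_Mapping.lookup (a + c) j) = Suc (\<Sum>j\<in>{1..n}. Poly_Mapping.lookup c j)"
    "(\<Sum>j\<in>{n<..N}. Poly_Mapping.lookup (a + c) j) = Suc (\<Sum>j\<in>{n<..N}. Poly_Mapping.lookup c j)"
    using assms by (simp_all add: bidegree_def lookup_add sum.distrib)
  show "a + c \<in> bidegree n N (Suc i) (Suc b) \<longleftrightarrow> c \<in> bidegree n N i b"
    using assms unfolding bidegree_def mem_Collect_eq sum keys_add_nat by simp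
  show "a + c \<notin> bidegree n N 0 b" "a + c \<notin> bidegree n N i 0"
    unfolding bidegree_def mem_Collect_eq sum by simp_all
qed

lemma part_id: "Poly_Mapping.keys p \<subseteq> A \<Longrightarrow> part A 0 p = p"
  by (rule poly_mapping_eqI) (auto simp: lookup_part in_keys_iff)

lemma part_empty: "part {} m p = 0"
  by (rule poly_mapping_eqI) (auto simp: lookup_part)

lemma part_bidegree_mult:
  assumes "g \<in> monomial_span (bidegree n N 1 1)"
  shows "part (bidegree n N (Suc i) (Suc b)) 0 (g * p) = g * part (bidegree n N i b) 0 p"
    and "part (bidegree n N 0 b) 0 (g * p) = 0" and "part (bidegree n N i 0) 0 (g * p) = 0"
proof -
  have g: "a \<in> bidegree n N 1 1" if "a \<in> Poly_Mapping.keys g" for a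
    using assms that by (auto simp: monomial_span_def)
  show "part (bidegree n N (Suc i) (Suc b)) 0 (g * p) = g * part (bidegree n N i b) 0 p"
    by (rule part_mult) (use bidegree_add_iff(1)[OF g] in auto)
  have "part (bidegree n N 0 b) 0 (g * p) = g * part {} 0 p"
    by (rule part_mult) (use bidegree_add_iff(2)[OF g] in auto)
  then show "part (bidegree n N 0 b) 0 (g * p) = 0" by (simp add: part_empty)
  have "part (bidegree n N i 0) 0 (g * p) = g * part {} 0 p"
    by (rule part_mult) (use bidegree_add_iff(3)[OF g] in auto)
  then show "part (bidegree n N i 0) 0 (g * p) = 0" by (simp add: part_empty)
qed

lemma bigraded_adjoin:
  assumes "ideal_of_ring J" "bigraded n N J" "g \<in> monomial_span (bidegree n N 1 1)"
  shows "bigraded n N (adjoin J g)"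
  unfolding bigraded_def
proof (intro ballI allI)
  fix p i b assume "p \<in> adjoin J g"
  then obtain a s where as: "a \<in> J" "p = a + g * s" unfolding adjoin_def by blast
  have a: "part (bidegree n N i b) 0 a \<in> J"
    using assms(2) as(1) unfolding bigraded_def by blast
  show "part (bidegree n N i b) 0 p \<in> adjoin J g"
  proof (cases "i = 0 \<or> b = 0")
    case True
    then have "part (bidegree n N i b) 0 p = part (bidegree n N i b) 0 a"
      using part_bidegree_mult(2,3)[OF assms(3)] as(2) by (auto simp: part_add)
    then show ?thesis using a subset_adjoin by auto
  next
    case False
    then obtain i' b' where "i = Suc i'" "b = Suc b'" by (metis not0_implies_Suc)
    then have "part (bidegree n N i b) 0 p =
        part (bidegree n N i b) 0 a + g * part (bidegree n N i' b') 0 s"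
      using part_bidegree_mult(1)[OF assms(3)] as(2) by (simp add: part_add)
    then show ?thesis using a unfolding adjoin_def by blast
  qed
qed

lemma subspace_ideal_of_ring: "ideal_of_ring J \<Longrightarrow> mpoly.subspace J"
  by (auto simp: mpoly.subspace_def ideal_of_ring_def)

lemma finite_bidegree: "finite (bidegree n N i b)"
proof -
  let ?F = "{f. \<forall>x. (x \<in> {1..N} \<longrightarrow> f x \<in> {..i + b}) \<and> (x \<notin> {1..N} \<longrightarrow> f x = 0)}"
  have "Poly_Mapping.lookup m \<in> ?F" if m: "m \<in> bidegree n N i b" for m
  proof -
    have "Poly_Mapping.lookup m j \<le> i + b" if j: "j \<in> {1..N}" for j
    proof (cases "j \<le> n")
      case True
      then have "Poly_Mapping.lookup m j \<le> (\<Sum>j\<in>{1..n}. Poly_Mapping.lookup m j)"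
        using j member_le_sum[of j "{1..n}" "Poly_Mapping.lookup m"] by simp
      then show ?thesis using m by (simp add: bidegree_def)
    next
      case False
      then have "Poly_Mapping.lookup m j \<le> (\<Sum>j\<in>{n<..N}. Poly_Mapping.lookup m j)"
        using j member_le_sum[of j "{n<..N}" "Poly_Mapping.lookup m"] by simp
      then show ?thesis using m by (simp add: bidegree_def)
    qed
    moreover have "Poly_Mapping.lookup m x = 0" if x: "x \<notin> {1..N}" for x
    proof -
      have "x \<notin> Poly_Mapping.keys m" using m x by (auto simp: bidegree_def)
      then show ?thesis by (simp add: in_keys_iff)
    qed
    ultimately show ?thesis by simp
  qed
  then have "Poly_Mapping.lookup ` bidegree n N i b \<subseteq> ?F" by (rule image_subsetI)
  moreover have "finite ?F" by (rule finite_set_of_finite_funs) simp_all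
  ultimately have "finite (Poly_Mapping.lookup ` bidegree n N i b)" by (rule finite_subset)
  then show ?thesis
    by (rule finite_imageD) (rule inj_onI, simp only: poly_mapping_eq_iff)
qed

lemma quotient_dim_nonneg: "quotient_dim n N (J :: ((nat \<Rightarrow>\<^sub>0 nat) \<Rightarrow>\<^sub>0 'k::field) set) i b \<ge> 0"
proof -
  let ?s = "\<lambda>m. Poly_Mapping.single m (1::'k)"
  let ?M = "bidegree n N i b"
  have "mpoly.dim (J \<inter> monomial_span ?M) \<le> card (?s ` ?M)"
    by (rule mpoly.dim_le_card) (auto simp: span_monomials finite_bidegree)
  also have "\<dots> \<le> card ?M" by (rule card_image_le[OF finite_bidegree])
  finally show ?thesis by (simp add: quotient_dim_def)
qed

text \<open>Multiples of \<open>g\<close> have positive degree in the x, so nothing new enters in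
  degree 0.\<close>

lemma quotient_dim_adjoin_0:
  assumes J: "ideal_of_ring J" "bigraded n N J" and g: "g \<in> monomial_span (bidegree n N 1 1)"
  shows "quotient_dim n N (adjoin J g) 0 b = quotient_dim n N J 0 b"
proof -
  have "adjoin J g \<inter> monomial_span (bidegree n N 0 b) = J \<inter> monomial_span (bidegree n N 0 b)"
  proof (intro equalityI subsetI)
    fix p assume p: "p \<in> adjoin J g \<inter> monomial_span (bidegree n N 0 b)"
    then obtain a s where as: "a \<in> J" "p = a + g * s" unfolding adjoin_def by blast
    have "p = part (bidegree n N 0 b) 0 p"
      using p by (intro part_id[symmetric]) (auto simp: monomial_span_def)
    also have "\<dots> = part (bidegree n N 0 b) 0 a"
      by (simp add: as(2) part_add part_bidegree_mult(2)[OF g])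
    finally show "p \<in> J \<inter> monomial_span (bidegree n N 0 b)"
      using p as(1) J(2) unfolding bigraded_def by auto
  qed (use subset_adjoin in blast)
  then show ?thesis by (simp add: quotient_dim_def)
qed

text \<open>Multiplication by \<open>g\<close> embeds the component (i, b) of the quotient by
  \<open>J\<close> into the component (i + 1, b + 1), and the component of the new quotient is the
  cokernel.\<close>

lemma quotient_dim_adjoin_Suc:
  assumes J: "ideal_of_ring J" "bigraded n N J" and g: "g \<in> monomial_span (bidegree n N 1 1)"
    and nz: "nonzerodivisor_mod J g"
  shows "quotient_dim n N (adjoin J g) (Suc i) (Suc b) =
    quotient_dim n N J (Suc i) (Suc b) - quotient_dim n N J i b"
proof -
  let ?M' = "bidegree n N (Suc i) (Suc b)" and ?M = "bidegree n N i b"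
  have gM: "g * v \<in> monomial_span ?M'" if "v \<in> monomial_span ?M" for v
    using keys_mult[of g v] that g bidegree_add_iff(1)[of _ n N _ i b]
    by (fastforce simp: monomial_span_def)
  have eq: "adjoin J g \<inter> monomial_span ?M' =
      {w + g * v | w v. w \<in> J \<inter> monomial_span ?M' \<and> v \<in> monomial_span ?M}"
  proof (intro equalityI subsetI)
    fix p assume p: "p \<in> adjoin J g \<inter> monomial_span ?M'"
    then obtain a s where as: "a \<in> J" "p = a + g * s" unfolding adjoin_def by blast
    have "p = part ?M' 0 p"
      using p by (intro part_id[symmetric]) (auto simp: monomial_span_def)
    also have "\<dots> = part ?M' 0 a + g * part ?M 0 s"
      by (simp add: as(2) part_add part_bidegree_mult(1)[OF g])
    finally have "p = part ?M' 0 a + g * part ?M 0 s" .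
    moreover have "part ?M' 0 a \<in> J" using as(1) J(2) by (simp add: bigraded_def)
    moreover have "part ?M' 0 a \<in> monomial_span ?M'" "part ?M 0 s \<in> monomial_span ?M"
      by (auto simp: monomial_span_def keys_part)
    ultimately show "p \<in> {w + g * v | w v. w \<in> J \<inter> monomial_span ?M' \<and> v \<in> monomial_span ?M}"
      by blast
  next
    fix p assume "p \<in> {w + g * v | w v. w \<in> J \<inter> monomial_span ?M' \<and> v \<in> monomial_span ?M}"
    then show "p \<in> adjoin J g \<inter> monomial_span ?M'"
      using gM mpoly.subspace_add[OF subspace_monomial_span] unfolding adjoin_def by blast
  qed
  let ?s = "\<lambda>m. Poly_Mapping.single m (1::'a)"
  have lin: "Vector_Spaces.linear (\<lambda>a p. Poly_Mapping.single 0 a * p) (\<lambda>a p. Poly_Mapping.single 0 a * p)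
      (\<lambda>v. g * v)"
    by unfold_locales (simp_all add: algebra_simps)
  have "mpoly.dim (adjoin J g \<inter> monomial_span ?M') + mpoly.dim (J \<inter> monomial_span ?M) =
      mpoly.dim (J \<inter> monomial_span ?M') + mpoly.dim (monomial_span ?M :: ((nat \<Rightarrow>\<^sub>0 nat) \<Rightarrow>\<^sub>0 'a) set)"
    unfolding eq
  proof (rule mpoly.dim_sum_linear_image[OF lin])
    show "J \<inter> monomial_span ?M' \<subseteq> mpoly.span (?s ` ?M')"
      "monomial_span ?M \<subseteq> mpoly.span (?s ` ?M)"
      by (auto simp: span_monomials)
    show "finite (?s ` ?M')" "finite (?s ` ?M)" by (simp_all add: finite_bidegree)
    show "mpoly.subspace (J \<inter> monomial_span ?M')" "mpoly.subspace (J \<inter> monomial_span ?M)"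
      by (intro mpoly.subspace_inter subspace_ideal_of_ring J(1) subspace_monomial_span)+
    show "g * v \<in> J \<inter> monomial_span ?M' \<longleftrightarrow> v \<in> J \<inter> monomial_span ?M"
      if "v \<in> monomial_span ?M" for v
      using that gM nz ideal_of_ring_mult[OF J(1)] unfolding nonzerodivisor_mod_def by blast
  qed (auto simp: subspace_monomial_span)
  then show ?thesis
    by (simp add: quotient_dim_def dim_monomial_span[OF finite_bidegree])
qed

text \<open>On generating functions this is multiplication by 1 - t; the value at 0 reads H(-1) as
  0.\<close>

definition backward_difference :: "(nat \<Rightarrow> real) \<Rightarrow> nat \<Rightarrow> real" where
  "backward_difference H i = (case i of 0 \<Rightarrow> H 0 | Suc j \<Rightarrow> H (Suc j) - H j)"

text \<open>\<open>P b\<close> stands for the number of monomials of degree \<open>b\<close> in the coefficients of the generic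
  forms; asymptotically in \<open>b\<close>, the quotients behave like graded vector spaces over the field of
  rational functions in these coefficients.\<close>

lemma backward_difference_nonneg:
  fixes J :: "((nat \<Rightarrow>\<^sub>0 nat) \<Rightarrow>\<^sub>0 'k::field) set"
  assumes "ideal_of_ring J" "bigraded n N J" "regular_mod J gs"
    and "\<forall>g\<in>set gs. g \<in> monomial_span (bidegree n N 1 1)"
    and P: "\<And>b. P b > 0" "(\<lambda>b. P b / P (Suc b)) \<longlonglongrightarrow> 1"
    and "\<And>i. (\<lambda>b. quotient_dim n N J i b / P b) \<longlonglongrightarrow> H i"
  shows "(backward_difference ^^ length gs) H i \<ge> 0"
  using assms(1-4,7)
proof (induction gs arbitrary: J H)
  case Nil
  have "0 \<le> quotient_dim n N J i b / P b" for b
    using P(1)[of b] by (intro divide_nonneg_pos quotient_dim_nonneg)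
  then have "0 \<le> H i" by (intro LIMSEQ_le_const[OF Nil.prems(5)]) blast
  then show ?case by simp
next
  case (Cons g gs)
  note J = Cons.prems(1,2) and lim = Cons.prems(5)
  have g: "g \<in> monomial_span (bidegree n N 1 1)" and nz: "nonzerodivisor_mod J g"
    using Cons.prems by auto
  have "(\<lambda>b. quotient_dim n N (adjoin J g) i b / P b) \<longlonglongrightarrow> backward_difference H i" for i
  proof (cases i)
    case 0
    then show ?thesis
      using lim[of 0] by (simp add: quotient_dim_adjoin_0[OF J g] backward_difference_def)
  next
    case (Suc j)
    \<comment> \<open>The exact sequence links b + 1 to b, so the subtracted term is normalised by
      \<open>P b\<close> instead of \<open>P (Suc b)\<close>; the ratio tending to 1 corrects
      this.\<close>
    have "(\<lambda>b. quotient_dim n N J (Suc j) (Suc b) / P (Suc b)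
        - quotient_dim n N J j b / P b * (P b / P (Suc b))) \<longlonglongrightarrow> H (Suc j) - H j * 1"
      by (intro tendsto_diff tendsto_mult P(2) lim LIMSEQ_Suc[OF lim])
    moreover have "quotient_dim n N J (Suc j) (Suc b) / P (Suc b)
        - quotient_dim n N J j b / P b * (P b / P (Suc b)) =
        quotient_dim n N (adjoin J g) (Suc j) (Suc b) / P (Suc b)" for b
      using P(1)[of b] P(1)[of "Suc b"]
      by (simp add: quotient_dim_adjoin_Suc[OF J g nz] diff_divide_distrib)
    ultimately have "(\<lambda>b. quotient_dim n N (adjoin J g) (Suc j) (Suc b) / P (Suc b))
        \<longlonglongrightarrow> H (Suc j) - H j" by simp
    from LIMSEQ_imp_Suc[OF this] show ?thesis
      using Suc by (simp add: backward_difference_def)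
  qed
  then have "(backward_difference ^^ length gs) (backward_difference H) i \<ge> 0"
    using Cons.prems by (intro Cons.IH[of "adjoin J g"] ideal_of_ring_adjoin bigraded_adjoin) auto
  then show ?case by (simp add: funpow_swap1)
qed

section \<open>Prime ideals of Stanley-Reisner rings\<close>

text \<open>As \<open>P\<close> contains \<open>I\<close>, it is a union of cosets of
  \<open>I\<close>, so any representative decides.\<close>

lemma (in ring) coset_in_image_iff:
  assumes "ideal I R" "ideal P R" "I \<subseteq> P" "a \<in> carrier R"
  shows "I +> a \<in> (+>) I ` P \<longleftrightarrow> a \<in> P"
proof -
  have "ideal ((+>) I ` P) (R Quot I)" by (rule ring_ideal_imp_quot_ideal[OF assms(1,2)])
  then have "(+>) I ` P \<subseteq> carrier (R Quot I)" by (rule additive_subgroup.a_subset[OF ideal.axioms(1)])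
  moreover have "\<Union> ((+>) I ` P) = P" using ideal_incl_iff[OF assms(1,2)] assms(3) by simp
  ultimately show ?thesis using canonical_proj_vimage_mem_iff[OF assms(1) _ assms(4)] by metis
qed

lemma (in ring) carrier_quotient: "carrier (R Quot I) = (+>) I ` carrier R"
  by (auto simp: FactRing_def A_RCOSETS_def')

lemma (in cring) primeideal_quotient:
  assumes I: "ideal I R" and P: "primeideal P R" and IP: "I \<subseteq> P"
  shows "primeideal ((+>) I ` P) (R Quot I)"
proof -
  have idP: "ideal P R" using P by (rule primeideal.axioms)
  note mem = coset_in_image_iff[OF I idP IP]
  show ?thesis
  proof (rule primeidealI)
    show "ideal ((+>) I ` P) (R Quot I)" by (rule ring_ideal_imp_quot_ideal[OF I idP])
    show "cring (R Quot I)" by (rule ideal.quotient_is_cring[OF I cring_axioms])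
    obtain a where a: "a \<in> carrier R" "a \<notin> P"
      using primeideal.I_notcarr[OF P] ideal.Icarr[OF idP] by blast
    have "I +> a \<notin> (+>) I ` P" using mem[OF a(1)] a(2) by simp
    moreover have "I +> a \<in> carrier (R Quot I)" unfolding carrier_quotient using a(1) by (rule imageI)
    ultimately show "carrier (R Quot I) \<noteq> (+>) I ` P" by metis
  next
    fix x y assume xy: "x \<in> carrier (R Quot I)" "y \<in> carrier (R Quot I)"
      "x \<otimes>\<^bsub>R Quot I\<^esub> y \<in> (+>) I ` P"
    obtain a b where ab: "a \<in> carrier R" "b \<in> carrier R" "x = I +> a" "y = I +> b"
      using xy(1,2) unfolding carrier_quotient by blast
    have "I +> (a \<otimes> b) \<in> (+>) I ` P"
      using xy(3) ideal.rcoset_mult_add[OF I ab(1,2)] ab(3,4) by (simp add: FactRing_def)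
    then have "a \<otimes> b \<in> P" using mem ab(1,2) by simp
    then have "a \<in> P \<or> b \<in> P" by (rule primeideal.I_prime[OF P ab(1,2)])
    then show "x \<in> (+>) I ` P \<or> y \<in> (+>) I ` P" unfolding ab(3,4) by (metis imageI)
  qed
qed

lemma (in cring) maximalideal_quotient:
  assumes I: "ideal I R" and M: "maximalideal M R" and IM: "I \<subseteq> M"
  shows "maximalideal ((+>) I ` M) (R Quot I)"
proof -
  have idM: "ideal M R" using M by (rule maximalideal.axioms)
  show ?thesis
  proof (rule maximalidealI)
    show "ideal ((+>) I ` M) (R Quot I)" by (rule ring_ideal_imp_quot_ideal[OF I idM])
    obtain a where a: "a \<in> carrier R" "a \<notin> M"
      using maximalideal.I_notcarr[OF M] ideal.Icarr[OF idM] by blast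
    have "I +> a \<notin> (+>) I ` M" using coset_in_image_iff[OF I idM IM a(1)] a(2) by simp
    moreover have "I +> a \<in> carrier (R Quot I)" unfolding carrier_quotient using a(1) by (rule imageI)
    ultimately show "carrier (R Quot I) \<noteq> (+>) I ` M" by metis
  next
    fix J assume J: "ideal J (R Quot I)" "(+>) I ` M \<subseteq> J" "J \<subseteq> carrier (R Quot I)"
    have idJ: "ideal (\<Union> J) R" by (rule quot_ideal_imp_ring_ideal[OF I J(1)])
    have "\<Union> ((+>) I ` M) = M" using ideal_incl_iff[OF I idM] IM by simp
    then have "M \<subseteq> \<Union> J" using J(2) by blast
    moreover have "\<Union> J \<subseteq> carrier R" using idJ by (rule additive_subgroup.a_subset[OF ideal.axioms(1)])
    ultimately have "\<Union> J = M \<or> \<Union> J = carrier R"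
      by (rule maximalideal.I_maximal[OF M idJ])
    moreover have "J = (+>) I ` (\<Union> J)"
    proof
      show "(+>) I ` (\<Union> J) \<subseteq> J"
      proof (rule image_subsetI)
        fix r assume "r \<in> \<Union> J"
        moreover from this have "r \<in> carrier R"
          using canonical_proj_vimage_in_carrier[OF I J(3)] by (rule rev_subsetD)
        ultimately show "I +> r \<in> J" using canonical_proj_vimage_mem_iff[OF I J(3)] by simp
      qed
      show "J \<subseteq> (+>) I ` (\<Union> J)"
      proof
        fix x assume x: "x \<in> J"
        then have "x \<in> (+>) I ` carrier R" using J(3) unfolding carrier_quotient by (rule rev_subsetD)
        then obtain r where r: "r \<in> carrier R" "x = I +> r" by (elim imageE)
        then have "r \<in> \<Union> J" using x canonical_proj_vimage_mem_iff[OF I J(3) r(1)] by simp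
        then show "x \<in> (+>) I ` (\<Union> J)" unfolding r(2) by (rule imageI)
      qed
    qed
    ultimately show "J = (+>) I ` M \<or> J = carrier (R Quot I)"
      unfolding carrier_quotient by metis
  qed
qed

section \<open>Ideals of the polynomial ring attached to faces\<close>

lemma polynomial_ring_simps [simp]:
  "p \<in> carrier (polynomial_ring k n) \<longleftrightarrow> supported {1..n} p"
  "p \<otimes>\<^bsub>polynomial_ring k n\<^esub> q = p * q"
  "p \<oplus>\<^bsub>polynomial_ring k n\<^esub> q = p + q"
  "\<one>\<^bsub>polynomial_ring k n\<^esub> = 1"
  "\<zero>\<^bsub>polynomial_ring k n\<^esub> = 0"
  by (simp_all add: polynomial_ring_def supported_def)

lemma supported_0 [simp]: "supported V 0"
  and supported_1 [simp]: "supported V 1"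
  and supported_uminus [simp]: "supported V (- p) \<longleftrightarrow> supported V p"
  by (simp_all add: supported_def)

lemma supported_mult: "supported V p \<Longrightarrow> supported V q \<Longrightarrow> supported V (p * q)"
  unfolding supported_def
proof
  fix m assume pq: "\<forall>m\<in>Poly_Mapping.keys p. Poly_Mapping.keys m \<subseteq> V"
    "\<forall>m\<in>Poly_Mapping.keys q. Poly_Mapping.keys m \<subseteq> V" and "m \<in> Poly_Mapping.keys (p * q)"
  then obtain a b where "a \<in> Poly_Mapping.keys p" "b \<in> Poly_Mapping.keys q" "m = a + b"
    using keys_mult[of p q] by blast
  then show "Poly_Mapping.keys m \<subseteq> V"
    using pq by (simp add: keys_add_nat)
qed

lemma ideal_polynomial_ringI:
  assumes "0 \<in> J" "\<And>a b. a \<in> J \<Longrightarrow> b \<in> J \<Longrightarrow> a + b \<in> J"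
    and "\<And>a r. a \<in> J \<Longrightarrow> supported {1..n} r \<Longrightarrow> r * a \<in> J" and "\<And>a. a \<in> J \<Longrightarrow> supported {1..n} a"
  shows "ideal J (polynomial_ring (k :: 'k::field itself) n)"
proof -
  interpret R: cring "polynomial_ring k n" by (rule cring_polynomial_ring)
  have minus: "\<ominus>\<^bsub>polynomial_ring k n\<^esub> a = - a" if "supported {1..n} a" for a
    using that by (intro R.minus_equality) simp_all
  show ?thesis
  proof (intro idealI R.ring_axioms)
    show "subgroup J (add_monoid (polynomial_ring k n))"
    proof (rule R.add.subgroupI)
      show "\<ominus>\<^bsub>polynomial_ring k n\<^esub> a \<in> J" if "a \<in> J" for a
        using assms(3)[of a "- 1"] assms(4) that by (simp add: minus)
    qed (use assms in auto)
  qed (use assms in \<open>auto simp: mult.commute\<close>)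
qed

lemma ideal_polynomial_ring_inter:
  "ideal_of_ring J \<Longrightarrow> ideal {p \<in> J. supported {1..n} p} (polynomial_ring (k :: 'k::field itself) n)"
  by (rule ideal_polynomial_ringI)
     (auto simp: ideal_of_ring_zero ideal_of_ring_add ideal_of_ring_mult supported_add supported_mult)

text \<open>The ideal generated by the variables with index in {1..n} outside \<open>G\<close>,
  written as the kernel of the map that discards all monomials not supported on \<open>G\<close>.
  For empty \<open>G\<close> it is the ideal of polynomials without constant term.\<close>

definition face_prime :: "nat \<Rightarrow> nat set \<Rightarrow> ((nat \<Rightarrow>\<^sub>0 nat) \<Rightarrow>\<^sub>0 'k::field) set" where
  "face_prime n G = {p. supported {1..n} p \<and> part {m. Poly_Mapping.keys m \<subseteq> G} 0 p = 0}"

lemma part_single: "part A 0 (Poly_Mapping.single m a) = (if m \<in> A then Poly_Mapping.single m a else 0)"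
  by (rule poly_mapping_eqI) (auto simp: lookup_part lookup_single when_def)

text \<open>A product of two monomials is supported on \<open>G\<close> iff both factors are, so
  discarding the other monomials is a ring homomorphism. Its target is a domain, which makes
  \<open>face_prime\<close> prime.\<close>

lemma part_face_mult:
  fixes p q :: "('i \<Rightarrow>\<^sub>0 nat) \<Rightarrow>\<^sub>0 'k::comm_ring_1"
  shows "part {m. Poly_Mapping.keys m \<subseteq> G} 0 (p * q) =
    part {m. Poly_Mapping.keys m \<subseteq> G} 0 p * part {m. Poly_Mapping.keys m \<subseteq> G} 0 q"
proof (induction p rule: poly_mapping_single_induct)
  case (single m a)
  show ?case
    by (induction q rule: poly_mapping_single_induct)
       (simp_all add: mult_single part_single keys_add_nat distrib_left part_add)
qed (simp_all add: distrib_right part_add)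

lemma primeideal_face_prime: "primeideal (face_prime n G) (polynomial_ring (k :: 'k::field itself) n)"
proof (rule primeidealI)
  show "ideal (face_prime n G) (polynomial_ring k n)"
    by (rule ideal_polynomial_ringI)
       (auto simp: face_prime_def part_add part_face_mult supported_add supported_mult)
  show "cring (polynomial_ring k n)" by (rule cring_polynomial_ring)
  have "(1 :: (nat \<Rightarrow>\<^sub>0 nat) \<Rightarrow>\<^sub>0 'k) \<notin> face_prime n G"
    using part_single[of "{m. Poly_Mapping.keys m \<subseteq> G}" "0 :: nat \<Rightarrow>\<^sub>0 nat" "1 :: 'k"] by (simp add: face_prime_def)
  then show "carrier (polynomial_ring k n) \<noteq> face_prime n G" by (metis polynomial_ring_simps(1) supported_1)
qed (auto simp: face_prime_def part_face_mult)

text \<open>A polynomial outside the ideal has a nonzero constant term c and differs from c by an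
  element of the ideal, so every strictly larger ideal contains the unit c.\<close>

lemma maximalideal_face_prime: "maximalideal (face_prime n {}) (polynomial_ring (k :: 'k::field itself) n)"
proof (rule maximalidealI)
  interpret primeideal "face_prime n {}" "polynomial_ring k n" by (rule primeideal_face_prime)
  show "ideal (face_prime n {}) (polynomial_ring k n)" by (rule is_ideal)
  show "carrier (polynomial_ring k n) \<noteq> face_prime n {}" by (rule I_notcarr)
  fix J assume J: "ideal J (polynomial_ring k n)" "face_prime n {} \<subseteq> J" "J \<subseteq> carrier (polynomial_ring k n)"
  show "J = face_prime n {} \<or> J = carrier (polynomial_ring k n)"
  proof (cases "J \<subseteq> face_prime n {}")
    case False
    then obtain p where p: "p \<in> J" "p \<notin> face_prime n {}" by blast
    interpret J: ideal J "polynomial_ring k n" by (rule J(1))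
    have supp: "supported {1..n} p" using p(1) J.Icarr by simp
    define c where "c = Poly_Mapping.lookup p 0"
    have part: "part {m. Poly_Mapping.keys m \<subseteq> {}} 0 p = Poly_Mapping.single 0 c"
      by (rule poly_mapping_eqI) (simp add: lookup_part lookup_single when_def c_def)
    have c: "c \<noteq> 0"
    proof
      assume "c = 0"
      then show False using part p(2) supp unfolding face_prime_def by simp
    qed
    have "Poly_Mapping.single 0 c - p \<in> face_prime n {}"
    proof -
      have "supported {1..n} (Poly_Mapping.single 0 c)" by (simp add: supported_def)
      then have "supported {1..n} (Poly_Mapping.single 0 c + (- p))" using supp by (intro supported_add) simp_all
      moreover have "part {m. Poly_Mapping.keys m \<subseteq> {}} 0 (Poly_Mapping.single 0 c + (- p)) = 0"
        by (rule poly_mapping_eqI)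
           (simp add: lookup_part lookup_single when_def c_def lookup_add lookup_minus)
      ultimately show ?thesis unfolding face_prime_def by simp
    qed
    then have "Poly_Mapping.single 0 c - p \<in> J" using J(2) by (rule rev_subsetD)
    then have "Poly_Mapping.single 0 c \<in> J"
      using J.a_closed[OF p(1), of "Poly_Mapping.single 0 c - p"] by simp
    then have "Poly_Mapping.single 0 (1 / c) * Poly_Mapping.single 0 c \<in> J"
      using J.I_l_closed[of "Poly_Mapping.single 0 c" "Poly_Mapping.single 0 (1 / c)"]
      by (simp add: supported_def)
    then have "1 \<in> J" using c by (simp add: mult_single)
    then show ?thesis using J.one_imp_carrier by simp
  qed (use J(2) in blast)
qed

text \<open>For a simplicial complex this is the extension of the Stanley-Reisner ideal to all
  variables; the intersection with {1..n} ignores the coefficient variables.\<close>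

definition nonface_ideal :: "nat \<Rightarrow> nat set set \<Rightarrow> ((nat \<Rightarrow>\<^sub>0 nat) \<Rightarrow>\<^sub>0 'k::field) set" where
  "nonface_ideal n \<Delta> = {p. \<forall>m\<in>Poly_Mapping.keys p. Poly_Mapping.keys m \<inter> {1..n} \<notin> \<Delta>}"

lemma ideal_nonface_ideal:
  assumes "simplicial_complex n \<Delta>"
  shows "ideal_of_ring (nonface_ideal n \<Delta> :: ((nat \<Rightarrow>\<^sub>0 nat) \<Rightarrow>\<^sub>0 'k::field) set)"
proof -
  have "r * a \<in> nonface_ideal n \<Delta>" if a: "a \<in> nonface_ideal n \<Delta>" for a r :: "(nat \<Rightarrow>\<^sub>0 nat) \<Rightarrow>\<^sub>0 'k"
    unfolding nonface_ideal_def
  proof (intro CollectI ballI)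
    fix m assume "m \<in> Poly_Mapping.keys (r * a)"
    then obtain b c where bc: "c \<in> Poly_Mapping.keys a" "m = b + c"
      using keys_mult[of r a] by blast
    have "Poly_Mapping.keys c \<inter> {1..n} \<notin> \<Delta>"
      using a bc(1) unfolding nonface_ideal_def by simp
    moreover have "Poly_Mapping.keys c \<inter> {1..n} \<subseteq> Poly_Mapping.keys m \<inter> {1..n}"
      unfolding bc keys_add_nat by blast
    ultimately show "Poly_Mapping.keys m \<inter> {1..n} \<notin> \<Delta>"
      using assms unfolding simplicial_complex_def by blast
  qed
  moreover have "a + b \<in> nonface_ideal n \<Delta>"
    if "a \<in> nonface_ideal n \<Delta>" "b \<in> nonface_ideal n \<Delta>" for a b :: "(nat \<Rightarrow>\<^sub>0 nat) \<Rightarrow>\<^sub>0 'k"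
    unfolding nonface_ideal_def
  proof (intro CollectI ballI)
    fix m assume "m \<in> Poly_Mapping.keys (a + b)"
    then have "m \<in> Poly_Mapping.keys a \<or> m \<in> Poly_Mapping.keys b"
      using Poly_Mapping.keys_add[of a b] by blast
    then show "Poly_Mapping.keys m \<inter> {1..n} \<notin> \<Delta>"
      using that unfolding nonface_ideal_def by (elim disjE) simp_all
  qed
  moreover have "(0 :: (nat \<Rightarrow>\<^sub>0 nat) \<Rightarrow>\<^sub>0 'k) \<in> nonface_ideal n \<Delta>"
    by (simp add: nonface_ideal_def)
  ultimately show ?thesis
    unfolding ideal_of_ring_def by (intro conjI ballI allI)
qed

lemma prod_var: "(\<Prod>i\<in>F. (var i :: (nat \<Rightarrow>\<^sub>0 nat) \<Rightarrow>\<^sub>0 'k::field)) =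
    Poly_Mapping.single (\<Sum>i\<in>F. Poly_Mapping.single i 1) 1"
  using prod_var_power[where A = F and e = "\<lambda>_. 1"] by simp

lemma lookup_sum_single:
  "finite F \<Longrightarrow> Poly_Mapping.lookup (\<Sum>i\<in>F. Poly_Mapping.single i (f i)) j = (if j \<in> F then f j else 0)"
  by (simp add: lookup_sum lookup_single when_def)

text \<open>Both sides are spanned by monomials, and a monomial whose support is a nonface is
  divisible by the squarefree generator of that support.\<close>

lemma stanley_reisner_ideal_eq:
  assumes \<Delta>: "simplicial_complex n \<Delta>"
  shows "stanley_reisner_ideal (k :: 'k::field itself) n \<Delta> = {p \<in> nonface_ideal n \<Delta>. supported {1..n} p}"
    (is "?I = ?N")
proof
  interpret R: cring "polynomial_ring k n" by (rule cring_polynomial_ring)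
  let ?S = "{\<Prod>i\<in>F. var i | F. F \<subseteq> {1..n} \<and> F \<notin> \<Delta>} :: ((nat \<Rightarrow>\<^sub>0 nat) \<Rightarrow>\<^sub>0 'k) set"
  have keys: "Poly_Mapping.keys (\<Sum>i\<in>F. Poly_Mapping.single i (1::nat)) = F" if "finite F" for F :: "nat set"
    using that by (auto simp: in_keys_iff lookup_sum_single split: if_splits)
  have gen: "?S \<subseteq> ?N"
  proof clarify
    fix F assume F: "F \<subseteq> {1..n}" "F \<notin> \<Delta>"
    then have "finite F" using finite_subset by blast
    with F show "(\<Prod>i\<in>F. var i) \<in> nonface_ideal n \<Delta> \<and> supported {1..n} (\<Prod>i\<in>F. var i :: (nat \<Rightarrow>\<^sub>0 nat) \<Rightarrow>\<^sub>0 'k)"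
      by (simp add: prod_var nonface_ideal_def supported_def keys Int_absorb2 del: One_nat_def)
  qed
  show "?I \<subseteq> ?N"
    unfolding stanley_reisner_ideal_def
    by (rule R.genideal_minimal[OF ideal_polynomial_ring_inter[OF ideal_nonface_ideal[OF \<Delta>]] gen])
  have S: "?S \<subseteq> carrier (polynomial_ring k n)"
  proof
    fix p assume "p \<in> ?S"
    then have "p \<in> ?N" using gen by (rule rev_subsetD)
    then show "p \<in> carrier (polynomial_ring k n)" by simp
  qed
  interpret I: ideal ?I "polynomial_ring k n"
    unfolding stanley_reisner_ideal_def by (rule R.genideal_ideal[OF S])
  show "?N \<subseteq> ?I"
  proof
    fix p assume p: "p \<in> ?N"
    have "Poly_Mapping.single m (Poly_Mapping.lookup p m) \<in> ?I" if m: "m \<in> Poly_Mapping.keys p" for m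
    proof -
      let ?F = "Poly_Mapping.keys m"
      have F: "?F \<subseteq> {1..n}" using p m by (auto simp: supported_def)
      then have "?F \<notin> \<Delta>" using p m by (auto simp: nonface_ideal_def Int_absorb2)
      then have "(\<Prod>i\<in>?F. var i) \<in> ?S" using F by blast
      then have 1: "(\<Prod>i\<in>?F. var i) \<in> ?I"
        using R.genideal_self[OF S] unfolding stanley_reisner_ideal_def by blast
      let ?e = "\<Sum>i\<in>?F. Poly_Mapping.single i (1::nat)"
      have "supported {1..n} (Poly_Mapping.single (m - ?e) (Poly_Mapping.lookup p m))"
        using F by (auto simp: supported_def in_keys_iff lookup_minus)
      then have "Poly_Mapping.single (m - ?e) (Poly_Mapping.lookup p m) * (\<Prod>i\<in>?F. var i) \<in> ?I"
        using I.I_l_closed[OF 1] by simp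
      \<comment> \<open>The truncated subtraction loses nothing, since each exponent of
        \<open>m\<close> on its support is at least 1.\<close>
      moreover have "(m - ?e) + ?e = m"
        by (rule poly_mapping_eqI)
           (auto simp: lookup_add lookup_minus lookup_sum_single in_keys_iff)
      ultimately show ?thesis by (simp add: prod_var mult_single del: One_nat_def)
    qed
    moreover have "sum f A \<in> ?I" if "\<forall>i\<in>A. f i \<in> ?I" for f :: "(nat \<Rightarrow>\<^sub>0 nat) \<Rightarrow> (nat \<Rightarrow>\<^sub>0 nat) \<Rightarrow>\<^sub>0 'k" and A
      using that
    proof (induction A rule: infinite_finite_induct)
      case (insert x A)
      then show ?case using I.a_closed[of "f x" "sum f A"] by simp
    qed (use I.zero_closed in simp_all)
    ultimately show "p \<in> ?I" using poly_mapping_sum_single[of p] by metis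
  qed
qed

lemma face_prime_mono: "G \<subseteq> G' \<Longrightarrow> face_prime n G' \<subseteq> face_prime n G"
proof
  fix p :: "(nat \<Rightarrow>\<^sub>0 nat) \<Rightarrow>\<^sub>0 'k::field" assume G: "G \<subseteq> G'" and "p \<in> face_prime n G'"
  then have p: "supported {1..n} p" and 0: "part {m. Poly_Mapping.keys m \<subseteq> G'} 0 p = 0"
    by (simp_all add: face_prime_def)
  have "part {m. Poly_Mapping.keys m \<subseteq> G} 0 p = 0"
  proof (rule poly_mapping_eqI)
    fix m
    have "Poly_Mapping.lookup (part {m. Poly_Mapping.keys m \<subseteq> G'} 0 p) m = 0" using 0 by simp
    then show "Poly_Mapping.lookup (part {m. Poly_Mapping.keys m \<subseteq> G} 0 p) m = Poly_Mapping.lookup 0 m"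
      using G by (auto simp: lookup_part split: if_splits)
  qed
  then show "p \<in> face_prime n G" using p by (simp add: face_prime_def)
qed

lemma stanley_reisner_ideal_subset_face_prime:
  assumes \<Delta>: "simplicial_complex n \<Delta>" and F: "F \<in> \<Delta>"
  shows "stanley_reisner_ideal (k :: 'k::field itself) n \<Delta> \<subseteq> face_prime n F"
proof
  fix p assume "p \<in> stanley_reisner_ideal k n \<Delta>"
  then have p: "p \<in> nonface_ideal n \<Delta>" "supported {1..n} p" by (simp_all add: stanley_reisner_ideal_eq[OF \<Delta>])
  have "m \<notin> Poly_Mapping.keys p" if "Poly_Mapping.keys m \<subseteq> F" for m
  proof
    assume "m \<in> Poly_Mapping.keys p"
    then have "Poly_Mapping.keys m \<inter> {1..n} \<notin> \<Delta>" using p(1) by (simp add: nonface_ideal_def)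
    moreover have "Poly_Mapping.keys m \<inter> {1..n} \<subseteq> F" using that by blast
    ultimately show False using \<Delta> F unfolding simplicial_complex_def by blast
  qed
  then have "part {m. Poly_Mapping.keys m \<subseteq> F} 0 p = 0"
    by (intro poly_mapping_eqI) (auto simp: lookup_part in_keys_iff)
  then show "p \<in> face_prime n F" using p(2) by (simp add: face_prime_def)
qed

lemma var_in_face_prime_iff:
  "i \<in> {1..n} \<Longrightarrow> (var i :: (nat \<Rightarrow>\<^sub>0 nat) \<Rightarrow>\<^sub>0 'k::field) \<in> face_prime n G \<longleftrightarrow> i \<notin> G"
  by (auto simp: face_prime_def var_def supported_def part_single dest: arg_cong[of _ _ Poly_Mapping.keys])

definition irrelevant_ideal :: "'k::field itself \<Rightarrow> nat \<Rightarrow> nat set set \<Rightarrow> ((nat \<Rightarrow>\<^sub>0 nat) \<Rightarrow>\<^sub>0 'k) set set" where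
  "irrelevant_ideal k n \<Delta> =
     (+>\<^bsub>polynomial_ring k n\<^esub>) (stanley_reisner_ideal k n \<Delta>) ` face_prime n {}"

section \<open>A chain of primes below the irrelevant ideal\<close>

context
  fixes k :: "'k::field itself" and n :: nat and \<Delta> :: "nat set set"
  assumes \<Delta>: "simplicial_complex n \<Delta>" and nonvoid: "{} \<in> \<Delta>"
begin

interpretation R: cring "polynomial_ring k n" by (rule cring_polynomial_ring)

lemma ideal_stanley_reisner: "ideal (stanley_reisner_ideal k n \<Delta>) (polynomial_ring k n)"
  unfolding stanley_reisner_ideal_eq[OF \<Delta>]
  by (rule ideal_polynomial_ring_inter[OF ideal_nonface_ideal[OF \<Delta>]])

lemma maximalideal_irrelevant: "maximalideal (irrelevant_ideal k n \<Delta>) (stanley_reisner_ring k n \<Delta>)"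
  unfolding irrelevant_ideal_def stanley_reisner_ring_def
  by (intro R.maximalideal_quotient ideal_stanley_reisner maximalideal_face_prime
      stanley_reisner_ideal_subset_face_prime[OF \<Delta> nonvoid])

text \<open>Removing the vertices of \<open>F\<close> one at a time makes the face primes grow, in
  \<open>card F\<close> strict steps, from the prime of \<open>F\<close> to that of the empty
  face.\<close>

lemma card_face_le_height:
  assumes F: "F \<in> \<Delta>"
  shows "enat (card F) \<le> prime_height (stanley_reisner_ring k n \<Delta>) (irrelevant_ideal k n \<Delta>)"
proof -
  have Fn: "F \<subseteq> {1..n}" using \<Delta> F unfolding simplicial_complex_def by blast
  then have "finite F" using finite_subset by blast
  then obtain e where e: "bij_betw e {0..<card F} F" using ex_bij_betw_nat_finite by blast
  let ?G = "\<lambda>i. e ` {i..<card F}"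
  let ?I = "stanley_reisner_ideal k n \<Delta>"
  let ?C = "\<lambda>i. (+>\<^bsub>polynomial_ring k n\<^esub>) ?I ` face_prime n (?G i)"
  have GF: "?G i \<subseteq> F" for i using bij_betw_imp_surj_on[OF e] by auto
  have IC: "?I \<subseteq> face_prime n (?G i)" for i
    using \<Delta> F GF[of i] unfolding simplicial_complex_def
    by (intro stanley_reisner_ideal_subset_face_prime[OF \<Delta>]) blast
  have "?C i \<subset> ?C (Suc i)" if i: "i < card F" for i
  proof -
    have "?G (Suc i) \<subseteq> ?G i" by auto
    then have "?C i \<subseteq> ?C (Suc i)" by (rule image_mono[OF face_prime_mono])
    moreover have ei: "e i \<in> ?G i" "e i \<notin> ?G (Suc i)"
    proof -
      show "e i \<in> ?G i" using i by simp
      show "e i \<notin> ?G (Suc i)"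
      proof
        assume "e i \<in> ?G (Suc i)"
        then obtain j where j: "j \<in> {Suc i..<card F}" "e i = e j" by blast
        then have "i = j" using i by (intro inj_onD[OF bij_betw_imp_inj_on[OF e] j(2)]) simp_all
        then show False using j(1) by simp
      qed
    qed
    then have n: "e i \<in> {1..n}" using GF Fn by blast
    \<comment> \<open>The variable of the vertex just removed separates consecutive primes, also in
      the quotient, because all of them contain the Stanley-Reisner ideal.\<close>
    have "?I +>\<^bsub>polynomial_ring k n\<^esub> var (e i) \<in> ?C j \<longleftrightarrow> (var (e i) :: (nat \<Rightarrow>\<^sub>0 nat) \<Rightarrow>\<^sub>0 'k) \<in> face_prime n (?G j)" for j
      using n by (intro R.coset_in_image_iff ideal_stanley_reisner IC primeideal.axioms(1)[OF primeideal_face_prime])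
        (simp add: var_def supported_def)
    then have "?I +>\<^bsub>polynomial_ring k n\<^esub> var (e i) \<notin> ?C i" "?I +>\<^bsub>polynomial_ring k n\<^esub> var (e i) \<in> ?C (Suc i)"
      using ei n by (simp_all only: var_in_face_prime_iff) simp_all
    ultimately show ?thesis by blast
  qed
  moreover have "primeideal (?C i) (stanley_reisner_ring k n \<Delta>)" for i
    unfolding stanley_reisner_ring_def
    by (intro R.primeideal_quotient ideal_stanley_reisner primeideal_face_prime IC)
  ultimately have "prime_chain (stanley_reisner_ring k n \<Delta>) (card F) ?C"
    unfolding prime_chain_def by blast
  moreover have "?C (card F) = irrelevant_ideal k n \<Delta>"
    by (simp add: irrelevant_ideal_def)
  ultimately show ?thesis
    unfolding prime_height_def by (intro Sup_upper) blast
qed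

end

section \<open>Lifting regular sequences\<close>

definition restrict_monomial :: "nat set \<Rightarrow> (nat \<Rightarrow>\<^sub>0 nat) \<Rightarrow> (nat \<Rightarrow>\<^sub>0 nat)" where
  "restrict_monomial A m = (\<Sum>i\<in>Poly_Mapping.keys m \<inter> A. Poly_Mapping.single i (Poly_Mapping.lookup m i))"

lemma lookup_restrict_monomial:
  "Poly_Mapping.lookup (restrict_monomial A m) i = (if i \<in> A then Poly_Mapping.lookup m i else 0)"
  unfolding restrict_monomial_def by (auto simp: lookup_sum_single in_keys_iff)

lemma keys_restrict_monomial: "Poly_Mapping.keys (restrict_monomial A m) = Poly_Mapping.keys m \<inter> A"
  by (auto simp: in_keys_iff lookup_restrict_monomial split: if_splits)

lemma restrict_monomial_add: "restrict_monomial A m + restrict_monomial (- A) m = m"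
  by (rule poly_mapping_eqI) (simp add: lookup_add lookup_restrict_monomial)

lemma monomial_decomposition_unique:
  fixes a b c d :: "nat \<Rightarrow>\<^sub>0 nat"
  assumes "a + b = c + d" "Poly_Mapping.keys a \<subseteq> V" "Poly_Mapping.keys c \<subseteq> V"
    and "Poly_Mapping.keys b \<inter> V = {}" "Poly_Mapping.keys d \<inter> V = {}"
  shows "b = d"
proof (rule poly_mapping_eqI)
  fix i
  have "Poly_Mapping.lookup a i + Poly_Mapping.lookup b i = Poly_Mapping.lookup c i + Poly_Mapping.lookup d i"
    using assms(1) by (metis lookup_add)
  moreover have "Poly_Mapping.lookup a i = 0 \<and> Poly_Mapping.lookup c i = 0" if "i \<notin> V"
    using assms(2,3) that by (auto simp: not_in_keys_iff_lookup_eq_zero[symmetric])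
  moreover have "Poly_Mapping.lookup b i = 0 \<and> Poly_Mapping.lookup d i = 0" if "i \<in> V"
    using assms(4,5) that by (auto simp: not_in_keys_iff_lookup_eq_zero[symmetric])
  ultimately show "Poly_Mapping.lookup b i = Poly_Mapping.lookup d i" by (cases "i \<in> V") auto
qed

abbreviation monomials_in :: "nat set \<Rightarrow> (nat \<Rightarrow>\<^sub>0 nat) set" where
  "monomials_in V \<equiv> {m. Poly_Mapping.keys m \<subseteq> V}"

lemma sum_parts_single:
  fixes c :: "'k::comm_ring_1"
  assumes "finite U" "\<forall>m\<in>U. Poly_Mapping.keys m \<inter> V = {}" "restrict_monomial (- V) a \<in> U"
  shows "(\<Sum>m\<in>U. Poly_Mapping.single m 1 * part (monomials_in V) m (Poly_Mapping.single a c)) = Poly_Mapping.single a c"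
proof -
  let ?b = "restrict_monomial V a" and ?d = "restrict_monomial (- V) a"
  have eq: "Poly_Mapping.single m 1 * part (monomials_in V) m (Poly_Mapping.single a c) =
      (if m = ?d then Poly_Mapping.single a c else 0)" if m: "m \<in> U" for m
  proof (cases "m = ?d")
    case True
    have b: "?b \<in> monomials_in V" by (simp add: keys_restrict_monomial)
    have "part (monomials_in V) m (Poly_Mapping.single a c) = Poly_Mapping.single ?b c"
      using part_single_in[OF b, of ?d c] restrict_monomial_add[of V a] True by simp
    moreover have "?d + ?b = a" using restrict_monomial_add[of V a] by (simp add: add.commute)
    ultimately show ?thesis using True by (simp add: mult_single)
  next
    case False
    have "\<not> (\<exists>b\<in>monomials_in V. b + m = a)"
    proof
      assume "\<exists>b\<in>monomials_in V. b + m = a"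
      then obtain b where b: "Poly_Mapping.keys b \<subseteq> V" "b + m = a" by blast
      have "m = ?d"
        by (rule monomial_decomposition_unique[of b m ?b ?d V])
           (use b m assms(2) restrict_monomial_add[of V a] in \<open>auto simp: keys_restrict_monomial\<close>)
      then show False using False by simp
    qed
    then show ?thesis using False by (simp add: part_single_notin)
  qed
  then show ?thesis using assms(1,3) by (simp add: sum.delta cong: sum.cong)
qed

text \<open>The monomials in the variables outside \<open>V\<close>, each multiplied by its
  coefficient, add up to \<open>p\<close>.\<close>

lemma mem_if_parts_mem:
  assumes J: "ideal_of_ring J"
    and parts: "\<forall>m. Poly_Mapping.keys m \<inter> V = {} \<longrightarrow> part (monomials_in V) m p \<in> J"
  shows "p \<in> J"
proof -
  let ?K = "Poly_Mapping.keys p"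
  define U where "U = restrict_monomial (- V) ` ?K"
  have U: "finite U" "\<forall>m\<in>U. Poly_Mapping.keys m \<inter> V = {}"
    by (auto simp: U_def keys_restrict_monomial)
  have "(\<Sum>m\<in>U. Poly_Mapping.single m 1 * part (monomials_in V) m p) =
    (\<Sum>m\<in>U. \<Sum>a\<in>?K. Poly_Mapping.single m 1 * part (monomials_in V) m (Poly_Mapping.single a (Poly_Mapping.lookup p a)))"
    by (subst poly_mapping_sum_single[of p]) (simp only: part_sum sum_distrib_left)
  also have "\<dots> = (\<Sum>a\<in>?K. \<Sum>m\<in>U. Poly_Mapping.single m 1 * part (monomials_in V) m (Poly_Mapping.single a (Poly_Mapping.lookup p a)))"
    by (rule sum.swap)
  also have "\<dots> = (\<Sum>a\<in>?K. Poly_Mapping.single a (Poly_Mapping.lookup p a))"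
    by (intro sum.cong refl sum_parts_single U) (simp add: U_def)
  also have "\<dots> = p" by (rule poly_mapping_sum_single[symmetric])
  finally have "p = (\<Sum>m\<in>U. Poly_Mapping.single m 1 * part (monomials_in V) m p)" by (rule sym)
  moreover have "(\<Sum>m\<in>U. Poly_Mapping.single m 1 * part (monomials_in V) m p) \<in> J"
    by (rule ideal_of_ring_sum[OF J]) (use U(2) parts ideal_of_ring_mult[OF J] in simp)
  ultimately show ?thesis by simp
qed

lemma subset_foldl_adjoin: "J \<subseteq> foldl adjoin J ys"
proof (induction ys arbitrary: J)
  case (Cons y ys)
  show ?case using subset_adjoin[of J y] Cons.IH[of "adjoin J y"] by simp
qed simp

lemma mem_foldl_adjoin: "ideal_of_ring J \<Longrightarrow> y \<in> set ys \<Longrightarrow> y \<in> foldl adjoin J ys"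
proof (induction ys arbitrary: J)
  case (Cons x ys)
  have "x \<in> adjoin J x" using mult_in_adjoin[OF Cons.prems(1), of x 1] by simp
  then show ?case
    using Cons.prems Cons.IH[OF ideal_of_ring_adjoin[OF Cons.prems(1), of x]]
      subset_foldl_adjoin[of "adjoin J x" ys] by auto
qed simp

text \<open>Extracting the coefficient of a monomial outside \<open>V\<close> is linear over the
  polynomials in the variables \<open>V\<close>.\<close>

lemma part_supported_mult:
  assumes "supported V y" "Poly_Mapping.keys m \<inter> V = {}"
  shows "part (monomials_in V) m (y * p) = y * part (monomials_in V) m p"
proof (rule part_mult)
  fix a c assume a: "a \<in> Poly_Mapping.keys y"
  then have aV: "Poly_Mapping.keys a \<subseteq> V" using assms(1) by (simp add: supported_def)
  show "(\<exists>b\<in>monomials_in V. b + m = a + c) \<longleftrightarrow> (\<exists>b\<in>monomials_in V. b + m = c)"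
  proof
    assume "\<exists>b\<in>monomials_in V. b + m = c"
    then obtain b where b: "Poly_Mapping.keys b \<subseteq> V" "b + m = c" by blast
    have "(a + b) + m = a + c" using b(2) by (simp add: add.assoc)
    moreover have "a + b \<in> monomials_in V" using aV b(1) by (simp add: keys_add_nat)
    ultimately show "\<exists>b\<in>monomials_in V. b + m = a + c" by blast
  next
    assume "\<exists>b\<in>monomials_in V. b + m = a + c"
    then obtain b where b: "Poly_Mapping.keys b \<subseteq> V" "b + m = a + c" by blast
    let ?b = "restrict_monomial V c" and ?d = "restrict_monomial (- V) c"
    have c: "?b + ?d = c" by (rule restrict_monomial_add)
    have "m = ?d"
    proof (rule monomial_decomposition_unique[of b m "a + ?b" ?d V])
      show "b + m = a + ?b + ?d" using b(2) c by (simp add: add.assoc)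
    qed (use b(1) aV assms(2) in \<open>auto simp: keys_restrict_monomial keys_add_nat\<close>)
    then have "?b + m = c" using c by simp
    moreover have "?b \<in> monomials_in V" by (simp add: keys_restrict_monomial)
    ultimately show "\<exists>b\<in>monomials_in V. b + m = c" by blast
  qed
qed

lemma supported_part: "supported V (part (monomials_in V) m p)"
  by (auto simp: supported_def keys_part)

section \<open>Extension from the Stanley-Reisner ring to the ring in all variables\<close>

context
  fixes k :: "'k::field itself" and n :: nat and \<Delta> :: "nat set set"
    and xs :: "((nat \<Rightarrow>\<^sub>0 nat) \<Rightarrow>\<^sub>0 'k) set list" and y :: "nat \<Rightarrow> (nat \<Rightarrow>\<^sub>0 nat) \<Rightarrow>\<^sub>0 'k"
  assumes \<Delta>: "simplicial_complex n \<Delta>" and nonvoid: "{} \<in> \<Delta>"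
    and reg: "regular_sequence (stanley_reisner_ring k n \<Delta>) xs"
    and y_supported: "\<And>i. i < length xs \<Longrightarrow> supported {1..n} (y i)"
    and y_coset: "\<And>i. i < length xs \<Longrightarrow>
      xs ! i = stanley_reisner_ideal k n \<Delta> +>\<^bsub>polynomial_ring k n\<^esub> y i"
begin

interpretation R: cring "polynomial_ring k n" by (rule cring_polynomial_ring)
interpretation Q: cring "stanley_reisner_ring k n \<Delta>" by (rule cring_stanley_reisner_ring)
interpretation I: ideal "stanley_reisner_ideal k n \<Delta>" "polynomial_ring k n"
  by (rule ideal_stanley_reisner[OF \<Delta> nonvoid])

text \<open>Pulled back to the polynomial ring in the x, the ideals of the quotient ring become
  comparable with those of the whole type.\<close>

definition segment_ideal :: "nat \<Rightarrow> ((nat \<Rightarrow>\<^sub>0 nat) \<Rightarrow>\<^sub>0 'k) set" where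
  "segment_ideal i = {p \<in> carrier (polynomial_ring k n).
     stanley_reisner_ideal k n \<Delta> +>\<^bsub>polynomial_ring k n\<^esub> p
       \<in> Idl\<^bsub>stanley_reisner_ring k n \<Delta>\<^esub> (set (take i xs))}"

lemma take_carrier: "set (take i xs) \<subseteq> carrier (stanley_reisner_ring k n \<Delta>)"
  using reg set_take_subset[of i xs] unfolding regular_sequence_def by (meson subset_trans)

lemma ideal_segment: "ideal (Idl\<^bsub>stanley_reisner_ring k n \<Delta>\<^esub> (set (take i xs))) (stanley_reisner_ring k n \<Delta>)"
  by (rule Q.genideal_ideal[OF take_carrier])

lemma ideal_segment_ideal: "ideal (segment_ideal i) (polynomial_ring k n)"
  unfolding segment_ideal_def
  by (rule ring_hom_ring.ideal_vimage[OF I.rcos_ring_hom_ring])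
     (use ideal_segment in \<open>simp add: stanley_reisner_ring_def\<close>)

lemma coset_mult:
  assumes "supported {1..n} p" "supported {1..n} q"
  shows "(stanley_reisner_ideal k n \<Delta> +>\<^bsub>polynomial_ring k n\<^esub> p)
      \<otimes>\<^bsub>stanley_reisner_ring k n \<Delta>\<^esub> (stanley_reisner_ideal k n \<Delta> +>\<^bsub>polynomial_ring k n\<^esub> q) =
    stanley_reisner_ideal k n \<Delta> +>\<^bsub>polynomial_ring k n\<^esub> (p * q)"
  using I.rcoset_mult_add[of p q] assms by (simp add: stanley_reisner_ring_def FactRing_def)

lemma segment_ideal_Suc: "segment_ideal i \<subseteq> segment_ideal (Suc i)"
proof -
  have "set (take i xs) \<subseteq> set (take (Suc i) xs)" by (rule set_take_subset_set_take) simp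
  then have "Idl\<^bsub>stanley_reisner_ring k n \<Delta>\<^esub> (set (take i xs)) \<subseteq> Idl\<^bsub>stanley_reisner_ring k n \<Delta>\<^esub> (set (take (Suc i) xs))"
    by (intro Q.genideal_minimal[OF ideal_segment] subset_trans[OF _ Q.genideal_self[OF take_carrier]])
  then show ?thesis unfolding segment_ideal_def by blast
qed

lemma y_in_segment_ideal:
  assumes i: "i < length xs"
  shows "y i \<in> segment_ideal (Suc i)"
proof -
  have "xs ! i \<in> set (take (Suc i) xs)" using i by (simp add: take_Suc_conv_app_nth)
  then have "xs ! i \<in> Idl\<^bsub>stanley_reisner_ring k n \<Delta>\<^esub> (set (take (Suc i) xs))"
    using Q.genideal_self[OF take_carrier] by (rule rev_subsetD)
  then show ?thesis using y_coset[OF i] y_supported[OF i] by (simp add: segment_ideal_def)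
qed

lemma parts_in_segment_ideal:
  "i \<le> length xs \<Longrightarrow> p \<in> foldl adjoin (nonface_ideal n \<Delta>) (map y [0..<i]) \<Longrightarrow>
    Poly_Mapping.keys m \<inter> {1..n} = {} \<Longrightarrow> part (monomials_in {1..n}) m p \<in> segment_ideal i"
proof (induction i arbitrary: p)
  case 0
  have "part (monomials_in {1..n}) m p \<in> nonface_ideal n \<Delta>"
    unfolding nonface_ideal_def
  proof (intro CollectI ballI)
    fix b assume "b \<in> Poly_Mapping.keys (part (monomials_in {1..n}) m p)"
    then have "b + m \<in> Poly_Mapping.keys p" by (simp add: keys_part)
    then have "Poly_Mapping.keys (b + m) \<inter> {1..n} \<notin> \<Delta>" using 0 by (simp add: nonface_ideal_def)
    moreover have "Poly_Mapping.keys (b + m) \<inter> {1..n} = Poly_Mapping.keys b \<inter> {1..n}"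
      using 0(3) by (auto simp: keys_add_nat)
    ultimately show "Poly_Mapping.keys b \<inter> {1..n} \<notin> \<Delta>" by simp
  qed
  then have I: "part (monomials_in {1..n}) m p \<in> stanley_reisner_ideal k n \<Delta>"
    by (simp add: stanley_reisner_ideal_eq[OF \<Delta>] supported_part)
  then have "stanley_reisner_ideal k n \<Delta> +>\<^bsub>polynomial_ring k n\<^esub> part (monomials_in {1..n}) m p
      = \<zero>\<^bsub>stanley_reisner_ring k n \<Delta>\<^esub>"
    by (simp add: stanley_reisner_ring_def FactRing_def I.a_rcos_const)
  then show ?case
    unfolding segment_ideal_def
    using additive_subgroup.zero_closed[OF ideal.axioms(1)[OF ideal_segment[of 0]]]
    by (simp add: supported_part)
next
  case (Suc i)
  have i: "i < length xs" using Suc.prems by simp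
  have "p \<in> adjoin (foldl adjoin (nonface_ideal n \<Delta>) (map y [0..<i])) (y i)"
    using Suc.prems(2) by simp
  then obtain a b where ab: "a \<in> foldl adjoin (nonface_ideal n \<Delta>) (map y [0..<i])" "p = a + y i * b"
    unfolding adjoin_def[of _ "y i"] by blast
  interpret S: ideal "segment_ideal (Suc i)" "polynomial_ring k n" by (rule ideal_segment_ideal)
  have "part (monomials_in {1..n}) m a \<in> segment_ideal (Suc i)"
    using Suc.IH[OF _ ab(1) Suc.prems(3)] i segment_ideal_Suc by auto
  moreover have "y i * part (monomials_in {1..n}) m b \<in> segment_ideal (Suc i)"
    using S.I_r_closed[OF y_in_segment_ideal[OF i], of "part (monomials_in {1..n}) m b"]
    by (simp add: supported_part)
  ultimately have "part (monomials_in {1..n}) m a + y i * part (monomials_in {1..n}) m b \<in> segment_ideal (Suc i)"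
    using S.a_closed by simp
  then show ?case
    by (simp only: ab(2) part_add part_supported_mult[OF y_supported[OF i] Suc.prems(3)])
qed

lemma segment_ideal_subset:
  assumes i: "i \<le> length xs"
  shows "segment_ideal i \<subseteq> foldl adjoin (nonface_ideal n \<Delta>) (map y [0..<i])"
proof
  let ?J = "foldl adjoin (nonface_ideal n \<Delta>) (map y [0..<i])"
  let ?A = "{p \<in> ?J. supported {1..n} p}"
  let ?c = "\<lambda>p. stanley_reisner_ideal k n \<Delta> +>\<^bsub>polynomial_ring k n\<^esub> p"
  have J: "ideal_of_ring ?J"
    by (rule ideal_of_ring_foldl_adjoin[OF ideal_nonface_ideal[OF \<Delta>]])
  have A: "ideal ?A (polynomial_ring k n)" by (rule ideal_polynomial_ring_inter[OF J])
  have IA: "stanley_reisner_ideal k n \<Delta> \<subseteq> ?A"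
    unfolding stanley_reisner_ideal_eq[OF \<Delta>] using subset_foldl_adjoin by blast
  have cA: "ideal (?c ` ?A) (stanley_reisner_ring k n \<Delta>)"
    unfolding stanley_reisner_ring_def by (rule R.ring_ideal_imp_quot_ideal[OF I.is_ideal A])
  have "set (take i xs) \<subseteq> ?c ` ?A"
  proof
    fix x assume "x \<in> set (take i xs)"
    then obtain j where j: "j < i" "x = xs ! j" using i by (auto simp: in_set_conv_nth)
    then have "y j \<in> ?J" by (intro mem_foldl_adjoin ideal_nonface_ideal[OF \<Delta>]) simp
    moreover have "supported {1..n} (y j)" "x = ?c (y j)"
      using j i y_supported[of j] y_coset[of j] by simp_all
    ultimately show "x \<in> ?c ` ?A" by simp
  qed
  then have sub: "Idl\<^bsub>stanley_reisner_ring k n \<Delta>\<^esub> (set (take i xs)) \<subseteq> ?c ` ?A"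
    by (rule Q.genideal_minimal[OF cA])
  fix p assume "p \<in> segment_ideal i"
  then have p: "p \<in> carrier (polynomial_ring k n)" "?c p \<in> ?c ` ?A"
    using sub by (auto simp: segment_ideal_def simp del: polynomial_ring_simps)
  then have "p \<in> ?A" using R.coset_in_image_iff[OF I.is_ideal A IA p(1)] by simp
  then show "p \<in> ?J" by simp
qed

text \<open>Membership in the extended ideal is a condition on each coefficient with respect to the
  outer monomials; this takes the place of flatness of k[x] -> k[x, u].\<close>

lemma mem_foldl_adjoin_iff:
  assumes "i \<le> length xs"
  shows "p \<in> foldl adjoin (nonface_ideal n \<Delta>) (map y [0..<i]) \<longleftrightarrow>
    (\<forall>m. Poly_Mapping.keys m \<inter> {1..n} = {} \<longrightarrow> part (monomials_in {1..n}) m p \<in> segment_ideal i)"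
  (is "?l \<longleftrightarrow> ?r")
proof
  assume ?l
  then show ?r using parts_in_segment_ideal[OF assms] by simp
next
  assume r: ?r
  show ?l
    by (rule mem_if_parts_mem[OF ideal_of_ring_foldl_adjoin[OF ideal_nonface_ideal[OF \<Delta>]]])
       (use r segment_ideal_subset[OF assms] in auto)
qed

text \<open>Since \<open>y i\<close> involves the x alone, multiplication by it acts on every
  coefficient separately, and regularity is checked coefficientwise in the Stanley-Reisner
  ring.\<close>

lemma regular_mod_lift: "regular_mod (nonface_ideal n \<Delta>) (map y [0..<length xs])"
  unfolding regular_mod_iff
proof (intro allI impI)
  fix i assume "i < length (map y [0..<length xs])"
  then have i: "i < length xs" by simp
  have eq: "take i (map y [0..<length xs]) = map y [0..<i]" using i by (simp add: take_map)
  have "nonzerodivisor_mod (foldl adjoin (nonface_ideal n \<Delta>) (map y [0..<i])) (y i)"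
    unfolding nonzerodivisor_mod_def mem_foldl_adjoin_iff[OF less_imp_le[OF i]]
  proof (intro allI impI)
    fix p and m :: "nat \<Rightarrow>\<^sub>0 nat"
    assume *: "\<forall>m. Poly_Mapping.keys m \<inter> {1..n} = {} \<longrightarrow>
        part (monomials_in {1..n}) m (y i * p) \<in> segment_ideal i"
      and m: "Poly_Mapping.keys m \<inter> {1..n} = {}"
    let ?q = "part (monomials_in {1..n}) m p"
    let ?c = "\<lambda>p. stanley_reisner_ideal k n \<Delta> +>\<^bsub>polynomial_ring k n\<^esub> p"
    have "y i * ?q \<in> segment_ideal i"
      using * m by (simp only: part_supported_mult[OF y_supported[OF i] m, symmetric])
    then have "xs ! i \<otimes>\<^bsub>stanley_reisner_ring k n \<Delta>\<^esub> ?c ?q \<in> Idl\<^bsub>stanley_reisner_ring k n \<Delta>\<^esub> (set (take i xs))"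
      unfolding y_coset[OF i] coset_mult[OF y_supported[OF i] supported_part]
      by (simp add: segment_ideal_def)
    moreover have "?c ?q \<in> carrier (stanley_reisner_ring k n \<Delta>)"
      unfolding stanley_reisner_ring_def R.carrier_quotient by (rule imageI) (simp add: supported_part)
    ultimately have "?c ?q \<in> Idl\<^bsub>stanley_reisner_ring k n \<Delta>\<^esub> (set (take i xs))"
      using reg i unfolding regular_sequence_def by simp
    then show "?q \<in> segment_ideal i" by (simp add: segment_ideal_def supported_part)
  qed
  then show "nonzerodivisor_mod (foldl adjoin (nonface_ideal n \<Delta>) (take i (map y [0..<length xs]))) (map y [0..<length xs] ! i)"
    using i by (simp add: eq)
qed

end

text \<open>Without a constant term, every monomial that occurs is divisible by some variable, and
  its whole term is assigned to that variable.\<close>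

lemma sum_var_of_face_prime:
  assumes "(p :: (nat \<Rightarrow>\<^sub>0 nat) \<Rightarrow>\<^sub>0 'k::field) \<in> face_prime n {}"
  shows "\<exists>h. p = (\<Sum>j\<in>{1..n}. h j * var j)"
proof -
  let ?S = "{q. \<exists>h. q = (\<Sum>j\<in>{1..n}. h j * (var j :: (nat \<Rightarrow>\<^sub>0 nat) \<Rightarrow>\<^sub>0 'k))}"
  have zero: "0 \<in> ?S" by (auto intro!: exI[of _ "\<lambda>_. 0"])
  have add: "p + q \<in> ?S" if pq: "p \<in> ?S" "q \<in> ?S" for p q
  proof -
    obtain g h where "p = (\<Sum>j\<in>{1..n}. g j * var j)" "q = (\<Sum>j\<in>{1..n}. h j * var j)"
      using pq by blast
    then have "p + q = (\<Sum>j\<in>{1..n}. (g j + h j) * var j)" by (simp add: sum.distrib distrib_right)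
    then show ?thesis by (intro CollectI exI)
  qed
  have sum: "sum f A \<in> ?S" if "\<forall>a\<in>A. f a \<in> ?S" for f :: "(nat \<Rightarrow>\<^sub>0 nat) \<Rightarrow> _" and A
    using that
  proof (induction A rule: infinite_finite_induct)
    case (insert a A)
    then have "f a + sum f A \<in> ?S" by (intro add) simp_all
    then show ?case using insert.hyps by simp
  qed (use zero in simp_all)
  have "Poly_Mapping.single m (Poly_Mapping.lookup p m) \<in> ?S" if m: "m \<in> Poly_Mapping.keys p" for m
  proof -
    have supp: "Poly_Mapping.keys m \<subseteq> {1..n}" using assms m by (simp add: face_prime_def supported_def)
    have "Poly_Mapping.lookup (part {m. Poly_Mapping.keys m \<subseteq> {}} 0 p) 0 = 0"
      using assms by (simp add: face_prime_def)
    then have "Poly_Mapping.lookup p 0 = 0" by (simp add: lookup_part)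
    then have "m \<noteq> 0" using m by (auto simp: in_keys_iff)
    then obtain j where j: "j \<in> Poly_Mapping.keys m" by (metis equals0I keys_eq_empty)
    have "(m - Poly_Mapping.single j 1) + Poly_Mapping.single j 1 = m"
      using j by (intro poly_mapping_eqI) (auto simp: lookup_add lookup_minus lookup_single when_def in_keys_iff)
    then have "Poly_Mapping.single m (Poly_Mapping.lookup p m) =
        Poly_Mapping.single (m - Poly_Mapping.single j 1) (Poly_Mapping.lookup p m) * var j"
      by (simp add: var_def mult_single del: One_nat_def)
    also have "\<dots> = (\<Sum>i\<in>{1..n}. (if i = j then Poly_Mapping.single (m - Poly_Mapping.single j 1) (Poly_Mapping.lookup p m) else 0) * var i)"
    proof -
      have "j \<in> {1..n}" using j supp by blast
      then show ?thesis by (simp add: if_distrib[of "\<lambda>x. x * _"] cong: if_cong)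
    qed
    finally show ?thesis by (intro CollectI exI)
  qed
  then have "(\<Sum>m\<in>Poly_Mapping.keys p. Poly_Mapping.single m (Poly_Mapping.lookup p m)) \<in> ?S"
    by (intro sum) simp
  then show ?thesis by (simp add: poly_mapping_sum_single[symmetric])
qed

lemma regular_sequence_take:
  assumes "regular_sequence R xs" "ring R"
  shows "regular_sequence R (take d xs)"
proof -
  interpret ring R by (rule assms(2))
  have xs: "set xs \<subseteq> carrier R" using assms(1) by (simp add: regular_sequence_def)
  then have td: "set (take d xs) \<subseteq> carrier R" using set_take_subset[of d xs] by (rule order_trans[rotated])
  have "Idl\<^bsub>R\<^esub> (set (take d xs)) \<subseteq> Idl\<^bsub>R\<^esub> (set xs)"
    by (rule genideal_minimal[OF genideal_ideal[OF xs]])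
       (rule order_trans[OF set_take_subset genideal_self[OF xs]])
  moreover have "Idl\<^bsub>R\<^esub> (set xs) \<subseteq> carrier R"
    by (rule additive_subgroup.a_subset[OF ideal.axioms(1)[OF genideal_ideal[OF xs]]])
  moreover have "Idl\<^bsub>R\<^esub> (set xs) \<noteq> carrier R" using assms(1) by (simp add: regular_sequence_def)
  ultimately have "Idl\<^bsub>R\<^esub> (set (take d xs)) \<noteq> carrier R" by blast
  then show ?thesis
    using assms(1) td unfolding regular_sequence_def by (simp add: min_def)
qed

text \<open>If all lengths were below \<open>d\<close>, the supremum would be at most d - 1, which
  is smaller because \<open>d > 0\<close>. A sequence that is too long is truncated.\<close>

lemma exists_regular_sequence:
  assumes "ring R" and d: "enat d \<le> ideal_depth R M" "d > 0"
  shows "\<exists>xs. regular_sequence R xs \<and> set xs \<subseteq> M \<and> length xs = d"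
proof -
  have "\<exists>xs. regular_sequence R xs \<and> set xs \<subseteq> M \<and> d \<le> length xs"
  proof (rule ccontr)
    assume *: "\<not> ?thesis"
    have "ideal_depth R M \<le> enat (d - 1)"
      unfolding ideal_depth_def
    proof (rule Sup_least)
      fix l assume "l \<in> {enat (length xs) | xs. regular_sequence R xs \<and> set xs \<subseteq> M}"
      then obtain xs where "l = enat (length xs)" "regular_sequence R xs" "set xs \<subseteq> M" by blast
      then show "l \<le> enat (d - 1)" using * by (auto simp: not_le)
    qed
    then have "enat d \<le> enat (d - 1)" using d(1) by (rule order_trans[rotated])
    then show False using d(2) by simp
  qed
  then obtain xs where "regular_sequence R xs" "set xs \<subseteq> M" "d \<le> length xs" by blast
  then show ?thesis
    using regular_sequence_take[OF _ assms(1), of xs d] set_take_subset[of d xs]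
    by (intro exI[of _ "take d xs"]) auto
qed

text \<open>At the irrelevant ideal the depth equals the height, which is at least
  \<open>card F\<close>. The sequence obtained may be inhomogeneous; what matters is that its
  representatives have no constant term.\<close>

lemma cohen_macaulay_regular_mod:
  assumes \<Delta>: "simplicial_complex n \<Delta>" and F: "F \<in> \<Delta>" and CM: "cohen_macaulay (k :: 'k::field itself) n \<Delta>"
  shows "\<exists>ys :: ((nat \<Rightarrow>\<^sub>0 nat) \<Rightarrow>\<^sub>0 'k) list. length ys = card F \<and> regular_mod (nonface_ideal n \<Delta>) ys \<and>
    (\<forall>y\<in>set ys. supported {1..n} y \<and> (\<exists>h. y = (\<Sum>j\<in>{1..n}. h j * var j)))"
proof (cases "card F = 0")
  case False
  let ?Q = "stanley_reisner_ring k n \<Delta>" and ?M = "irrelevant_ideal k n \<Delta>"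
  have nonvoid: "{} \<in> \<Delta>" using \<Delta> F unfolding simplicial_complex_def by blast
  have "enat (card F) \<le> prime_height ?Q ?M" by (rule card_face_le_height[OF \<Delta> nonvoid F])
  also have "\<dots> = ideal_depth ?Q ?M"
    using CM maximalideal_irrelevant[OF \<Delta> nonvoid] unfolding cohen_macaulay_def cohen_macaulay_ring_def by metis
  finally have "enat (card F) \<le> ideal_depth ?Q ?M" .
  then obtain xs where xs: "regular_sequence ?Q xs" "set xs \<subseteq> ?M" "length xs = card F"
    using exists_regular_sequence[of ?Q "card F" ?M] False cring_stanley_reisner_ring[of k n \<Delta>]
    by (auto simp: cring.axioms(1))
  have "\<forall>i<length xs. \<exists>y. y \<in> face_prime n {} \<and> xs ! i = stanley_reisner_ideal k n \<Delta> +>\<^bsub>polynomial_ring k n\<^esub> y"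
  proof (intro allI impI)
    fix i assume "i < length xs"
    then have "xs ! i \<in> ?M" using xs(2) nth_mem by blast
    then show "\<exists>y. y \<in> face_prime n {} \<and> xs ! i = stanley_reisner_ideal k n \<Delta> +>\<^bsub>polynomial_ring k n\<^esub> y"
      unfolding irrelevant_ideal_def by (elim imageE) metis
  qed
  then obtain y where y: "\<And>i. i < length xs \<Longrightarrow> y i \<in> face_prime n {}"
    "\<And>i. i < length xs \<Longrightarrow> xs ! i = stanley_reisner_ideal k n \<Delta> +>\<^bsub>polynomial_ring k n\<^esub> y i"
    by metis
  have supp: "supported {1..n} (y i)" if "i < length xs" for i
    using y(1)[OF that] by (simp add: face_prime_def)
  have "regular_mod (nonface_ideal n \<Delta>) (map y [0..<length xs])"
    by (rule regular_mod_lift[OF \<Delta> nonvoid xs(1) supp y(2)])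
  moreover have "\<forall>z\<in>set (map y [0..<length xs]). supported {1..n} z \<and> (\<exists>h. z = (\<Sum>j\<in>{1..n}. h j * var j))"
    using supp sum_var_of_face_prime[OF y(1)] by simp
  ultimately show ?thesis using xs(3) by (intro exI[of _ "map y [0..<length xs]"]) simp
qed (auto intro!: exI[of _ "[]"])

text \<open>A substitution fixing the x keeps the x-part of a monomial as a factor of its image, and
  that factor is supported on a nonface.\<close>

lemma substitution_stable_nonface_ideal:
  assumes \<Delta>: "simplicial_complex n \<Delta>"
  shows "substitution_stable {1..n} (nonface_ideal n \<Delta> :: ((nat \<Rightarrow>\<^sub>0 nat) \<Rightarrow>\<^sub>0 'k::field) set)"
  unfolding substitution_stable_def
proof (intro allI impI ballI)
  fix v :: "nat \<Rightarrow> ((nat \<Rightarrow>\<^sub>0 nat) \<Rightarrow>\<^sub>0 'k) poly" and p :: "(nat \<Rightarrow>\<^sub>0 nat) \<Rightarrow>\<^sub>0 'k" and l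
  assume v: "\<forall>i\<in>{1..n}. v i = [:var i:]" and p: "p \<in> nonface_ideal n \<Delta>"
  note J = ideal_nonface_ideal[OF \<Delta>, where 'k = 'k]
  have "coeff ([:Poly_Mapping.single 0 (Poly_Mapping.lookup p m):] * monomial_eval v m) l \<in> nonface_ideal n \<Delta>"
    if m: "m \<in> Poly_Mapping.keys p" for m
  proof -
    let ?b = "restrict_monomial {1..n} m" and ?d = "restrict_monomial (- {1..n}) m"
    have "monomial_eval v ?b = [:Poly_Mapping.single ?b 1:]"
    proof -
      have "supported {1..n} (Poly_Mapping.single ?b (1 :: 'k))"
        by (simp add: supported_def keys_restrict_monomial)
      from poly_eval_supported[OF this v] show ?thesis
        by (simp add: poly_eval.eval_single mult_single)
    qed
    then have "monomial_eval v m = [:Poly_Mapping.single ?b 1:] * monomial_eval v ?d"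
      using monomial_eval_add[of v ?b ?d] by (simp add: restrict_monomial_add)
    then have eq: "coeff ([:Poly_Mapping.single 0 (Poly_Mapping.lookup p m):] * monomial_eval v m) l =
      (Poly_Mapping.single 0 (Poly_Mapping.lookup p m) * coeff (monomial_eval v ?d) l) * Poly_Mapping.single ?b 1"
      by (simp add: ac_simps)
    have "Poly_Mapping.single ?b (1 :: 'k) \<in> nonface_ideal n \<Delta>"
      using p m by (simp add: nonface_ideal_def keys_restrict_monomial)
    then show ?thesis unfolding eq by (rule ideal_of_ring_mult[OF J])
  qed
  then have "(\<Sum>m\<in>Poly_Mapping.keys p. coeff ([:Poly_Mapping.single 0 (Poly_Mapping.lookup p m):] * monomial_eval v m) l)
      \<in> nonface_ideal n \<Delta>"
    by (intro ideal_of_ring_sum[OF J]) simp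
  then show "coeff (poly_eval.eval v p) l \<in> nonface_ideal n \<Delta>"
    by (simp only: poly_eval.eval_def coeff_sum)
qed

lemma bigraded_nonface_ideal: "bigraded n N (nonface_ideal n \<Delta>)"
  by (auto simp: bigraded_def nonface_ideal_def keys_part)

lemma generic_form_bidegree:
  assumes "n * (i + 2) \<le> N"
  shows "generic_form n i \<in> monomial_span (bidegree n N 1 1)"
  unfolding generic_form_def
proof (rule mpoly.subspace_sum[OF subspace_monomial_span])
  fix j assume j: "j \<in> {1..n}"
  let ?u = "n * (i + 1) + j"
  have u: "?u \<in> {n<..N}" using j assms by (auto simp: algebra_simps)
  have N: "n \<le> N" using assms by (simp add: algebra_simps)
  have sum: "(\<Sum>x\<in>A. Poly_Mapping.lookup (Poly_Mapping.single a (1 :: nat)) x) = (if a \<in> A then 1 else 0)"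
    if "finite A" for a and A :: "nat set"
    using that by (simp add: lookup_single when_def)
  have "Poly_Mapping.single ?u 1 + Poly_Mapping.single j 1 \<in> bidegree n N 1 1"
    unfolding bidegree_def mem_Collect_eq keys_add_nat lookup_add sum.distrib sum[OF finite_atLeastAtMost]
      sum[OF finite_greaterThanAtMost]
    using u j N by auto
  then show "var ?u * var j \<in> monomial_span (bidegree n N 1 1)"
    by (simp add: var_def mult_single monomial_span_def)
qed

section \<open>Nonnegativity of the h-vector\<close>

definition monomial_degree :: "(nat \<Rightarrow>\<^sub>0 nat) \<Rightarrow> nat" where
  "monomial_degree m = (\<Sum>j\<in>Poly_Mapping.keys m. Poly_Mapping.lookup m j)"

lemma monomial_degree_superset:
  assumes "finite A" "Poly_Mapping.keys m \<subseteq> A"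
  shows "monomial_degree m = (\<Sum>j\<in>A. Poly_Mapping.lookup m j)"
  unfolding monomial_degree_def
  by (rule sum.mono_neutral_left) (use assms in \<open>auto simp: in_keys_iff\<close>)

lemma monomial_degree_add: "monomial_degree (a + b) = monomial_degree a + monomial_degree b"
proof -
  let ?A = "Poly_Mapping.keys a \<union> Poly_Mapping.keys b"
  show ?thesis
    by (simp add: monomial_degree_superset[of ?A] keys_add_nat lookup_add sum.distrib)
qed

lemma monomial_degree_single [simp]: "monomial_degree (Poly_Mapping.single i e) = e"
  by (simp add: monomial_degree_def)

lemma monomial_degree_eq_0_iff: "monomial_degree m = 0 \<longleftrightarrow> m = 0"
proof
  assume "monomial_degree m = 0"
  then have "\<forall>j\<in>Poly_Mapping.keys m. Poly_Mapping.lookup m j = 0"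
    by (simp add: monomial_degree_def)
  then show "m = 0" by (intro poly_mapping_eqI) (auto simp: in_keys_iff)
qed (simp add: monomial_degree_def)

lemma monomial_diff_single:
  "x \<in> Poly_Mapping.keys m \<Longrightarrow> (m - Poly_Mapping.single x 1) + Poly_Mapping.single x (1 :: nat) = m"
  by (rule poly_mapping_eqI) (auto simp: lookup_add lookup_minus lookup_single when_def in_keys_iff)

definition monomials_of_degree :: "nat set \<Rightarrow> nat \<Rightarrow> (nat \<Rightarrow>\<^sub>0 nat) set" where
  "monomials_of_degree U b = {m. Poly_Mapping.keys m \<subseteq> U \<and> monomial_degree m = b}"

lemma finite_monomials_of_degree:
  assumes "U \<subseteq> {1..N}"
  shows "finite (monomials_of_degree U b)"
proof (rule finite_subset)
  show "finite (bidegree 0 N 0 b)" by (rule finite_bidegree)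
  show "monomials_of_degree U b \<subseteq> bidegree 0 N 0 b"
  proof
    fix m assume "m \<in> monomials_of_degree U b"
    then have m: "Poly_Mapping.keys m \<subseteq> {1..N}" "monomial_degree m = b"
      using assms by (auto simp: monomials_of_degree_def)
    moreover have "{0<..N} = {1..N}" by auto
    ultimately show "m \<in> bidegree 0 N 0 b"
      using monomial_degree_superset[OF _ m(1)] by (simp add: bidegree_def)
  qed
qed

text \<open>Pascal's rule: a monomial of degree b + 1 either avoids a chosen variable or is that
  variable times a monomial of degree b. Taking r + 1 variables avoids a subtraction in the binomial
  coefficient.\<close>

lemma card_monomials_of_degree:
  "\<lbrakk>U \<subseteq> {1..N}; card U = Suc r\<rbrakk> \<Longrightarrow> card (monomials_of_degree U b) = (b + r) choose r"
proof (induction r arbitrary: U b)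
  have step: "card (monomials_of_degree (insert x U) (Suc b)) =
      card (monomials_of_degree (insert x U) b) + card (monomials_of_degree U (Suc b))"
    if x: "x \<notin> U" and N: "insert x U \<subseteq> {1..N}" for x U b
  proof -
    let ?s = "\<lambda>m. m + Poly_Mapping.single x (1 :: nat)"
    have "monomials_of_degree (insert x U) (Suc b) =
        ?s ` monomials_of_degree (insert x U) b \<union> monomials_of_degree U (Suc b)"
    proof (intro equalityI subsetI)
      fix m assume m: "m \<in> monomials_of_degree (insert x U) (Suc b)"
      show "m \<in> ?s ` monomials_of_degree (insert x U) b \<union> monomials_of_degree U (Suc b)"
      proof (cases "x \<in> Poly_Mapping.keys m")
        case True
        let ?m = "m - Poly_Mapping.single x 1"
        have eq: "?m + Poly_Mapping.single x 1 = m" by (rule monomial_diff_single[OF True])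
        have "monomial_degree m = Suc (monomial_degree ?m)"
          using monomial_degree_add[of ?m "Poly_Mapping.single x 1"] eq by simp
        moreover have "Poly_Mapping.keys ?m \<subseteq> Poly_Mapping.keys m"
          using keys_add_nat[of ?m "Poly_Mapping.single x 1"] eq by auto
        ultimately have "?m \<in> monomials_of_degree (insert x U) b"
          using m by (auto simp: monomials_of_degree_def)
        then show ?thesis using eq by (metis UnI1 imageI)
      next
        case False
        then show ?thesis using m by (auto simp: monomials_of_degree_def)
      qed
    next
      fix m assume "m \<in> ?s ` monomials_of_degree (insert x U) b \<union> monomials_of_degree U (Suc b)"
      then show "m \<in> monomials_of_degree (insert x U) (Suc b)"
        by (auto simp: monomials_of_degree_def keys_add_nat monomial_degree_add)
    qed
    moreover have "?s ` monomials_of_degree (insert x U) b \<inter> monomials_of_degree U (Suc b) = {}"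
      using x by (auto simp: monomials_of_degree_def keys_add_nat)
    moreover have "finite (monomials_of_degree (insert x U) b)"
      by (rule finite_monomials_of_degree[OF N])
    moreover have "finite (monomials_of_degree U (Suc b))"
      using N by (intro finite_monomials_of_degree[of _ N]) blast
    moreover have "inj_on ?s (monomials_of_degree (insert x U) b)"
      by (rule inj_onI) simp
    ultimately show ?thesis by (simp add: card_Un_disjoint card_image)
  qed
  have deg0: "monomials_of_degree U 0 = {0}" for U
    by (auto simp: monomials_of_degree_def monomial_degree_eq_0_iff)
  {
    case 0
    then obtain x where U: "U = {x}" by (metis One_nat_def card_1_singletonE)
    have "monomials_of_degree {} (Suc b) = {}" for b
      by (auto simp: monomials_of_degree_def monomial_degree_def)
    then have "card (monomials_of_degree {x} b) = 1"
      by (induction b) (use 0 in \<open>simp_all add: deg0 step U\<close>)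
    then show ?case by (simp add: U)
  next
    case (Suc r)
    then obtain x V where V: "U = insert x V" "x \<notin> V" "card V = Suc r"
      by (metis card_Suc_eq)
    show ?case
    proof (induction b)
      case (Suc b)
      then show ?case
        using Suc.prems Suc.IH V Suc.IH step[OF V(2), of b] \<open>U \<subseteq> {1..N}\<close>
          \<open>\<And>U b. U \<subseteq> {1..N} \<Longrightarrow> card U = Suc r \<Longrightarrow> card (monomials_of_degree U b) = b + r choose r\<close>[of V "Suc b"]
        by simp
    qed (simp add: deg0)
  }
qed

text \<open>The quotient equals (b + 1)/(b + 1 + r).\<close>

lemma binomial_ratio_tendsto:
  "(\<lambda>b. real ((b + r) choose r) / real ((Suc b + r) choose r)) \<longlonglongrightarrow> 1"
proof -
  have "real ((b + r) choose r) / real ((Suc b + r) choose r) = 1 - real r * inverse (real (Suc (b + r)))" for b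
  proof -
    have "(Suc b + r - r) * ((Suc b + r) choose r) = (Suc b + r) * ((Suc b + r - 1) choose r)"
      by (rule binomial_absorb_comp)
    then have "real (Suc b) * real ((Suc b + r) choose r) = real (Suc b + r) * real ((b + r) choose r)"
      unfolding of_nat_mult[symmetric] by simp
    moreover have "real ((Suc b + r) choose r) > 0" by (simp add: zero_less_binomial_iff)
    ultimately show ?thesis by (simp add: field_simps)
  qed
  moreover have "(\<lambda>b. 1 - real r * inverse (real (Suc (b + r)))) \<longlonglongrightarrow> 1 - real r * 0"
    by (intro tendsto_intros LIMSEQ_ignore_initial_segment[OF LIMSEQ_inverse_real_of_nat, of r])
  ultimately show ?thesis by simp
qed

section \<open>The Hilbert series of a complex\<close>

definition face_monomials :: "nat set \<Rightarrow> nat \<Rightarrow> (nat \<Rightarrow>\<^sub>0 nat) set" where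
  "face_monomials F i = {m. Poly_Mapping.keys m = F \<and> monomial_degree m = i}"

lemma finite_face_monomials: "F \<subseteq> {1..N} \<Longrightarrow> finite (face_monomials F i)"
  by (rule finite_subset[OF _ finite_monomials_of_degree[of F N i]])
     (auto simp: face_monomials_def monomials_of_degree_def)

text \<open>The series is (t/(1 - t))^|F|, here with the denominator cleared. In the induction,
  dividing by the new variable either keeps the support or reduces it to \<open>F\<close>.\<close>

lemma fps_face_monomials:
  assumes "F \<subseteq> {1..N}"
  shows "(1 - fps_X) ^ card F * Abs_fps (\<lambda>i. real (card (face_monomials F i))) = fps_X ^ card F"
proof -
  have "finite F" using assms finite_subset by blast
  then show ?thesis using assms
  proof (induction F)
    case empty
    have "face_monomials {} i = (if i = 0 then {0} else {})" for i
      by (auto simp: face_monomials_def monomial_degree_def)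
    then show ?case by (intro fps_ext) simp
  next
    case (insert x F)
    let ?s = "\<lambda>m. m + Poly_Mapping.single x (1 :: nat)"
    let ?f = "Abs_fps (\<lambda>i. real (card (face_monomials F i)))"
    let ?g = "Abs_fps (\<lambda>i. real (card (face_monomials (insert x F) i)))"
    have 0: "face_monomials (insert x F) 0 = {}"
      by (auto simp: face_monomials_def monomial_degree_eq_0_iff)
    have Suc: "card (face_monomials (insert x F) (Suc i)) =
        card (face_monomials (insert x F) i) + card (face_monomials F i)" for i
    proof -
      have "face_monomials (insert x F) (Suc i) = ?s ` (face_monomials (insert x F) i \<union> face_monomials F i)"
      proof (intro equalityI subsetI)
        fix m assume m: "m \<in> face_monomials (insert x F) (Suc i)"
        have "x \<in> Poly_Mapping.keys m" using m by (simp add: face_monomials_def)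
        then have "m = (m - Poly_Mapping.single x 1) + Poly_Mapping.single x 1"
          by (rule monomial_diff_single[symmetric])
        then obtain c where c: "m = c + Poly_Mapping.single x 1" by (rule that)
        have "monomial_degree c = i"
          using m by (simp add: c monomial_degree_add face_monomials_def)
        moreover have "insert x (Poly_Mapping.keys c) = insert x F"
          using m by (simp add: c keys_add_nat face_monomials_def)
        then have "Poly_Mapping.keys c = insert x F \<or> Poly_Mapping.keys c = F"
          using insert.hyps(2) by (cases "x \<in> Poly_Mapping.keys c") (simp_all add: insert_absorb insert_ident)
        ultimately have "c \<in> face_monomials (insert x F) i \<union> face_monomials F i"
          by (simp add: face_monomials_def)
        then show "m \<in> ?s ` (face_monomials (insert x F) i \<union> face_monomials F i)"
          unfolding c by (rule imageI)
      next
        fix m assume "m \<in> ?s ` (face_monomials (insert x F) i \<union> face_monomials F i)"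
        then obtain c where c: "m = ?s c" "c \<in> face_monomials (insert x F) i \<union> face_monomials F i"
          by (rule imageE)
        then have "insert x (Poly_Mapping.keys c) = insert x F" "monomial_degree c = i"
          by (auto simp: face_monomials_def)
        then show "m \<in> face_monomials (insert x F) (Suc i)"
          by (simp add: c(1) face_monomials_def keys_add_nat monomial_degree_add)
      qed
      moreover have "inj_on ?s (face_monomials (insert x F) i \<union> face_monomials F i)"
        by (rule inj_onI) simp
      moreover have "face_monomials (insert x F) i \<inter> face_monomials F i = {}"
        using insert.hyps(2) by (auto simp: face_monomials_def)
      moreover have "finite (face_monomials (insert x F) i)" "finite (face_monomials F i)"
        using insert.prems finite_face_monomials[of "insert x F" N] finite_face_monomials[of F N] by simp_all
      ultimately show ?thesis by (simp add: card_image card_Un_disjoint)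
    qed
    have "(1 - fps_X) * ?g = fps_X * ?f"
    proof (rule fps_ext)
      fix i show "fps_nth ((1 - fps_X) * ?g) i = fps_nth (fps_X * ?f) i"
        by (cases i) (simp_all add: left_diff_distrib 0 Suc)
    qed
    then have "(1 - fps_X) ^ card F * ((1 - fps_X) * ?g) = fps_X * ((1 - fps_X) ^ card F * ?f)"
      by (simp only: mult.left_commute)
    moreover have "(1 - fps_X) ^ card F * ?f = fps_X ^ card F" using insert by simp
    moreover have "card (insert x F) = Suc (card F)" using insert.hyps by simp
    ultimately show ?case by (simp only: power_Suc mult.assoc mult.left_commute)
  qed
qed

lemma fps_backward_difference:
  "Abs_fps ((backward_difference ^^ d) H) = (1 - fps_X) ^ d * Abs_fps H"
proof (induction d arbitrary: H)
  case (Suc d)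
  have "Abs_fps (backward_difference H) = (1 - fps_X) * Abs_fps H"
  proof (rule fps_ext)
    fix i show "fps_nth (Abs_fps (backward_difference H)) i = fps_nth ((1 - fps_X) * Abs_fps H) i"
      by (cases i) (simp_all add: left_diff_distrib backward_difference_def)
  qed
  then show ?case
    using Suc[of "backward_difference H"] by (simp add: funpow_swap1 ac_simps)
qed simp

definition h_polynomial :: "nat set set \<Rightarrow> nat \<Rightarrow> real poly" where
  "h_polynomial \<Delta> d = (\<Sum>F\<in>\<Delta>. Polynomial.monom 1 (card F) * [:1, -1:] ^ (d - card F))"

text \<open>The monomials supported on faces form a basis of the Stanley-Reisner ring, so this is
  its Hilbert function.\<close>

definition hilbert_function :: "nat set set \<Rightarrow> nat \<Rightarrow> real" where
  "hilbert_function \<Delta> i = real (card {m. Poly_Mapping.keys m \<in> \<Delta> \<and> monomial_degree m = i})"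

lemma finite_simplicial_complex: "simplicial_complex n \<Delta> \<Longrightarrow> finite \<Delta>"
  unfolding simplicial_complex_def by (meson finite_Pow_iff finite_atLeastAtMost finite_subset)

text \<open>Grouping the monomials by support writes the Hilbert series as the sum of (t/(1 -
  t))^|F| over the faces; the factor (1 - t)^d clears all denominators.\<close>

lemma fps_hilbert_function:
  assumes \<Delta>: "simplicial_complex n \<Delta>" and d: "\<forall>F\<in>\<Delta>. card F \<le> d"
  shows "Abs_fps ((backward_difference ^^ d) (hilbert_function \<Delta>)) = fps_of_poly (h_polynomial \<Delta> d)"
proof -
  have fin: "finite \<Delta>" by (rule finite_simplicial_complex[OF \<Delta>])
  have sub: "F \<subseteq> {1..n}" if "F \<in> \<Delta>" for F using \<Delta> that unfolding simplicial_complex_def by blast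
  have "hilbert_function \<Delta> i = (\<Sum>F\<in>\<Delta>. real (card (face_monomials F i)))" for i
  proof -
    have "{m. Poly_Mapping.keys m \<in> \<Delta> \<and> monomial_degree m = i} = (\<Union>F\<in>\<Delta>. face_monomials F i)"
      by (auto simp: face_monomials_def)
    moreover have "card (\<Union>F\<in>\<Delta>. face_monomials F i) = (\<Sum>F\<in>\<Delta>. card (face_monomials F i))"
    proof (rule card_UN_disjoint[OF fin])
      show "\<forall>F\<in>\<Delta>. finite (face_monomials F i)" using sub finite_face_monomials by blast
    qed (auto simp: face_monomials_def)
    ultimately show ?thesis by (simp add: hilbert_function_def)
  qed
  then have H: "Abs_fps (hilbert_function \<Delta>) = (\<Sum>F\<in>\<Delta>. Abs_fps (\<lambda>i. real (card (face_monomials F i))))"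
    by (intro fps_ext) (simp add: fps_sum_nth)
  have "(1 - fps_X) ^ d * Abs_fps (\<lambda>i. real (card (face_monomials F i))) =
      fps_of_poly (Polynomial.monom 1 (card F) * [:1, -1:] ^ (d - card F))" if F: "F \<in> \<Delta>" for F
  proof -
    have X: "fps_of_poly [:1, -1 :: real:] = 1 - fps_X" by (simp add: fps_of_poly_pCons)
    have "(1 - fps_X) ^ d * Abs_fps (\<lambda>i. real (card (face_monomials F i))) =
      (1 - fps_X) ^ (d - card F) * ((1 - fps_X) ^ card F * Abs_fps (\<lambda>i. real (card (face_monomials F i))))"
      using d F by (simp add: power_add[symmetric] mult.assoc[symmetric])
    also have "\<dots> = (1 - fps_X) ^ (d - card F) * fps_X ^ card F"
      by (simp only: fps_face_monomials[OF sub[OF F]])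
    finally show ?thesis
      by (simp add: fps_of_poly_mult fps_of_poly_power fps_of_poly_monom X mult.commute)
  qed
  then show ?thesis
    unfolding fps_backward_difference H h_polynomial_def sum_distrib_left fps_of_poly_sum
    by (intro sum.cong) simp_all
qed

text \<open>A basis of the component consists of the monomials whose x-part is supported on a face,
  and each factors uniquely into its x-part and a monomial in the coefficient variables.\<close>

lemma quotient_dim_nonface_ideal:
  assumes \<Delta>: "simplicial_complex n \<Delta>" and N: "n \<le> N"
  shows "quotient_dim n N (nonface_ideal n \<Delta> :: ((nat \<Rightarrow>\<^sub>0 nat) \<Rightarrow>\<^sub>0 'k::field) set) i b =
    hilbert_function \<Delta> i * real (card (monomials_of_degree {n<..N} b))"
proof -
  let ?B = "bidegree n N i b"
  let ?A = "{m. Poly_Mapping.keys m \<in> \<Delta> \<and> monomial_degree m = i}"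
  let ?U = "monomials_of_degree {n<..N} b"
  let ?face = "\<lambda>m. Poly_Mapping.keys m \<inter> {1..n} \<in> \<Delta>"
  have sub: "F \<subseteq> {1..n}" if "F \<in> \<Delta>" for F using \<Delta> that unfolding simplicial_complex_def by blast
  have "nonface_ideal n \<Delta> \<inter> monomial_span ?B = (monomial_span {m \<in> ?B. \<not> ?face m} :: ((nat \<Rightarrow>\<^sub>0 nat) \<Rightarrow>\<^sub>0 'k) set)"
    by (auto simp: nonface_ideal_def monomial_span_def)
  then have "mpoly.dim (nonface_ideal n \<Delta> \<inter> monomial_span ?B :: ((nat \<Rightarrow>\<^sub>0 nat) \<Rightarrow>\<^sub>0 'k) set) = card {m \<in> ?B. \<not> ?face m}"
    by (simp add: dim_monomial_span finite_bidegree)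
  moreover have "card ?B = card {m \<in> ?B. \<not> ?face m} + card {m \<in> ?B. ?face m}"
    by (subst card_Un_disjoint[symmetric]) (auto simp: finite_bidegree intro!: arg_cong[of _ _ card])
  ultimately have "quotient_dim n N (nonface_ideal n \<Delta> :: ((nat \<Rightarrow>\<^sub>0 nat) \<Rightarrow>\<^sub>0 'k) set) i b = real (card {m \<in> ?B. ?face m})"
    by (simp add: quotient_dim_def)
  also have "{m \<in> ?B. ?face m} = (\<lambda>(a, c). a + c) ` (?A \<times> ?U)"
  proof (intro equalityI subsetI)
    fix m assume m: "m \<in> {m \<in> ?B. ?face m}"
    let ?a = "restrict_monomial {1..n} m" and ?c = "restrict_monomial (- {1..n}) m"
    have "monomial_degree ?a = i"
      using m by (subst monomial_degree_superset[of "{1..n}"])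
        (auto simp: keys_restrict_monomial lookup_restrict_monomial bidegree_def)
    then have "?a \<in> ?A" using m by (simp add: keys_restrict_monomial)
    moreover have kc: "Poly_Mapping.keys ?c \<subseteq> {n<..N}"
    proof
      fix x assume "x \<in> Poly_Mapping.keys ?c"
      then have "x \<in> Poly_Mapping.keys m" "x \<notin> {1..n}" by (auto simp: keys_restrict_monomial)
      moreover from this have "x \<in> {1..N}" using m by (auto simp: bidegree_def)
      ultimately show "x \<in> {n<..N}" by simp
    qed
    have "monomial_degree ?c = b"
      using m by (subst monomial_degree_superset[OF _ kc])
        (auto simp: lookup_restrict_monomial bidegree_def)
    then have "?c \<in> ?U" using kc by (simp add: monomials_of_degree_def)
    ultimately have "(?a, ?c) \<in> ?A \<times> ?U" by blast
    moreover have "m = (\<lambda>(a, c). a + c) (?a, ?c)" by (simp add: restrict_monomial_add)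
    ultimately show "m \<in> (\<lambda>(a, c). a + c) ` (?A \<times> ?U)" by (rule rev_image_eqI)
  next
    fix m assume "m \<in> (\<lambda>(a, c). a + c) ` (?A \<times> ?U)"
    then obtain a c where ac: "Poly_Mapping.keys a \<in> \<Delta>" "monomial_degree a = i"
      "Poly_Mapping.keys c \<subseteq> {n<..N}" "monomial_degree c = b" "m = a + c"
      by (auto simp: monomials_of_degree_def)
    have a: "Poly_Mapping.keys a \<subseteq> {1..n}" using sub ac(1) by blast
    have "(\<Sum>j\<in>{1..n}. Poly_Mapping.lookup c j) = 0"
      using ac(3) by (intro sum.neutral) (auto simp: not_in_keys_iff_lookup_eq_zero[symmetric])
    moreover have "(\<Sum>j\<in>{n<..N}. Poly_Mapping.lookup a j) = 0"
      using a by (intro sum.neutral) (auto simp: not_in_keys_iff_lookup_eq_zero[symmetric])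
    moreover have "Poly_Mapping.keys m \<subseteq> {1..N}" "Poly_Mapping.keys m \<inter> {1..n} = Poly_Mapping.keys a"
      using a ac(3) N by (auto simp: ac(5) keys_add_nat)
    ultimately show "m \<in> {m \<in> ?B. ?face m}"
      using ac monomial_degree_superset[OF _ a] monomial_degree_superset[OF _ ac(3)]
      by (simp add: bidegree_def lookup_add sum.distrib)
  qed
  also have "card \<dots> = card (?A \<times> ?U)"
  proof (rule card_image, rule inj_onI, clarify)
    fix a c a' c'
    assume *: "a + c = a' + c'" "Poly_Mapping.keys a \<in> \<Delta>" "Poly_Mapping.keys a' \<in> \<Delta>" "c \<in> ?U" "c' \<in> ?U"
    have "c = c'"
      by (rule monomial_decomposition_unique[OF *(1), of "{1..n}"])
         (use * sub in \<open>auto simp: monomials_of_degree_def\<close>)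
    then show "a = a' \<and> c = c'" using *(1) by simp
  qed
  finally show ?thesis by (simp add: card_cartesian_product hilbert_function_def)
qed

lemma h_polynomial_nonneg:
  assumes \<Delta>: "simplicial_complex n \<Delta>" and CM: "cohen_macaulay (k :: 'k::field itself) n \<Delta>"
    and F: "F \<in> \<Delta>" "\<forall>G\<in>\<Delta>. card G \<le> card F"
  shows "coeff (h_polynomial \<Delta> (card F)) i \<ge> 0"
proof -
  let ?J = "nonface_ideal n \<Delta> :: ((nat \<Rightarrow>\<^sub>0 nat) \<Rightarrow>\<^sub>0 'k) set"
  let ?d = "card F"
  \<comment> \<open>There are n variables x, n d coefficients of the d forms and one spare variable;
    with it, the range \<open>{n<..N}\<close> has n d + 1 elements, the shape required by the
    monomial count.\<close>
  define N where "N = n * (?d + 1) + 1"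
  define P where "P b = real (card (monomials_of_degree {n<..N} b))" for b
  obtain ys :: "((nat \<Rightarrow>\<^sub>0 nat) \<Rightarrow>\<^sub>0 'k) list" where ys: "length ys = ?d" "regular_mod ?J ys"
    "\<forall>y\<in>set ys. supported {1..n} y \<and> (\<exists>h. y = (\<Sum>j\<in>{1..n}. h j * var j))"
    using cohen_macaulay_regular_mod[OF \<Delta> F(1) CM] by blast
  have J: "ideal_of_ring ?J" by (rule ideal_nonface_ideal[OF \<Delta>])
  have "regular_mod ?J (map (generic_form n) [0..<0 + length ys])"
    using substitution_stable_nonface_ideal[OF \<Delta>] ys by (intro regular_mod_generic_forms J) simp_all
  then have reg: "regular_mod ?J (map (generic_form n) [0..<?d])" using ys(1) by simp
  have gen: "\<forall>g\<in>set (map (generic_form n) [0..<?d]). (g :: (nat \<Rightarrow>\<^sub>0 nat) \<Rightarrow>\<^sub>0 'k) \<in> monomial_span (bidegree n N 1 1)"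
  proof
    fix g :: "(nat \<Rightarrow>\<^sub>0 nat) \<Rightarrow>\<^sub>0 'k" assume "g \<in> set (map (generic_form n) [0..<?d])"
    then obtain j where j: "j < ?d" "g = generic_form n j" by auto
    have "n * (j + 2) \<le> n * (?d + 1)" using j(1) by (intro mult_le_mono2) simp
    then show "g \<in> monomial_span (bidegree n N 1 1)"
      unfolding j(2) by (intro generic_form_bidegree) (simp add: N_def)
  qed
  have P: "P b = real ((b + n * ?d) choose (n * ?d))" for b
    unfolding P_def by (subst card_monomials_of_degree[of _ N "n * ?d"]) (auto simp: N_def algebra_simps)
  have Ppos: "P b > 0" for b unfolding P by (simp add: zero_less_binomial_iff)
  have Plim: "(\<lambda>b. P b / P (Suc b)) \<longlonglongrightarrow> 1"
    unfolding P by (rule binomial_ratio_tendsto)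
  have "(\<lambda>b. quotient_dim n N ?J i b / P b) \<longlonglongrightarrow> hilbert_function \<Delta> i" for i
  proof -
    \<comment> \<open>For the nonface ideal itself the normalised dimensions do not depend on
      b.\<close>
    have "quotient_dim n N ?J i b / P b = hilbert_function \<Delta> i" for b
      using Ppos[of b] by (simp add: quotient_dim_nonface_ideal[OF \<Delta>] N_def P_def algebra_simps)
    then show ?thesis by simp
  qed
  from backward_difference_nonneg[OF J bigraded_nonface_ideal reg gen Ppos Plim this]
  have "(backward_difference ^^ ?d) (hilbert_function \<Delta>) i \<ge> 0" by simp
  also have "(backward_difference ^^ ?d) (hilbert_function \<Delta>) i = coeff (h_polynomial \<Delta> ?d) i"
    using arg_cong[OF fps_hilbert_function[OF \<Delta> F(2)], of "\<lambda>f. fps_nth f i"] by simp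
  finally show ?thesis .
qed

section \<open>Alexander duality of h-polynomials\<close>

abbreviation one_minus_X :: "real poly" where "one_minus_X \<equiv> [:1, -1:]"

lemma X_plus_one_minus_X: "[:0, 1:] + one_minus_X = 1"
  by (simp add: one_pCons)

lemma bezout_solution_unique:
  fixes h g h' q' :: "real poly"
  assumes eq: "one_minus_X ^ e * h + Polynomial.monom 1 (Suc c) * pcompose g one_minus_X = 1"
    and eq': "one_minus_X ^ e * h' + Polynomial.monom 1 (Suc c) * q' = 1"
    and deg: "degree h' \<le> c" "degree q' < e"
    and h: "\<And>i. coeff h i \<ge> 0" and g: "coeff g e \<ge> 0"
  shows "h = h'"
proof -
  let ?X = "[:0, 1:] :: real poly"
  have X: "Polynomial.monom (1 :: real) k = ?X ^ k" for k by (simp add: monom_altdef)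
  have diff: "one_minus_X ^ e * (h - h') = Polynomial.monom 1 (Suc c) * (q' - pcompose g one_minus_X)"
    using eq eq' by (simp add: algebra_simps)
  \<comment> \<open>The second identity expresses that (1 - t)^e and t^(c + 1) are coprime;
    multiplying the difference by this 1 shows that t^(c + 1) divides it.\<close>
  have "h - h' = (h - h') * (one_minus_X ^ e * h' + Polynomial.monom 1 (Suc c) * q')"
    by (simp only: eq' mult_1_right)
  also have "\<dots> = one_minus_X ^ e * (h - h') * h' + Polynomial.monom 1 (Suc c) * ((h - h') * q')"
    by (simp only: distrib_left ac_simps)
  also have "\<dots> = Polynomial.monom 1 (Suc c) * ((q' - pcompose g one_minus_X) * h' + (h - h') * q')"
    by (simp only: diff distrib_left mult.assoc)
  finally obtain r where r: "h - h' = Polynomial.monom 1 (Suc c) * r" by (rule that)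
  have "Polynomial.monom 1 (Suc c) * (one_minus_X ^ e * r) =
      Polynomial.monom 1 (Suc c) * (q' - pcompose g one_minus_X)"
    using diff unfolding r by (simp add: ac_simps)
  then have "one_minus_X ^ e * r = q' - pcompose g one_minus_X"
    by (simp only: mult_cancel_left monom_eq_0_iff) simp
  \<comment> \<open>Replacing t by 1 - t is an involution and now isolates \<open>g\<close>.\<close>
  then have "pcompose g one_minus_X = q' - one_minus_X ^ e * r" by simp
  then have "pcompose (pcompose g one_minus_X) one_minus_X =
      pcompose q' one_minus_X - pcompose (one_minus_X ^ e * r) one_minus_X"
    by (simp add: pcompose_diff)
  moreover have w: "pcompose one_minus_X one_minus_X = ?X" by (simp add: pcompose_pCons)
  moreover have "pcompose (one_minus_X ^ e) one_minus_X = ?X ^ e" for e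
    by (induction e) (simp_all only: power_0 power_Suc pcompose_1 pcompose_mult w)
  ultimately have g_eq: "g = pcompose q' one_minus_X - Polynomial.monom 1 e * pcompose r one_minus_X"
    by (simp only: pcompose_assoc[symmetric] pcompose_mult X pcompose_idR)
  have "degree (pcompose q' one_minus_X) < e"
    using deg(2) degree_pcompose_le[of q' one_minus_X] by simp
  \<comment> \<open>The first term has degree below e; in the second, the coefficient of t^e is the
    constant term of r(1 - t), which is r(1).\<close>
  then have "coeff g e = - poly r 1"
    unfolding g_eq by (simp add: coeff_monom_mult coeff_eq_0)
  then have r1: "poly r 1 \<le> 0" using g by simp
  \<comment> \<open>Above degree c the coefficients of \<open>h'\<close> vanish, so those of
    \<open>r\<close> are coefficients of \<open>h\<close>.\<close>
  have r_nonneg: "coeff r i \<ge> 0" for i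
  proof -
    have "coeff (h - h') (i + Suc c) = coeff r i" unfolding r by (simp add: coeff_monom_mult)
    moreover have "coeff h' (i + Suc c) = 0" using deg(1) by (intro coeff_eq_0) simp
    ultimately show ?thesis using h[of "i + Suc c"] by simp
  qed
  have sum: "poly r 1 = (\<Sum>i\<le>degree r. coeff r i)" by (simp add: poly_altdef)
  moreover have "(\<Sum>i\<le>degree r. coeff r i) \<ge> 0" by (intro sum_nonneg r_nonneg)
  ultimately have "(\<Sum>i\<le>degree r. coeff r i) = 0" using r1 by linarith
  then have "\<forall>i\<in>{..degree r}. coeff r i = 0"
    using r_nonneg by (subst (asm) sum_nonneg_eq_0_iff) auto
  then have "lead_coeff r = 0" by simp
  then show ?thesis using r by simp
qed

lemma one_minus_X_power_mult_h_polynomial: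
  assumes "\<forall>F\<in>\<Delta>. card F \<le> d" "d \<le> n"
  shows "one_minus_X ^ (n - d) * h_polynomial \<Delta> d =
    (\<Sum>F\<in>\<Delta>. Polynomial.monom 1 (card F) * one_minus_X ^ (n - card F))"
  unfolding h_polynomial_def sum_distrib_left
proof (rule sum.cong)
  fix F assume "F \<in> \<Delta>"
  then have "n - card F = (n - d) + (d - card F)" using assms by auto
  then show "one_minus_X ^ (n - d) * (Polynomial.monom 1 (card F) * one_minus_X ^ (d - card F)) =
      Polynomial.monom 1 (card F) * one_minus_X ^ (n - card F)"
    by (simp only: power_add mult.left_commute)
qed simp

lemma simplicial_complex_alexander_dual:
  "simplicial_complex n \<Delta> \<Longrightarrow> simplicial_complex n (alexander_dual n \<Delta>)"
  unfolding simplicial_complex_def alexander_dual_def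
proof (intro conjI ballI allI impI CollectI; elim conjE CollectE)
  fix F G assume \<Delta>: "\<forall>F\<in>\<Delta>. \<forall>G\<subseteq>F. G \<in> \<Delta>" and F: "{1..n} - F \<notin> \<Delta>" "G \<subseteq> F" "F \<subseteq> {1..n}"
  show "G \<subseteq> {1..n}" using F by blast
  have "{1..n} - F \<subseteq> {1..n} - G" using F by blast
  then show "{1..n} - G \<notin> \<Delta>" using \<Delta> F by blast
qed blast

text \<open>This expands a product of n factors t + (1 - t) over the subsets of {1..n}.\<close>

lemma sum_Pow_monomials:
  "(\<Sum>F\<in>Pow {1..n}. Polynomial.monom 1 (card F) * one_minus_X ^ (n - card F)) = 1"
proof -
  have "(\<Sum>F\<in>Pow {1..n}. Polynomial.monom 1 (card F) * one_minus_X ^ (n - card F)) =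
      (\<Sum>F\<in>Pow {1..n}. (\<Prod>x\<in>F. [:0, 1:]) * (\<Prod>x\<in>{1..n} - F. one_minus_X))"
    by (rule sum.cong) (auto simp: monom_altdef card_Diff_subset finite_subset)
  also have "\<dots> = (\<Prod>x\<in>{1..n}. [:0, 1:] + one_minus_X)"
    by (rule prod_add[symmetric]) simp
  also have "\<dots> = 1" by (simp only: X_plus_one_minus_X power_one prod.neutral_const)
  finally show ?thesis .
qed

text \<open>The sum in \<open>sum_Pow_monomials\<close> is split into faces and nonfaces. The
  nonfaces are the complements of the dual faces, and complementation exchanges t with 1 - t; the
  bounds on face sizes allow the powers (1 - t)^(n - d) and t^(c + 1) to be factored out.\<close>

lemma h_polynomial_alexander_dual:
  assumes \<Delta>: "simplicial_complex n \<Delta>" and d: "\<forall>F\<in>\<Delta>. card F \<le> d" "d \<le> n"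
    and d': "\<forall>F\<in>alexander_dual n \<Delta>. card F + Suc c \<le> n"
    and cn: "c < n"
  shows "one_minus_X ^ (n - d) * h_polynomial \<Delta> d +
    Polynomial.monom 1 (Suc c) * pcompose (h_polynomial (alexander_dual n \<Delta>) (n - Suc c)) one_minus_X = 1"
proof -
  let ?D = "alexander_dual n \<Delta>"
  let ?m = "\<lambda>F. Polynomial.monom 1 (card F) * one_minus_X ^ (n - card F)"
  have fin: "finite \<Delta>" by (rule finite_simplicial_complex[OF \<Delta>])
  have sub: "\<Delta> \<subseteq> Pow {1..n}" using \<Delta> by (simp add: simplicial_complex_def)
  have w: "pcompose one_minus_X one_minus_X = [:0, 1:]" by (simp add: pcompose_pCons)
  have wp: "pcompose (one_minus_X ^ j) one_minus_X = Polynomial.monom 1 j" for j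
    unfolding monom_altdef
    by (induction j) (simp_all only: power_0 power_Suc pcompose_1 pcompose_mult w smult_1_left)
  have Xp: "pcompose (Polynomial.monom 1 j) one_minus_X = one_minus_X ^ j" for j
  proof -
    have "pcompose ([:0, 1:] ^ j) one_minus_X = one_minus_X ^ j"
      by (induction j) (simp_all add: pcompose_1 pcompose_mult pcompose_pCons)
    then show ?thesis by (simp add: monom_altdef)
  qed
  have "Polynomial.monom 1 (Suc c) * pcompose (h_polynomial ?D (n - Suc c)) one_minus_X =
      (\<Sum>G\<in>?D. Polynomial.monom 1 (n - card G) * one_minus_X ^ card G)"
    unfolding h_polynomial_def pcompose_sum sum_distrib_left
  proof (rule sum.cong)
    fix G assume "G \<in> ?D"
    then have eq: "Suc c + (n - Suc c - card G) = n - card G" using d' by auto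
    have mono: "Polynomial.monom (1 :: real) (Suc c) * Polynomial.monom 1 (n - Suc c - card G) = Polynomial.monom 1 (n - card G)"
      unfolding mult_monom eq by simp
    show "Polynomial.monom 1 (Suc c) * pcompose (Polynomial.monom 1 (card G) * one_minus_X ^ (n - Suc c - card G)) one_minus_X =
        Polynomial.monom 1 (n - card G) * one_minus_X ^ card G"
      by (simp only: pcompose_mult Xp wp mono[symmetric] ac_simps)
  qed simp
  also have "\<dots> = (\<Sum>F\<in>Pow {1..n} - \<Delta>. ?m F)"
  proof (rule sum.reindex_bij_witness[of _ "\<lambda>F. {1..n} - F" "\<lambda>F. {1..n} - F"])
    fix G assume G: "G \<in> ?D"
    then have Gn: "G \<subseteq> {1..n}" by (simp add: alexander_dual_def)
    then have "card G \<le> n" using card_mono[OF finite_atLeastAtMost Gn] by simp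
    then show "?m ({1..n} - G) = Polynomial.monom 1 (n - card G) * one_minus_X ^ card G"
      using Gn by (simp add: card_Diff_subset finite_subset)
  qed (auto simp: alexander_dual_def double_diff)
  finally have dual: "Polynomial.monom 1 (Suc c) * pcompose (h_polynomial ?D (n - Suc c)) one_minus_X =
      (\<Sum>F\<in>Pow {1..n} - \<Delta>. ?m F)" .
  have "(\<Sum>F\<in>Pow {1..n} - \<Delta>. ?m F) + (\<Sum>F\<in>\<Delta>. ?m F) = (\<Sum>F\<in>Pow {1..n}. ?m F)"
    by (rule sum.subset_diff[OF sub, symmetric]) simp
  then show ?thesis
    unfolding dual one_minus_X_power_mult_h_polynomial[OF d] sum_Pow_monomials by (simp add: add.commute)
qed

section \<open>The f-polynomial\<close>

text \<open>The binomial expansion of (t + (1 - t))^s is cut after j = c. For s = e + c, the earlier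
  terms are divisible by (1 - t)^e and the later ones by t^(c + 1), with cofactors of degree at most
  c and e - 1.\<close>

lemma skeleton_bezout:
  fixes e c :: nat
  assumes e: "e > 0"
  defines "s \<equiv> e + c"
  obtains h' q' :: "real poly"
  where "one_minus_X ^ e * h' + Polynomial.monom 1 (Suc c) * q' = 1" "degree h' \<le> c" "degree q' < e"
    "one_minus_X ^ e * h' = (\<Sum>j\<le>c. of_nat (s choose j) * Polynomial.monom 1 j * one_minus_X ^ (s - j))"
proof -
  let ?t = "\<lambda>j. of_nat (s choose j) * Polynomial.monom 1 j * one_minus_X ^ (s - j) :: real poly"
  define h' :: "real poly" where
    "h' = (\<Sum>j\<le>c. of_nat (s choose j) * Polynomial.monom 1 j * one_minus_X ^ (c - j))"
  define q' :: "real poly" where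
    "q' = (\<Sum>j\<in>{c<..s}. of_nat (s choose j) * Polynomial.monom 1 (j - Suc c) * one_minus_X ^ (s - j))"
  have deg_w: "degree (one_minus_X ^ k) = k" for k by (simp add: degree_power_eq)
  have deg: "degree (of_nat a * Polynomial.monom 1 i * one_minus_X ^ k) \<le> i + k" for a i k
  proof -
    have "degree (of_nat a * Polynomial.monom 1 i * one_minus_X ^ k) \<le> degree (of_nat a * Polynomial.monom (1::real) i) + degree (one_minus_X ^ k)"
      by (rule degree_mult_le)
    also have "degree (of_nat a * Polynomial.monom (1::real) i) \<le> i"
      using degree_mult_le[of "of_nat a" "Polynomial.monom (1::real) i"] by (simp add: degree_monom_eq)
    finally show ?thesis using deg_w by simp
  qed
  have 1: "one_minus_X ^ e * h' = (\<Sum>j\<le>c. ?t j)"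
    unfolding h'_def sum_distrib_left
  proof (rule sum.cong)
    fix j assume "j \<in> {..c}"
    then have "s - j = e + (c - j)" by (simp add: s_def)
    then show "one_minus_X ^ e * (of_nat (s choose j) * Polynomial.monom 1 j * one_minus_X ^ (c - j)) = ?t j"
      by (simp only: power_add ac_simps)
  qed simp
  have 2: "Polynomial.monom 1 (Suc c) * q' = (\<Sum>j\<in>{c<..s}. ?t j)"
    unfolding q'_def sum_distrib_left
  proof (rule sum.cong)
    fix j assume "j \<in> {c<..s}"
    then have "Polynomial.monom 1 j = Polynomial.monom (1::real) (Suc c) * Polynomial.monom 1 (j - Suc c)"
      by (simp add: mult_monom)
    then show "Polynomial.monom 1 (Suc c) * (of_nat (s choose j) * Polynomial.monom 1 (j - Suc c) * one_minus_X ^ (s - j)) = ?t j"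
      by (simp only: ac_simps)
  qed simp
  have split: "{..c} \<union> {c<..s} = {..s}" by (auto simp: s_def)
  have "(\<Sum>j\<le>c. ?t j) + (\<Sum>j\<in>{c<..s}. ?t j) = (\<Sum>j\<in>{..c} \<union> {c<..s}. ?t j)"
    by (rule sum.union_disjoint[symmetric]) auto
  also have "\<dots> = (\<Sum>j\<le>s. ?t j)" by (simp only: split)
  also have "\<dots> = ([:0, 1:] + one_minus_X) ^ s"
    unfolding binomial_ring by (simp add: monom_altdef)
  also have "\<dots> = 1" by (simp only: X_plus_one_minus_X power_one prod.neutral_const)
  finally have "one_minus_X ^ e * h' + Polynomial.monom 1 (Suc c) * q' = 1" unfolding 1 2 .
  moreover have "degree h' \<le> c"
    unfolding h'_def
  proof (rule degree_sum_le)
    fix j assume "j \<in> {..c}"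
    then show "degree (of_nat (s choose j) * Polynomial.monom (1 :: real) j * one_minus_X ^ (c - j)) \<le> c"
      using deg[of "s choose j" j "c - j"] by simp
  qed simp
  moreover have "degree q' < e"
  proof -
    have "degree q' \<le> e - 1"
      unfolding q'_def
    proof (rule degree_sum_le)
      fix j assume "j \<in> {c<..s}"
      then have "j - Suc c + (s - j) = e - 1" by (auto simp: s_def)
      then show "degree (of_nat (s choose j) * Polynomial.monom 1 (j - Suc c) * one_minus_X ^ (s - j)) \<le> e - 1"
        using deg[of "s choose j" "j - Suc c" "s - j"] by simp
    qed simp
    then show ?thesis using e by simp
  qed
  ultimately show thesis using 1 by (rule that)
qed

lemma poly_f_polynomial:
  assumes \<Delta>: "simplicial_complex n \<Delta>" and nonvoid: "{} \<in> \<Delta>"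
  shows "poly (f_polynomial \<Delta>) y = (\<Sum>F\<in>\<Delta>. y ^ card F)"
proof -
  let ?d = "Max (card ` \<Delta>)"
  have fin: "finite \<Delta>" by (rule finite_simplicial_complex[OF \<Delta>])
  have "\<forall>F\<in>\<Delta>. finite F" using \<Delta> unfolding simplicial_complex_def by (meson PowD finite_atLeastAtMost finite_subset subsetD)
  then have zero: "{F \<in> \<Delta>. card F = 0} = {{}}" using nonvoid by auto
  have "(\<Sum>F\<in>\<Delta>. y ^ card F) = (\<Sum>i\<le>?d. \<Sum>F\<in>{F \<in> \<Delta>. card F = i}. y ^ card F)"
    using fin by (intro sum.group[symmetric]) auto
  also have "\<dots> = (\<Sum>i\<le>?d. int (card {F \<in> \<Delta>. card F = i}) * y ^ i)"
    by (intro sum.cong) simp_all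
  also have "\<dots> = 1 + (\<Sum>i<?d. int (face_number \<Delta> i) * y ^ Suc i)"
    unfolding sum.atMost_shift face_number_def by (simp only: zero) simp
  finally show ?thesis by (simp add: f_polynomial_def poly_sum poly_monom)
qed

lemma int_poly_eqI:
  fixes p q :: "int poly"
  assumes "\<And>y. y \<ge> 0 \<Longrightarrow> poly p y = poly q y"
  shows "p = q"
proof (rule ccontr)
  assume "p \<noteq> q"
  then have "finite {y. poly (p - q) y = 0}" by (intro poly_roots_finite) simp
  moreover have "{0..} \<subseteq> {y. poly (p - q) y = 0}" using assms by auto
  ultimately have "finite {0 :: int..}" by (rule rev_finite_subset)
  then show False using infinite_Ici by blast
qed

text \<open>With t = y/(1 + y) and after multiplication by (1 + y)^n, the term t^i (1 - t)^(m - i)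
  becomes (1 + y)^(n - m) y^i. For y \<ge> 0 the denominator does not vanish.\<close>

lemma sum_powers_if_monomials:
  fixes y :: real
  assumes \<Delta>: "simplicial_complex n \<Delta>"
    and eq: "(\<Sum>F\<in>\<Delta>. Polynomial.monom 1 (card F) * one_minus_X ^ (n - card F)) =
      (\<Sum>j\<le>c. of_nat (s choose j) * Polynomial.monom 1 j * one_minus_X ^ (s - j))"
    and s: "c \<le> s" "s \<le> n" and y: "y \<ge> 0"
  shows "(\<Sum>F\<in>\<Delta>. y ^ card F) = (1 + y) ^ (n - s) * (\<Sum>j\<le>c. real (s choose j) * y ^ j)"
proof -
  let ?x = "y / (1 + y)"
  have one_minus: "1 - ?x = 1 / (1 + y)" using y by (simp add: field_simps)
  have pos: "1 + y \<noteq> 0" using y by simp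
  have pow: "(1 + y) ^ n * (?x ^ i * (1 - ?x) ^ (m - i)) = (1 + y) ^ (n - m) * y ^ i" if "i \<le> m" "m \<le> n" for i m
  proof -
    have "(1 + y) ^ n = (1 + y) ^ (n - m) * ((1 + y) ^ i * (1 + y) ^ (m - i))"
      using that by (simp add: power_add[symmetric])
    then show ?thesis
      unfolding one_minus using pos by (simp add: power_divide)
  qed
  have card: "card F \<le> n" if "F \<in> \<Delta>" for F
    using \<Delta> that card_mono[of "{1..n}" F] unfolding simplicial_complex_def by auto
  have "(\<Sum>F\<in>\<Delta>. y ^ card F) = (1 + y) ^ n * (\<Sum>F\<in>\<Delta>. ?x ^ card F * (1 - ?x) ^ (n - card F))"
    unfolding sum_distrib_left by (intro sum.cong) (simp_all add: pow card)
  also have "(\<Sum>F\<in>\<Delta>. ?x ^ card F * (1 - ?x) ^ (n - card F)) =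
      (\<Sum>j\<le>c. real (s choose j) * ?x ^ j * (1 - ?x) ^ (s - j))"
    using arg_cong[OF eq, of "\<lambda>p. poly p ?x"] by (simp add: poly_sum poly_monom)
  also have "(1 + y) ^ n * \<dots> = (\<Sum>j\<le>c. real (s choose j) * ((1 + y) ^ n * (?x ^ j * (1 - ?x) ^ (s - j))))"
    unfolding sum_distrib_left by (intro sum.cong) (simp_all only: ac_simps)
  also have "\<dots> = (\<Sum>j\<le>c. real (s choose j) * ((1 + y) ^ (n - s) * y ^ j))"
    using s by (intro sum.cong) (simp_all add: pow)
  finally show ?thesis by (simp add: sum_distrib_left ac_simps)
qed

text \<open>At nonnegative integers the real identity descends to the integers, and these infinitely
  many values determine the polynomial.\<close>

lemma f_polynomial_eqI:
  assumes \<Delta>: "simplicial_complex n \<Delta>" "{} \<in> \<Delta>"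
    and eq: "(\<Sum>F\<in>\<Delta>. Polynomial.monom 1 (card F) * one_minus_X ^ (n - card F)) =
      (\<Sum>j\<le>c. of_nat (s choose j) * Polynomial.monom 1 j * one_minus_X ^ (s - j))"
    and s: "c \<le> s" "s \<le> n"
  shows "f_polynomial \<Delta> = [:1, 1:] ^ (n - s) * skeleton_f_polynomial s c"
proof (rule int_poly_eqI)
  fix y :: int assume y: "y \<ge> 0"
  have "real_of_int (\<Sum>F\<in>\<Delta>. y ^ card F) =
      real_of_int ((1 + y) ^ (n - s) * (\<Sum>j\<le>c. int (s choose j) * y ^ j))"
    using sum_powers_if_monomials[OF \<Delta>(1) eq s, of "real_of_int y"] y by simp
  then have "(\<Sum>F\<in>\<Delta>. y ^ card F) = (1 + y) ^ (n - s) * (\<Sum>j\<le>c. int (s choose j) * y ^ j)"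
    by (simp only: of_int_eq_iff)
  then show "poly (f_polynomial \<Delta>) y = poly ([:1, 1:] ^ (n - s) * skeleton_f_polynomial s c) y"
    by (simp add: poly_f_polynomial[OF \<Delta>] skeleton_f_polynomial_def poly_sum poly_monom)
qed

theorem proposition3p1:
  fixes n c :: nat and \<Delta> :: "nat set set"
  assumes "simplicial_complex n \<Delta>"
    and "c \<le> n" and "\<forall>F\<subseteq>{1..n}. card F = c \<longrightarrow> F \<in> \<Delta>"
    and "\<And>b. b \<le> n \<Longrightarrow> \<forall>F\<subseteq>{1..n}. card F = b \<longrightarrow> F \<in> \<Delta> \<Longrightarrow> b \<le> c"
    and "bi_cohen_macaulay TYPE('k::field) n \<Delta>"
  shows "\<exists>s\<le>n. f_polynomial \<Delta> = [:1, 1:] ^ (n - s) * skeleton_f_polynomial s c"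
proof -
  note \<Delta> = assms(1)
  have closed: "G \<in> \<Delta>" if "F \<in> \<Delta>" "G \<subseteq> F" for F G
    using \<Delta> that unfolding simplicial_complex_def by blast
  have fin: "finite \<Delta>" by (rule finite_simplicial_complex[OF \<Delta>])
  have small: "F \<in> \<Delta>" if F: "F \<subseteq> {1..n}" "card F \<le> c" for F
  proof -
    obtain G where "F \<subseteq> G" "G \<subseteq> {1..n}" "card G = c"
      using exists_subset_between[of F c "{1..n}"] F assms(2) by auto
    then show ?thesis using closed assms(3) by blast
  qed
  have nonvoid: "{} \<in> \<Delta>" by (rule small) simp_all
  have sub: "F \<subseteq> {1..n}" if "F \<in> \<Delta>" for F using \<Delta> that unfolding simplicial_complex_def by blast
  show ?thesis
  proof (cases "c = n")
    \<comment> \<open>The full simplex: its dual is void and has no face to which the nonnegativity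
      of h could be applied. Here s = n.\<close>
    case True
    have "\<Delta> = Pow {1..n}"
    proof (intro equalityI subsetI)
      fix F assume "F \<in> Pow {1..n}"
      then show "F \<in> \<Delta>" using small[of F] True card_mono[of "{1..n}" F] by simp
    qed (use sub in blast)
    moreover have "(\<Sum>j\<le>n. of_nat (n choose j) * Polynomial.monom 1 j * one_minus_X ^ (n - j)) = ([:0, 1:] + one_minus_X) ^ n"
      unfolding binomial_ring by (simp add: monom_altdef)
    then have "(\<Sum>j\<le>n. of_nat (n choose j) * Polynomial.monom 1 j * one_minus_X ^ (n - j)) = 1"
      by (simp only: X_plus_one_minus_X power_one)
    ultimately have "f_polynomial \<Delta> = [:1, 1:] ^ (n - n) * skeleton_f_polynomial n c"
      using True by (intro f_polynomial_eqI[OF \<Delta> nonvoid]) (simp_all only: sum_Pow_monomials le_refl)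
    then show ?thesis by blast
  next
    case False
    then have cn: "c < n" using assms(2) by simp
    let ?D = "alexander_dual n \<Delta>"
    have "Max (card ` \<Delta>) \<in> card ` \<Delta>" using fin nonvoid by (intro Max_in) auto
    then obtain F0 where F0: "F0 \<in> \<Delta>" "card F0 = Max (card ` \<Delta>)" by auto
    then have F0': "\<forall>F\<in>\<Delta>. card F \<le> card F0" using fin by simp
    define d where "d = card F0"
    have full: "{1..n} \<notin> \<Delta>"
      using assms(4)[of n] cn closed by force
    have "card F0 < card {1..n}"
      using full F0(1) sub[OF F0(1)] by (intro psubset_card_mono) auto
    then have dn: "d < n" by (simp add: d_def)
    obtain C where C: "C \<subseteq> {1..n}" "card C = c" using obtain_subset_with_card_n[of c "{1..n}"] assms(2) by auto
    have cd: "c \<le> d" using small[OF C(1)] C(2) F0' unfolding d_def by auto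
    \<comment> \<open>Maximality of c yields a nonface with c + 1 elements. Its complement is a dual
      face of the largest size n - c - 1, so \<open>h_polynomial_nonneg\<close> applies to the dual
      with this exponent.\<close>
    obtain G where G: "G \<subseteq> {1..n}" "card G = Suc c" "G \<notin> \<Delta>"
      using assms(4)[of "Suc c"] cn by auto
    have D: "simplicial_complex n ?D" by (rule simplicial_complex_alexander_dual[OF \<Delta>])
    have G0: "{1..n} - G \<in> ?D" using G by (simp add: alexander_dual_def double_diff)
    have cardG0: "card ({1..n} - G) = n - Suc c" using G finite_subset[OF G(1)] by (simp add: card_Diff_subset)
    have cardD: "\<forall>F\<in>?D. card F + Suc c \<le> n"
    proof
      fix F assume "F \<in> ?D"
      then have F: "F \<subseteq> {1..n}" "{1..n} - F \<notin> \<Delta>" by (simp_all add: alexander_dual_def)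
      then have "c < card ({1..n} - F)" using small[of "{1..n} - F"] by force
      then show "card F + Suc c \<le> n"
        using F(1) finite_subset[OF F(1)] by (simp add: card_Diff_subset)
    qed
    have CM: "cohen_macaulay TYPE('k) n \<Delta>" "cohen_macaulay TYPE('k) n ?D"
      using assms(5) by (simp_all add: bi_cohen_macaulay_def)
    have h: "coeff (h_polynomial \<Delta> d) i \<ge> 0" for i
      unfolding d_def by (rule h_polynomial_nonneg[OF \<Delta> CM(1) F0(1) F0'])
    have g: "coeff (h_polynomial ?D (n - Suc c)) i \<ge> 0" for i
      using h_polynomial_nonneg[OF D CM(2) G0, of i] cardD unfolding cardG0 by force
    have d: "\<forall>F\<in>\<Delta>. card F \<le> d" using F0' by (simp add: d_def)
    define e where "e = n - d"
    \<comment> \<open>The value required by \<open>skeleton_bezout\<close>; the exponent n - s of 1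
      + t then becomes d - c.\<close>
    define s where "s = e + c"
    have e: "e > 0" using dn by (simp add: e_def)
    obtain h' q' :: "real poly" where h': "one_minus_X ^ e * h' + Polynomial.monom 1 (Suc c) * q' = 1"
      "degree h' \<le> c" "degree q' < e"
      "one_minus_X ^ e * h' = (\<Sum>j\<le>c. of_nat (s choose j) * Polynomial.monom 1 j * one_minus_X ^ (s - j))"
      using skeleton_bezout[OF e, of c] unfolding s_def by blast
    have "h_polynomial \<Delta> d = h'"
      using h_polynomial_alexander_dual[OF \<Delta> d less_imp_le[OF dn] cardD cn] unfolding e_def[symmetric]
      by (rule bezout_solution_unique[OF _ h'(1-3) h g])
    then have "(\<Sum>F\<in>\<Delta>. Polynomial.monom 1 (card F) * one_minus_X ^ (n - card F)) =
        (\<Sum>j\<le>c. of_nat (s choose j) * Polynomial.monom 1 j * one_minus_X ^ (s - j))"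
      using one_minus_X_power_mult_h_polynomial[OF d less_imp_le[OF dn]] h'(4) by (simp add: e_def)
    moreover have "c \<le> s" "s \<le> n" using cd dn by (simp_all add: s_def e_def)
    ultimately show ?thesis using f_polynomial_eqI[OF \<Delta> nonvoid] by blast
  qed
qed

end
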